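(* Let $X$ be a non-trivial mixing subshift of finite type and let $\mu$ be the Gibbs measure of a H\"older continuous potential $f:X\to\mathbb{R}$. Let $\gamma_0=\gamma_0(X,f)\in(0,1)$ be as defined in the context. Then for each $\alpha\in(\gamma_0,1]$ and each $\epsilon>0$ there exists $\rho>0$ such that for all sufficiently large $n$, the escape rate quantity $\varrho(\mu:H_n)$ is well defined and $$\mathbb{P}\Bigl(\bigl|\varrho(\mu:H_n)-\log\alpha\bigr|\ge\epsilon\Bigr)<e^{-\rho n}.$$
   Context: $\mathcal{A}$ is a finite alphabet, $\sigma$ the left shift. $B_m(X)$ is the set of words of length $m$ occurring in points of $X$; for a word $w$ of length $m$, $[w]=\{x\in X: x_0\dots x_{m-1}=w\}$ and $\mu(w)=\mu([w])$. The Gibbs measure $\mu$ of $f$ is the unique equilibrium state of $f$ on $X$. Define $$\gamma_0(X,f)=\inf\{\gamma>0:\exists n_0\ \forall m\ge n_0\ \forall u\in B_m(X),\ \mu(u)\le\gamma^m\}.$$ Random hole: fix $\alpha\in(0,1]$; for each $n\ge1$ let $\mathcal{F}_n\subset B_n(X)$ be the random set obtained by including each word of $B_n(X)$ independently with probability $1-\alpha$ (probability measure $\mathbb{P}$), and let $H_n=\bigcup_{w\in\mathcal{F}_n}[w]$. For a Borel probability measure $\mu$ and hole $H\subset X$, $$\varrho(\mu:H)=\lim_{m\to\infty}\frac1m\log\mu\bigl(\{x\in X:\sigma^j(x)\notin H\ \text{for all } j\in\{0,\dots,m-1\}\}\bigr),$$ whenever the limit exists (with $\log 0=-\infty$). 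*)

theory Defs
  imports "HOL-Probability.Probability"
begin

definition shift :: "(nat \<Rightarrow> 'a) \<Rightarrow> (nat \<Rightarrow> 'a)" where
  "shift x = (\<lambda>i. x (Suc i))"

definition full_shift_top :: "(nat \<Rightarrow> 'a) topology" where
  "full_shift_top = product_topology (\<lambda>_::nat. discrete_topology (UNIV::'a set)) UNIV"

definition full_shift_space :: "(nat \<Rightarrow> 'a) measure" where
  "full_shift_space = PiM UNIV (\<lambda>_::nat. count_space (UNIV::'a set))"

definition occurs_at :: "'a list \<Rightarrow> (nat \<Rightarrow> 'a) \<Rightarrow> nat \<Rightarrow> bool" where
  "occurs_at w x i \<longleftrightarrow> (\<forall>j<length w. x (i + j) = w ! j)"

definition SFT :: "(nat \<Rightarrow> 'a::finite) set \<Rightarrow> bool" where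
  "SFT X \<longleftrightarrow> (\<exists>Fb :: 'a list set. finite Fb \<and>
      X = {x. \<forall>w\<in>Fb. \<forall>i. \<not> occurs_at w x i})"

definition top_mixing :: "(nat \<Rightarrow> 'a) set \<Rightarrow> bool" where
  "top_mixing X \<longleftrightarrow> (\<forall>U V. openin (subtopology full_shift_top X) U \<and>
      openin (subtopology full_shift_top X) V \<and> U \<noteq> {} \<and> V \<noteq> {} \<longrightarrow>
      (\<exists>N. \<forall>n\<ge>N. U \<inter> ((shift ^^ n) -` V) \<noteq> {}))"

definition nontrivial_shift :: "(nat \<Rightarrow> 'a) set \<Rightarrow> bool" where
  "nontrivial_shift X \<longleftrightarrow> (\<exists>x\<in>X. \<exists>y\<in>X. x \<noteq> y)"

text \<open>Hoelder continuity w.r.t. the standard metrics d_theta(x,y) = theta^(first disagreement).\<close>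
definition holder_potential :: "(nat \<Rightarrow> 'a) set \<Rightarrow> ((nat \<Rightarrow> 'a) \<Rightarrow> real) \<Rightarrow> bool" where
  "holder_potential X f \<longleftrightarrow> (\<exists>C \<theta>::real. 0 < \<theta> \<and> \<theta> < 1 \<and>
      (\<forall>x\<in>X. \<forall>y\<in>X. \<forall>k. (\<forall>i<k. x i = y i) \<longrightarrow> \<bar>f x - f y\<bar> \<le> C * \<theta> ^ k))"

definition words :: "nat \<Rightarrow> (nat \<Rightarrow> 'a) set \<Rightarrow> 'a list set" where
  "words m X = {w. length w = m \<and> (\<exists>x\<in>X. occurs_at w x 0)}"

definition cyl :: "(nat \<Rightarrow> 'a) set \<Rightarrow> 'a list \<Rightarrow> (nat \<Rightarrow> 'a) set" where
  "cyl X w = {x\<in>X. occurs_at w x 0}"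

definition inv_prob :: "(nat \<Rightarrow> 'a) set \<Rightarrow> (nat \<Rightarrow> 'a) measure \<Rightarrow> bool" where
  "inv_prob X \<nu> \<longleftrightarrow> sets \<nu> = sets full_shift_space \<and> prob_space \<nu> \<and> emeasure \<nu> X = 1 \<and>
      (\<forall>A\<in>sets \<nu>. emeasure \<nu> (shift -` A) = emeasure \<nu> A)"

text \<open>Measure-theoretic (Kolmogorov-Sinai) entropy, computed with the generating
  partition into cylinders of length one.\<close>
definition ms_entropy :: "(nat \<Rightarrow> 'a) set \<Rightarrow> (nat \<Rightarrow> 'a) measure \<Rightarrow> real" where
  "ms_entropy X \<nu> = lim (\<lambda>n. (1 / real n) *
      (\<Sum>w\<in>words n X. - measure \<nu> (cyl X w) * ln (measure \<nu> (cyl X w))))"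

definition equilibrium_state ::
  "(nat \<Rightarrow> 'a) set \<Rightarrow> ((nat \<Rightarrow> 'a) \<Rightarrow> real) \<Rightarrow> (nat \<Rightarrow> 'a) measure \<Rightarrow> bool" where
  "equilibrium_state X f \<nu> \<longleftrightarrow> inv_prob X \<nu> \<and>
      (\<forall>\<nu>'. inv_prob X \<nu>' \<longrightarrow>
         ms_entropy X \<nu>' + (LINT x:X|\<nu>'. f x) \<le> ms_entropy X \<nu> + (LINT x:X|\<nu>. f x))"

definition gibbs_measure ::
  "(nat \<Rightarrow> 'a) set \<Rightarrow> ((nat \<Rightarrow> 'a) \<Rightarrow> real) \<Rightarrow> (nat \<Rightarrow> 'a) measure \<Rightarrow> bool" where
  "gibbs_measure X f \<mu> \<longleftrightarrow> equilibrium_state X f \<mu> \<and>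
      (\<forall>\<nu>. equilibrium_state X f \<nu> \<longrightarrow> \<nu> = \<mu>)"

definition gamma0 :: "(nat \<Rightarrow> 'a) set \<Rightarrow> (nat \<Rightarrow> 'a) measure \<Rightarrow> real" where
  "gamma0 X \<mu> = Inf {\<gamma>::real. \<gamma> > 0 \<and>
      (\<exists>n0. \<forall>m\<ge>n0. \<forall>u\<in>words m X. measure \<mu> (cyl X u) \<le> \<gamma> ^ m)}"

definition hole :: "(nat \<Rightarrow> 'a) set \<Rightarrow> 'a list set \<Rightarrow> (nat \<Rightarrow> 'a) set" where
  "hole X F = (\<Union>w\<in>F. cyl X w)"

definition survivors :: "(nat \<Rightarrow> 'a) set \<Rightarrow> (nat \<Rightarrow> 'a) set \<Rightarrow> nat \<Rightarrow> (nat \<Rightarrow> 'a) set" where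
  "survivors X H m = {x\<in>X. \<forall>j<m. (shift ^^ j) x \<notin> H}"

definition log_ext :: "real \<Rightarrow> ereal" where
  "log_ext r = (if r = 0 then - \<infinity> else ereal (ln r))"

definition escape_seq ::
  "(nat \<Rightarrow> 'a) measure \<Rightarrow> (nat \<Rightarrow> 'a) set \<Rightarrow> (nat \<Rightarrow> 'a) set \<Rightarrow> nat \<Rightarrow> ereal" where
  "escape_seq \<mu> X H m = ereal (1 / real m) * log_ext (measure \<mu> (survivors X H m))"

definition escape_rate_defined ::
  "(nat \<Rightarrow> 'a) measure \<Rightarrow> (nat \<Rightarrow> 'a) set \<Rightarrow> (nat \<Rightarrow> 'a) set \<Rightarrow> bool" where
  "escape_rate_defined \<mu> X H \<longleftrightarrow> (\<exists>L. escape_seq \<mu> X H \<longlonglongrightarrow> L)"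

definition escape_rate ::
  "(nat \<Rightarrow> 'a) measure \<Rightarrow> (nat \<Rightarrow> 'a) set \<Rightarrow> (nat \<Rightarrow> 'a) set \<Rightarrow> ereal" where
  "escape_rate \<mu> X H = lim (escape_seq \<mu> X H)"

text \<open>Law of the random set F_n: each word of B_n(X) included independently with
  probability 1 - alpha. hole_prob gives the probability of the event E.\<close>
definition hole_prob :: "(nat \<Rightarrow> 'a) set \<Rightarrow> real \<Rightarrow> nat \<Rightarrow> ('a list set \<Rightarrow> bool) \<Rightarrow> real" where
  "hole_prob X \<alpha> n E = (\<Sum>F\<in>Pow (words n X).
      if E F then (1 - \<alpha>) ^ card F * \<alpha> ^ card (words n X - F) else 0)"

end

theory Submission
  imports Defs "HOL-Complex_Analysis.Great_Picard"
begin

text \<open>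
  The only property of \<open>\<mu>\<close> that matters is the quasi-Bernoulli estimate: \<open>\<mu>(uv)\<close> and \<open>\<mu>(u) \<mu>(v)\<close>
  agree up to a constant whenever \<open>uv\<close> is a word of \<open>X\<close>. To obtain it, an invariant measure with
  the Gibbs property is built as a limit of averaged weights \<open>exp (S\<^sub>m f)\<close>; the Gibbs inequality shows
  that it is an equilibrium state, and by uniqueness it is \<open>\<mu>\<close>.

  Let \<open>m = K n\<close> with \<open>K\<close> large but fixed. A word \<open>w\<close> of length \<open>m\<close> avoids the random set with
  probability \<open>\<alpha>\<close> to the number of its distinct windows of length \<open>n\<close>. In every block of \<open>n\<close> letters,
  once a window repeats an earlier one the rest of the block is determined, so each lost factor
  \<open>\<alpha>\<close> is compensated by a factor \<open>\<gamma> < \<alpha>\<close> of measure; hence the expected measure of avoiding words is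
  \<open>\<alpha>\<^sup>m\<close> up to polynomial factors and a bounded power of \<open>\<alpha>\<^sup>n\<close>. As the surviving measure is submultiplicative in the
  length, Markov's inequality bounds the escape rate from above. For the lower bound, the measure of
  avoiding loops has mean at least a constant times \<open>\<alpha>\<^sup>m\<close> and relative variance of order \<open>(\<gamma>/\<alpha>)\<^sup>n\<close>, because two loops with a
  common window can be rotated so that the second one starts with \<open>n\<close> determined letters. Loops with
  the same initial word concatenate freely, so Chebyshev's inequality bounds the escape rate from below.
\<close>

section \<open>Limits of almost subadditive sequences\<close>

text \<open>Why \<open>m\<close> is a large but fixed multiple of \<open>n\<close>: both tails lose
  a factor exponential in \<open>n\<close>. For the upper tail it is
  \<open>(1 / \<alpha>) ^ n\<close>, from windows that wrap around the end of a word; for the lower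
  tail it is the number of words of \<open>n\<close> letters, since loops concatenate only when they
  share a prefix. A deviation by \<epsilon> gains \<open>exp (- \<epsilon> * K * n)\<close>, which
  beats both once \<open>K\<close> is large. On the other hand every block multiplies the estimates
  by a polynomial in \<open>n\<close>, so the total loss stays polynomial only for bounded
  \<open>K\<close>. Working block by block is essential here: within a block only the first repeat
  is recorded, at the cost of a union bound, and everything after it is given up.

  Why loops: in a second moment the common window may sit anywhere in the second word. In a linear
  word it could not be moved to the front, where a prescribed block is easy to estimate; a loop can
  be rotated, at bounded cost. The strict inequality between the decay rate and \<alpha> enters
  through the variance, whose relative size must decay exponentially.\<close>

lemma subadditive_mult:
  fixes a :: "nat \<Rightarrow> real"
  assumes "\<And>m k. m \<ge> 1 \<Longrightarrow> k \<ge> 1 \<Longrightarrow> a (m + k) \<le> a m + a k" "m \<ge> 1" "q \<ge> 1"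
  shows "a (q * m) \<le> real q * a m"
  using assms(3)
proof (induction q rule: dec_induct)
  case base
  then show ?case by simp
next
  case (step q)
  have "a (Suc q * m) \<le> a m + a (q * m)"
    using assms(1)[of m "q * m"] assms(2) step by simp
  with step show ?case by (simp add: algebra_simps)
qed

lemma fekete:
  fixes a :: "nat \<Rightarrow> real"
  assumes sub: "\<And>m k. m \<ge> 1 \<Longrightarrow> k \<ge> 1 \<Longrightarrow> a (m + k) \<le> a m + a k"
    and bdd: "\<And>m. m \<ge> 1 \<Longrightarrow> a m \<ge> - c * real m"
  obtains L where "(\<lambda>m. a m / real m) \<longlonglongrightarrow> L" "\<And>m. m \<ge> 1 \<Longrightarrow> L * real m \<le> a m"
proof -
  define L where "L = (INF m\<in>{1..}. a m / real m)"
  have bb: "bdd_below ((\<lambda>m. a m / real m) ` {1..})"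
  proof (rule bdd_belowI2)
    fix m :: nat assume "m \<in> {1..}"
    then show "- c \<le> a m / real m" using bdd[of m] by (simp add: field_simps)
  qed
  have le: "L \<le> a m / real m" if "m \<ge> 1" for m
    unfolding L_def using that by (intro cINF_lower bb) auto
  have "(\<lambda>m. a m / real m) \<longlonglongrightarrow> L"
  proof (rule LIMSEQ_I)
    fix e :: real assume e: "e > 0"
    have "\<exists>m\<in>{1..}. a m / real m < L + e / 2"
      using e bb unfolding L_def by (intro cINF_less_iff[THEN iffD1]) auto
    then obtain p where p: "p \<ge> 1" "a p / real p < L + e / 2" by auto
    define M where "M = Max ((\<lambda>r. \<bar>a r\<bar>) ` {..p + p}) + (\<bar>L\<bar> + e) * 2 * real p"
    have M0: "\<bar>a r\<bar> + (\<bar>L\<bar> + e) * 2 * real p \<le> M" if "r \<le> p + p" for r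
      using that by (auto simp: M_def intro!: Max_ge)
    have up: "a m \<le> (L + e / 2) * real m + M" if m: "m \<ge> p + p" for m
    proof -
      \<comment> \<open>The remainder is kept between \<open>p\<close> and \<open>2 p\<close>
        instead of 0 and \<open>p\<close>, because subadditivity is assumed only for positive
        indices.\<close>
      define q where "q = m div p - 1"
      define r where "r = p + m mod p"
      have d2: "m div p \<ge> 2" using m p by (metis div_le_mono div_mult_self_is_m mult_2 le_trans order_refl less_le_trans zero_less_one)
      have m': "m = q * p + r"
      proof -
        have "m = (m div p) * p + m mod p" by simp
        also have "m div p = q + 1" using d2 by (simp add: q_def)
        finally show ?thesis by (simp add: r_def)
      qed
      have q1: "q \<ge> 1" using d2 by (simp add: q_def)
      have r: "r \<ge> 1" "r \<le> p + p" using p by (simp_all add: r_def less_imp_le)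
      have "q * p \<ge> 1" using q1 p by simp
      then have "a m \<le> a (q * p) + a r" using sub[of "q * p" r] r m' by simp
      also have "a (q * p) \<le> real q * a p" by (rule subadditive_mult[OF sub p(1) q1])
      also have "\<dots> \<le> real q * ((L + e / 2) * real p)"
        using p by (intro mult_left_mono) (auto simp: field_simps)
      also have "\<dots> = (L + e / 2) * real m - (L + e / 2) * real r"
        by (simp add: m' algebra_simps)
      finally have 1: "a m \<le> (L + e / 2) * real m - (L + e / 2) * real r + a r" by simp
      have 2: "- ((L + e / 2) * real r) \<le> (\<bar>L\<bar> + e) * 2 * real p"
      proof -
        have "- ((L + e / 2) * real r) \<le> (\<bar>L\<bar> + e) * real r"
          unfolding minus_mult_left by (intro mult_right_mono) (use e in auto)
        also have "\<dots> \<le> (\<bar>L\<bar> + e) * (2 * real p)"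
          using r e by (intro mult_left_mono) auto
        finally show ?thesis unfolding mult.assoc .
      qed
      show ?thesis using 1 2 M0[OF r(2)] by linarith
    qed
    have "(\<lambda>m. (L + e / 2) + M / real m) \<longlonglongrightarrow> (L + e / 2) + 0"
      by (intro tendsto_intros lim_const_over_n)
    then have "\<forall>\<^sub>F m in sequentially. (L + e / 2) + M / real m < L + e"
      using e by (intro order_tendstoD(2)[where y = "L + e / 2 + 0"]) auto
    then have "\<forall>\<^sub>F m in sequentially. norm (a m / real m - L) < e"
      using eventually_ge_at_top[of "p + p"]
    proof eventually_elim
      case (elim m)
      have m1: "m \<ge> 1" using elim p by linarith
      have "a m / real m \<le> ((L + e / 2) * real m + M) / real m"
        using up[OF elim(2)] by (intro divide_right_mono) auto
      also have "\<dots> = (L + e / 2) + M / real m" using m1 by (simp add: field_simps)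
      finally show ?case using elim(1) le[OF m1] by auto
    qed
    then show "\<exists>no. \<forall>n\<ge>no. norm (a n / real n - L) < e"
      by (simp add: eventually_sequentially)
  qed
  moreover have "L * real m \<le> a m" if "m \<ge> 1" for m
    using le[OF that] that by (simp add: field_simps)
  ultimately show ?thesis using that by blast
qed

text \<open>Adding the constant \<open>d\<close> to the sequence absorbs the defect.\<close>

lemma almost_subadditive_limit:
  fixes a :: "nat \<Rightarrow> real"
  assumes sub: "\<And>m k. m \<ge> 1 \<Longrightarrow> k \<ge> 1 \<Longrightarrow> a (m + k) \<le> a m + a k + d"
    and bdd: "\<And>m. m \<ge> 1 \<Longrightarrow> a m + d \<ge> - c * real m"
  obtains L where "(\<lambda>m. a m / real m) \<longlonglongrightarrow> L" "\<And>m. m \<ge> 1 \<Longrightarrow> L * real m \<le> a m + d"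
proof -
  obtain L where L: "(\<lambda>m. (a m + d) / real m) \<longlonglongrightarrow> L" "\<And>m. m \<ge> 1 \<Longrightarrow> L * real m \<le> a m + d"
  proof (rule fekete[of "\<lambda>m. a m + d" c])
    fix m k :: nat assume "1 \<le> m" "1 \<le> k"
    then show "a (m + k) + d \<le> a m + d + (a k + d)" using sub[of m k] by simp
  qed (use bdd in auto)
  have "(\<lambda>m. (a m + d) / real m - d / real m) \<longlonglongrightarrow> L - 0"
    by (intro tendsto_diff L lim_const_over_n)
  then show ?thesis using that L(2) by (simp add: diff_divide_distrib[symmetric])
qed

text \<open>The limits for \<open>a\<close> and \<open>- a\<close> are opposite numbers, and the
  one-sided Fekete inequality for each yields the two-sided bound. The facts \<open>lo\<close>
  supply the linear lower bounds that Fekete's lemma demands.\<close>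

lemma almost_additive_bound:
  fixes a :: "nat \<Rightarrow> real"
  assumes add: "\<And>m k. m \<ge> 1 \<Longrightarrow> k \<ge> 1 \<Longrightarrow> \<bar>a (m + k) - a m - a k\<bar> \<le> d"
  obtains P where "\<And>m. m \<ge> 1 \<Longrightarrow> \<bar>a m - P * real m\<bar> \<le> d"
proof -
  have lo: "a m \<ge> real m * (a 1 - d) + d" "a m \<le> real m * (a 1 + d) - d" if "m \<ge> 1" for m
  proof -
    have "a m \<ge> real m * (a 1 - d) + d \<and> a m \<le> real m * (a 1 + d) - d" using that
    proof (induction m rule: dec_induct)
      case (step m)
      then show ?case using add[of m 1] by (simp add: algebra_simps abs_le_iff)
    qed simp
    then show "a m \<ge> real m * (a 1 - d) + d" "a m \<le> real m * (a 1 + d) - d" by auto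
  qed
  have d0: "d \<ge> 0" using add[of 1 1] by linarith
  obtain L where L: "(\<lambda>m. a m / real m) \<longlonglongrightarrow> L" "\<And>m. m \<ge> 1 \<Longrightarrow> L * real m \<le> a m + d"
  proof (rule almost_subadditive_limit[of a d "d - a 1"])
    fix m k :: nat assume "1 \<le> m" "1 \<le> k"
    then show "a (m + k) \<le> a m + a k + d" using add[of m k] by linarith
  next
    fix m :: nat assume "1 \<le> m"
    then show "- (d - a 1) * real m \<le> a m + d" using lo(1)[of m] d0 by (simp add: algebra_simps)
  qed (use that in blast)
  obtain L' where L': "(\<lambda>m. - a m / real m) \<longlonglongrightarrow> L'" "\<And>m. m \<ge> 1 \<Longrightarrow> L' * real m \<le> - a m + d"
  proof (rule almost_subadditive_limit[of "\<lambda>m. - a m" d "a 1 + d"])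
    fix m k :: nat assume "1 \<le> m" "1 \<le> k"
    then show "- a (m + k) \<le> - a m + - a k + d" using add[of m k] by linarith
  next
    fix m :: nat assume "1 \<le> m"
    then show "- (a 1 + d) * real m \<le> - a m + d" using lo(2)[of m] d0 by (simp add: algebra_simps)
  qed (use that in blast)
  have "(\<lambda>m. - (a m / real m)) \<longlonglongrightarrow> - L" by (intro tendsto_minus L)
  then have "L' = - L" using L'(1) LIMSEQ_unique by fastforce
  then have "\<bar>a m - L * real m\<bar> \<le> d" if "m \<ge> 1" for m
    using L(2)[OF that] L'(2)[OF that] by simp
  then show ?thesis using that by blast
qed

text \<open>Nonnegativity of relative entropy, from \<open>ln t \<le> t - 1\<close>. It serves
  twice: with a product of marginals as \<open>q\<close> it makes entropy subadditive, and with the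
  Gibbs weights as \<open>q\<close> it bounds entropy plus energy by the pressure.\<close>

lemma gibbs_inequality:
  fixes p q :: "'b \<Rightarrow> real"
  assumes fin: "finite S" and p: "\<And>i. i \<in> S \<Longrightarrow> p i \<ge> 0" "sum p S = 1"
    and q: "\<And>i. i \<in> S \<Longrightarrow> q i \<ge> 0" "sum q S \<le> 1"
    and ac: "\<And>i. i \<in> S \<Longrightarrow> q i = 0 \<Longrightarrow> p i = 0"
  shows "(\<Sum>i\<in>S. - p i * ln (p i)) \<le> (\<Sum>i\<in>S. - p i * ln (q i))"
proof -
  have "(\<Sum>i\<in>S. - p i * ln (p i)) - (\<Sum>i\<in>S. - p i * ln (q i)) = (\<Sum>i\<in>S. p i * ln (q i) - p i * ln (p i))"
    by (simp add: sum_subtractf sum_negf)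
  also have "\<dots> \<le> (\<Sum>i\<in>S. q i - p i)"
  proof (rule sum_mono)
    fix i assume i: "i \<in> S"
    show "p i * ln (q i) - p i * ln (p i) \<le> q i - p i"
    proof (cases "p i = 0")
      case True
      then show ?thesis using q(1)[OF i] by simp
    next
      case False
      then have pp: "p i > 0" "q i > 0" using p(1)[OF i] q(1)[OF i] ac[OF i] by (auto simp: less_le)
      have "p i * ln (q i) - p i * ln (p i) = p i * ln (q i / p i)"
        using pp by (simp add: ln_div algebra_simps)
      also have "\<dots> \<le> p i * (q i / p i - 1)"
        using pp by (intro mult_left_mono ln_le_minus_one) auto
      also have "\<dots> = q i - p i" using pp by (simp add: field_simps)
      finally show ?thesis .
    qed
  qed
  also have "\<dots> \<le> 0" using p q by (simp add: sum_subtractf)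
  finally show ?thesis by simp
qed

section \<open>Sums over words of fixed length\<close>

abbreviation listsn :: "nat \<Rightarrow> 'a list set" where
  "listsn n \<equiv> {w. length w = n}"

lemma finite_listsn [simp]: "finite (listsn n :: 'a::finite list set)"
  using finite_lists_length_eq[of "UNIV :: 'a set" n] by simp

lemma sum_listsn_append:
  fixes F :: "'a::finite list \<Rightarrow> real"
  shows "(\<Sum>w\<in>listsn (m + k). F w) = (\<Sum>u\<in>listsn m. \<Sum>v\<in>listsn k. F (u @ v))"
proof -
  have "(\<Sum>u\<in>listsn m. \<Sum>v\<in>listsn k. F (u @ v)) = (\<Sum>(u,v)\<in>listsn m \<times> listsn k. F (u @ v))"
    by (simp add: sum.cartesian_product)
  also have "\<dots> = (\<Sum>w\<in>listsn (m + k). F w)"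
    by (rule sum.reindex_bij_witness[of _ "\<lambda>w. (take m w, drop m w)" "\<lambda>(u,v). u @ v"]) auto
  finally show ?thesis by simp
qed

lemma listsn_1: "listsn (Suc 0) = range (\<lambda>a. [a])"
  by (auto simp: length_Suc_conv)

lemma sum_listsn_1: "(\<Sum>w\<in>listsn (Suc 0). F w) = (\<Sum>a\<in>UNIV. F [a])"
  by (simp add: listsn_1 sum.reindex inj_on_def)

section \<open>Subshifts of finite type\<close>

definition win :: "(nat \<Rightarrow> 'a) \<Rightarrow> nat \<Rightarrow> nat \<Rightarrow> 'a list" where
  "win x i n = map (\<lambda>l. x (i + l)) [0..<n]"

lemma length_win [simp]: "length (win x i n) = n"
  by (simp add: win_def)

lemma nth_win [simp]: "l < n \<Longrightarrow> win x i n ! l = x (i + l)"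
  by (simp add: win_def)

lemma win_eq_iff: "win x i n = w \<longleftrightarrow> length w = n \<and> (\<forall>l<n. w ! l = x (i + l))"
  by (auto simp: list_eq_iff_nth_eq)

lemma win_add: "win x i (m + k) = win x i m @ win x (i + m) k"
  by (auto simp: list_eq_iff_nth_eq nth_append add.assoc)

lemma win_0 [simp]: "win x i 0 = []"
  by (simp add: win_def)

lemma win_1 [simp]: "win x i (Suc 0) = [x i]"
  by (simp add: win_def)

lemma shift_funpow: "(shift ^^ j) x = (\<lambda>i. x (i + j))"
  by (induction j arbitrary: x) (auto simp: shift_def fun_eq_iff)

lemma win_shift_funpow [simp]: "win ((shift ^^ j) x) i n = win x (i + j) n"
  by (simp add: win_def shift_funpow ac_simps)

lemma win_shift [simp]: "win (shift x) i n = win x (Suc i) n"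
  by (simp add: win_def shift_def)

lemma occurs_at_iff_win: "occurs_at w x i \<longleftrightarrow> win x i (length w) = w"
  by (auto simp: occurs_at_def win_eq_iff)

lemma words_eq_win: "words n X = (\<lambda>x. win x 0 n) ` X"
  by (auto simp: words_def occurs_at_iff_win image_iff) metis

lemma cyl_eq_win: "cyl X w = {x \<in> X. win x 0 (length w) = w}"
  by (auto simp: cyl_def occurs_at_iff_win)

lemma finite_words [simp]: "finite (words n X :: 'a::finite list set)"
  by (rule finite_subset[OF _ finite_listsn[of n]]) (auto simp: words_def)

lemma words_subset_listsn: "words n X \<subseteq> listsn n"
  by (auto simp: words_def)

abbreviation language :: "(nat \<Rightarrow> 'a) set \<Rightarrow> 'a list set" where
  "language X \<equiv> {w. w \<in> words (length w) X}"

lemma cyl_nonempty_iff: "cyl X w \<noteq> {} \<longleftrightarrow> w \<in> language X"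
  by (auto simp: cyl_eq_win words_eq_win image_iff) metis

lemma cyl_Nil [simp]: "cyl X [] = X"
  by (auto simp: cyl_eq_win)

lemma openin_cyl: "openin (subtopology full_shift_top X) (cyl X w)"
proof -
  let ?S = "\<lambda>i. if i < length w then {w ! i} else UNIV"
  have "openin full_shift_top (PiE UNIV ?S)"
    unfolding full_shift_top_def
    by (subst openin_PiE_gen) (auto intro: finite_subset[of _ "{..<length w}"])
  moreover have "cyl X w = PiE UNIV ?S \<inter> X"
    by (auto simp: cyl_eq_win win_eq_iff PiE_iff split: if_splits)
  ultimately show ?thesis by (auto simp: openin_subtopology)
qed

locale sft =
  fixes X :: "(nat \<Rightarrow> 'a::finite) set"
  assumes sft: "SFT X"
begin

lemma shift_closed: "x \<in> X \<Longrightarrow> (shift ^^ j) x \<in> X"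
proof -
  obtain Fb where X: "X = {x. \<forall>w\<in>Fb. \<forall>i. win x i (length w) \<noteq> w}"
    using sft unfolding SFT_def occurs_at_iff_win by blast
  then show "x \<in> X \<Longrightarrow> (shift ^^ j) x \<in> X"
    unfolding X by simp
qed

lemma win_in_words: "x \<in> X \<Longrightarrow> win x i n \<in> words n X"
  using shift_closed[of x i] by (force simp: words_eq_win)

lemma language_appendD1: "u @ v \<in> language X \<Longrightarrow> u \<in> language X"
  by (auto simp: words_eq_win win_add)

lemma language_appendD2:
  assumes "u @ v \<in> language X"
  shows "v \<in> language X"
proof -
  obtain x where "x \<in> X" "win x 0 (length u + length v) = u @ v"
    using assms by (auto simp: words_eq_win)
  then have "win x (length u) (length v) = v" by (simp add: win_add)
  then show ?thesis using win_in_words[OF \<open>x \<in> X\<close>] by (metis mem_Collect_eq)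
qed

text \<open>A window at least as long as every forbidden word shows any forbidden occurrence, so
  membership in \<open>X\<close> is a local condition. Gluing and periodic points both rest on
  this.\<close>

lemma memory_ex: "\<exists>k\<ge>1. \<forall>n\<ge>k. \<forall>x. x \<in> X \<longleftrightarrow> (\<forall>i. win x i n \<in> words n X)"
proof -
  obtain Fb where fin: "finite Fb" and X: "X = {x. \<forall>w\<in>Fb. \<forall>i. win x i (length w) \<noteq> w}"
    using sft unfolding SFT_def occurs_at_iff_win by blast
  define k where "k = Suc (Max (insert 0 (length ` Fb)))"
  have k: "length w \<le> k" if "w \<in> Fb" for w
    using fin that by (auto simp: k_def intro!: le_SucI Max_ge)
  have "x \<in> X" if n: "n \<ge> k" and wi: "\<forall>i. win x i n \<in> words n X" for n x
  proof -
    have False if w: "w \<in> Fb" "win x i (length w) = w" for w i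
    proof -
      obtain y where y: "y \<in> X" "win y 0 n = win x i n"
        using wi by (auto simp: words_eq_win image_iff) metis
      have "win y 0 (length w) = w"
        using y(2) w(2) k[OF w(1)] n by (auto simp: win_eq_iff)
      with y(1) w(1) show False by (auto simp: X)
    qed
    then show ?thesis unfolding X by blast
  qed
  then show ?thesis using win_in_words by (intro exI[of _ k]) (auto simp: k_def)
qed

definition memory :: nat where
  "memory = (SOME k. k \<ge> 1 \<and> (\<forall>n\<ge>k. \<forall>x. x \<in> X \<longleftrightarrow> (\<forall>i. win x i n \<in> words n X)))"

lemma memory: "memory \<ge> 1" "n \<ge> memory \<Longrightarrow> x \<in> X \<longleftrightarrow> (\<forall>i. win x i n \<in> words n X)"
  using someI_ex[OF memory_ex] unfolding memory_def[symmetric] by blast+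

end

locale mixing_sft = sft +
  assumes mixing: "top_mixing X" and nonempty: "X \<noteq> {}"
begin

lemma mixing_words:
  assumes "p \<in> language X" "q \<in> language X"
  shows "\<exists>N. \<forall>n\<ge>N. \<exists>x\<in>X. win x 0 (length p) = p \<and> win x n (length q) = q"
proof -
  obtain N where N: "\<forall>n\<ge>N. cyl X p \<inter> ((shift ^^ n) -` cyl X q) \<noteq> {}"
    using mixing[unfolded top_mixing_def, rule_format, of "cyl X p" "cyl X q"] assms
    by (auto simp: openin_cyl cyl_nonempty_iff)
  show ?thesis
  proof (intro exI[of _ N] allI impI)
    fix n assume "n \<ge> N"
    then obtain x where "x \<in> cyl X p" "(shift ^^ n) x \<in> cyl X q" using N by blast
    then show "\<exists>x\<in>X. win x 0 (length p) = p \<and> win x n (length q) = q"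
      by (auto simp: cyl_eq_win)
  qed
qed

text \<open>There are finitely many pairs of words of length \<open>k\<close>, so the waiting times
  have a maximum. It is taken at least \<open>k\<close> because the gluing below needs the two
  windows to be disjoint.\<close>

lemma uniform_mixing:
  "\<exists>N\<ge>k. \<forall>p\<in>words k X. \<forall>q\<in>words k X. \<exists>x\<in>X. win x 0 k = p \<and> win x N k = q"
proof -
  let ?P = "\<lambda>p q N. \<forall>n\<ge>N. \<exists>x\<in>X. win x 0 k = p \<and> win x n k = q"
  have "\<forall>p\<in>words k X. \<forall>q\<in>words k X. \<exists>N. ?P p q N"
  proof (intro ballI)
    fix p q assume "p \<in> words k X" "q \<in> words k X"
    then have "length p = k" "p \<in> language X" "length q = k" "q \<in> language X"
      by (auto simp: words_def)
    then show "\<exists>N. ?P p q N" using mixing_words[of p q] by simp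
  qed
  then obtain N where N: "\<And>p q. p \<in> words k X \<Longrightarrow> q \<in> words k X \<Longrightarrow> ?P p q (N p q)"
    by (metis (no_types, lifting))
  define M where "M = Max (insert k ((\<lambda>(p, q). N p q) ` (words k X \<times> words k X)))"
  have M: "N p q \<le> M" if "p \<in> words k X" "q \<in> words k X" for p q
    unfolding M_def using that by (intro Max_ge) auto
  have "k \<le> M" unfolding M_def by (intro Max_ge) auto
  moreover have "\<exists>x\<in>X. win x 0 k = p \<and> win x M k = q" if "p \<in> words k X" "q \<in> words k X" for p q
    using N[OF that] M[OF that] by simp
  ultimately show ?thesis by auto
qed

text \<open>The bridge length does not depend on \<open>u\<close> and \<open>v\<close>: only
  \<open>memory\<close> letters at each junction matter, and there are finitely many possibilities
  for them.\<close>

lemma gap_ex: "\<exists>G. \<forall>u\<in>language X. \<forall>v\<in>language X. \<exists>a. length a = G \<and> u @ a @ v \<in> language X"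
proof -
  define k where "k = memory"
  obtain N where N: "N \<ge> k" "\<And>p q. p \<in> words k X \<Longrightarrow> q \<in> words k X \<Longrightarrow> \<exists>x\<in>X. win x 0 k = p \<and> win x N k = q"
    using uniform_mixing by blast
  show ?thesis
  proof (intro exI[of _ N] ballI)
    fix u v assume u: "u \<in> language X" and v: "v \<in> language X"
    define m where "m = length u"
    obtain x where x: "x \<in> X" "win x 0 m = u" using u by (auto simp: words_eq_win m_def)
    obtain y where y: "y \<in> X" "win y 0 (length v) = v" using v by (auto simp: words_eq_win)
    obtain z where z: "z \<in> X" "win z 0 k = win x m k" "win z N k = win y 0 k"
      using N(2)[OF win_in_words[OF x(1)] win_in_words[OF y(1)]] by blast
    have zx: "z l = x (m + l)" if "l < k" for l
      using arg_cong[OF z(2), of "\<lambda>w. w ! l"] that by simp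
    have zy: "z (N + l) = y l" if "l < k" for l
      using arg_cong[OF z(3), of "\<lambda>w. w ! l"] that by simp
    \<comment> \<open>Neighbouring pieces agree on \<open>k\<close> letters beyond each junction, so
      every window of length \<open>k\<close> of \<open>t\<close> is a window of \<open>x\<close>,
      \<open>z\<close> or \<open>y\<close>.\<close>
    define t where "t i = (if i < m then x i else if i < m + N then z (i - m) else y (i - (m + N)))" for i
    have t1: "t i = x i" if "i < m + k" for i
      using that zx[of "i - m"] N(1) by (auto simp: t_def)
    have t2: "t i = z (i - m)" if "m \<le> i" "i < m + N + k" for i
      using that zy[of "i - (m + N)"] by (auto simp: t_def)
    have t3: "t i = y (i - (m + N))" if "m + N \<le> i" for i
      using that by (auto simp: t_def)
    have "win t i k \<in> words k X" for i
    proof -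
      consider "i < m" | "m \<le> i" "i < m + N" | "m + N \<le> i" by linarith
      then show ?thesis
      proof cases
        case 1
        then have "win t i k = win x i k" by (auto simp: win_eq_iff t1)
        then show ?thesis using win_in_words[OF x(1)] by simp
      next
        case 2
        then have "win t i k = win z (i - m) k" by (auto simp: win_eq_iff t2)
        then show ?thesis using win_in_words[OF z(1)] by simp
      next
        case 3
        then have "win t i k = win y (i - (m + N)) k" by (auto simp: win_eq_iff t3)
        then show ?thesis using win_in_words[OF y(1)] by simp
      qed
    qed
    then have tX: "t \<in> X" using memory(2)[of k] by (simp add: k_def)
    have "win t 0 m = u" using x(2) t1 by (auto simp: win_eq_iff)
    moreover have "win t (m + N) (length v) = v"
      using y(2) t3 by (auto simp: win_eq_iff)
    ultimately have "win t 0 (m + (N + length v)) = u @ win t m N @ v"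
      by (simp add: win_add)
    then have "u @ win t m N @ v \<in> language X"
      using win_in_words[OF tX, of 0 "m + (N + length v)"] by (simp add: m_def)
    then show "\<exists>a. length a = N \<and> u @ a @ v \<in> language X"
      by (intro exI[of _ "win t m N"]) auto
  qed
qed

definition gap :: nat where
  "gap = (SOME G. \<forall>u\<in>language X. \<forall>v\<in>language X. \<exists>a. length a = G \<and> u @ a @ v \<in> language X)"

lemma gap:
  assumes "u \<in> language X" "v \<in> language X"
  obtains a where "length a = gap" "u @ a @ v \<in> language X"
  using someI_ex[OF gap_ex] assms unfolding gap_def[symmetric] by blast

lemma words_nonempty: "words n X \<noteq> {}"
  using nonempty by (simp add: words_eq_win)

end

section \<open>Invariant Gibbs weights\<close>

lemma prod_sum_listsn:
  fixes F G :: "'a::finite list \<Rightarrow> real"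
  shows "(\<Sum>u\<in>listsn m. F u) * (\<Sum>v\<in>listsn k. G v) = (\<Sum>u\<in>listsn m. \<Sum>v\<in>listsn k. F u * G v)"
  by (simp add: sum_product)

text \<open>This is all that the construction of the invariant measure uses of a Hoelder potential.
  The lower inequality is confined to admissible words; mixing makes up for that by inserting a
  bridge.\<close>

locale quasi_multiplicative = mixing_sft X for X :: "(nat \<Rightarrow> 'a::finite) set" +
  fixes g :: "'a list \<Rightarrow> real" and D :: real
  assumes g_pos: "w \<in> language X \<Longrightarrow> g w > 0"
    and g_zero: "w \<notin> language X \<Longrightarrow> g w = 0"
    and D: "D \<ge> 1"
    and g_upper: "g (u @ v) \<le> D * g u * g v"
    and g_lower: "u @ v \<in> language X \<Longrightarrow> g u * g v \<le> D * g (u @ v)"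
begin

lemma g_nonneg: "g w \<ge> 0"
  using g_pos[of w] g_zero[of w] by (cases "w \<in> language X") auto

definition gap_const :: real where
  "gap_const = Min (g ` words gap X) / D ^ 2"

lemma gap_const_pos: "gap_const > 0"
  unfolding gap_const_def using D words_nonempty
  by (intro divide_pos_pos) (auto simp: words_def intro!: g_pos)

text \<open>A single admissible bridge \<open>a\<close> already gives the bound: cutting
  \<open>u @ a @ v\<close> in two places costs \<open>D ^ 2\<close>, and \<open>g a\<close> is at
  least the minimum in \<open>gap_const\<close>.\<close>

lemma gap_sum: "gap_const * (g u * g v) \<le> (\<Sum>a\<in>listsn gap. g (u @ a @ v))"
proof (cases "u \<in> language X \<and> v \<in> language X")
  case True
  then obtain a where a: "length a = gap" "u @ a @ v \<in> language X"
    using gap by blast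
  have "a \<in> words gap X"
    using language_appendD1[OF language_appendD2[OF a(2)]] a(1) by simp
  then have "Min (g ` words gap X) \<le> g a" by (intro Min_le) auto
  then have "Min (g ` words gap X) * (g u * g v) \<le> g a * (g u * g v)"
    using g_nonneg by (intro mult_right_mono) auto
  also have "\<dots> = g u * (g a * g v)" by simp
  also have "\<dots> \<le> g u * (D * g (a @ v))"
    using g_lower[OF language_appendD2[OF a(2)]] g_nonneg by (intro mult_left_mono)
  also have "\<dots> = D * (g u * g (a @ v))" by simp
  also have "\<dots> \<le> D * (D * g (u @ a @ v))"
    using g_lower[OF a(2)] D by (intro mult_left_mono) auto
  finally have "gap_const * (g u * g v) \<le> g (u @ a @ v)"
    using D by (simp add: gap_const_def field_simps power2_eq_square)
  also have "\<dots> \<le> (\<Sum>a\<in>listsn gap. g (u @ a @ v))"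
    using a by (intro member_le_sum[where f = "\<lambda>a. g (u @ a @ v)"]) (auto simp: g_nonneg)
  finally show ?thesis .
next
  case False
  then have "g u * g v = 0" using g_zero by auto
  moreover have "(\<Sum>a\<in>listsn gap. g (u @ a @ v)) \<ge> 0" by (intro sum_nonneg g_nonneg)
  ultimately show ?thesis by auto
qed

section \<open>Partition function and pressure\<close>

definition Z :: "nat \<Rightarrow> real" where
  "Z k = (\<Sum>w\<in>listsn k. g w)"

lemma Z_pos: "Z k > 0"
proof -
  obtain w where "w \<in> words k X" using words_nonempty by blast
  then have w: "w \<in> language X" "length w = k" by (auto simp: words_def)
  then have "0 < g w" by (intro g_pos)
  also have "g w \<le> Z k" unfolding Z_def using w by (intro member_le_sum) (auto simp: g_nonneg)
  finally show ?thesis .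
qed

lemma Z_upper: "Z (m + k) \<le> D * (Z m * Z k)"
proof -
  have "Z (m + k) \<le> (\<Sum>u\<in>listsn m. \<Sum>v\<in>listsn k. D * (g u * g v))"
    unfolding Z_def sum_listsn_append using g_upper by (intro sum_mono) (simp add: mult.assoc)
  also have "\<dots> = D * (Z m * Z k)"
    unfolding Z_def prod_sum_listsn by (simp add: sum_distrib_left)
  finally show ?thesis .
qed

lemma Z_lower: "gap_const * (Z m * Z k) \<le> D * (Z gap * Z (m + k))"
proof -
  have "gap_const * (Z m * Z k) = (\<Sum>u\<in>listsn m. \<Sum>v\<in>listsn k. gap_const * (g u * g v))"
    unfolding Z_def prod_sum_listsn by (simp add: sum_distrib_left)
  also have "\<dots> \<le> (\<Sum>u\<in>listsn m. \<Sum>v\<in>listsn k. \<Sum>a\<in>listsn gap. g (u @ a @ v))"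
    by (intro sum_mono gap_sum)
  also have "\<dots> = (\<Sum>u\<in>listsn m. \<Sum>a\<in>listsn gap. \<Sum>v\<in>listsn k. g (u @ a @ v))"
    by (intro sum.cong refl sum.swap)
  also have "\<dots> = Z (m + (gap + k))"
    unfolding Z_def sum_listsn_append ..
  \<comment> \<open>\<open>Z\<close> depends on the total length alone, so the bridge can be split
    off as if it stood in front.\<close>
  also have "\<dots> = Z (gap + (m + k))" by (simp add: ac_simps)
  also have "\<dots> \<le> D * (Z gap * Z (m + k))" by (rule Z_upper)
  finally show ?thesis .
qed

text \<open>\<open>P\<close> is the pressure of the weights: by the two estimates for
  \<open>Z (m + k)\<close> the sequence \<open>ln (Z k)\<close> is almost additive, hence linear up
  to a bounded error.\<close>

lemma pressure_ex: "\<exists>P d. \<forall>k. Z k \<le> exp (d + P * real k) \<and> exp (P * real k - d) \<le> Z k"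
proof -
  define d where "d = max (ln D) (ln (D * Z gap / gap_const))"
  obtain P where P: "\<And>m. m \<ge> 1 \<Longrightarrow> \<bar>ln (Z m) - P * real m\<bar> \<le> d"
  proof (rule almost_additive_bound[of "\<lambda>m. ln (Z m)" d])
    fix m k :: nat
    have "ln (Z (m + k)) \<le> ln (D * (Z m * Z k))"
      using Z_upper Z_pos by (intro ln_mono) auto
    also have "\<dots> = ln D + (ln (Z m) + ln (Z k))"
      using Z_pos[of m] Z_pos[of k] D by (simp add: ln_mult)
    finally have 1: "ln (Z (m + k)) - ln (Z m) - ln (Z k) \<le> d" by (simp add: d_def)
    have "Z m * Z k \<le> (D * Z gap / gap_const) * Z (m + k)"
      using Z_lower[of m k] gap_const_pos by (simp add: field_simps)
    then have "ln (Z m * Z k) \<le> ln ((D * Z gap / gap_const) * Z (m + k))"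
      using Z_pos by (intro ln_mono) auto
    also have "\<dots> = ln (D * Z gap / gap_const) + ln (Z (m + k))"
      using Z_pos[of gap] Z_pos[of "m + k"] D gap_const_pos by (intro ln_mult_pos) auto
    also have "ln (Z m * Z k) = ln (Z m) + ln (Z k)"
      using Z_pos[of m] Z_pos[of k] by (simp add: ln_mult)
    finally have 2: "ln (Z m) + ln (Z k) - ln (Z (m + k)) \<le> d" by (simp add: d_def)
    show "\<bar>ln (Z (m + k)) - ln (Z m) - ln (Z k)\<bar> \<le> d" using 1 2 by linarith
  qed (use that in blast)
  \<comment> \<open>Almost additivity speaks of positive lengths; the maximum includes length
    0.\<close>
  define d' where "d' = max d \<bar>ln (Z 0)\<bar>"
  have *: "\<bar>ln (Z k) - P * real k\<bar> \<le> d'" for k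
    using P[of k] by (cases "k = 0") (auto simp: d'_def)
  have "Z k \<le> exp (d' + P * real k) \<and> exp (P * real k - d') \<le> Z k" for k
  proof -
    have "exp (ln (Z k)) \<le> exp (d' + P * real k)" "exp (P * real k - d') \<le> exp (ln (Z k))"
      using *[of k] by (auto simp: abs_le_iff)
    then show ?thesis using Z_pos by simp
  qed
  then show ?thesis by blast
qed

text \<open>The probability that \<open>u\<close> stands at position \<open>j\<close> of a word of
  length \<open>N\<close> drawn with probability proportional to \<open>g\<close>.\<close>

definition Q :: "nat \<Rightarrow> nat \<Rightarrow> 'a list \<Rightarrow> real" where
  "Q N j u = (\<Sum>w1\<in>listsn j. \<Sum>w2\<in>listsn (N - j - length u). g (w1 @ u @ w2)) / Z N"

lemma Q_nonneg: "Q N j u \<ge> 0"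
  unfolding Q_def using Z_pos[of N] by (intro divide_nonneg_pos sum_nonneg g_nonneg)

lemma Q_Nil: "j \<le> N \<Longrightarrow> Q N j [] = 1"
proof -
  assume "j \<le> N"
  then have "N = j + (N - j)" by simp
  then have "Z N = (\<Sum>w1\<in>listsn j. \<Sum>w2\<in>listsn (N - j). g (w1 @ w2))"
    unfolding Z_def by (metis sum_listsn_append)
  then show ?thesis using Z_pos[of N] by (simp add: Q_def)
qed

lemma Q_right: "j + length u + 1 \<le> N \<Longrightarrow> (\<Sum>a\<in>UNIV. Q N j (u @ [a])) = Q N j u"
proof -
  assume le: "j + length u + 1 \<le> N"
  define r where "r = N - j - length u - 1"
  have r: "N - j - length u = Suc 0 + r" "N - j - Suc (length u) = r" using le by (auto simp: r_def)
  have "(\<Sum>w1\<in>listsn j. \<Sum>w2\<in>listsn (N - j - length u). g (w1 @ u @ w2))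
      = (\<Sum>w1\<in>listsn j. \<Sum>a\<in>UNIV. \<Sum>w2\<in>listsn r. g (w1 @ u @ a # w2))"
    unfolding r(1) sum_listsn_append by (simp only: sum_listsn_1 append_Cons append_Nil)
  also have "\<dots> = (\<Sum>a\<in>UNIV. \<Sum>w1\<in>listsn j. \<Sum>w2\<in>listsn r. g (w1 @ u @ a # w2))"
    by (rule sum.swap)
  finally have *: "(\<Sum>a\<in>UNIV. \<Sum>w1\<in>listsn j. \<Sum>w2\<in>listsn r. g (w1 @ u @ a # w2))
      = (\<Sum>w1\<in>listsn j. \<Sum>w2\<in>listsn (N - j - length u). g (w1 @ u @ w2))" by simp
  have len: "N - j - length (u @ [a]) = r" for a using r(2) by simp
  show ?thesis unfolding Q_def len sum_divide_distrib[symmetric] *[symmetric] by simp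
qed

text \<open>Summing over the letter in front moves the position by one, so \<open>Q\<close> is left
  consistent only up to a change of position. This is the defect that averaging over positions
  removes.\<close>

lemma Q_left: "j + length u + 1 \<le> N \<Longrightarrow> (\<Sum>a\<in>UNIV. Q N j (a # u)) = Q N (Suc j) u"
proof -
  have "(\<Sum>w1\<in>listsn (Suc j). \<Sum>w2\<in>listsn (N - Suc j - length u). g (w1 @ u @ w2))
      = (\<Sum>w1\<in>listsn j. \<Sum>a\<in>UNIV. \<Sum>w2\<in>listsn (N - Suc j - length u). g (w1 @ (a # u) @ w2))"
    unfolding Suc_eq_plus1[of j] One_nat_def sum_listsn_append
    by (simp only: sum_listsn_1 append_Cons append_Nil append_assoc)
  also have "\<dots> = (\<Sum>a\<in>UNIV. \<Sum>w1\<in>listsn j. \<Sum>w2\<in>listsn (N - Suc j - length u). g (w1 @ (a # u) @ w2))"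
    by (rule sum.swap)
  finally show ?thesis by (simp add: Q_def sum_divide_distrib)
qed

text \<open>The Gibbs property, uniform in \<open>N\<close> and \<open>j\<close>: splitting off both
  contexts gives about \<open>Z j * g u * Z r\<close>, and the pressure governs the ratio to
  \<open>Z N\<close>. The lower bound needs room for a bridge on either side of
  \<open>u\<close>.\<close>

lemma Q_bounds_ex:
  "\<exists>P K. K > 0 \<and> (\<forall>N j u. j + length u \<le> N \<longrightarrow> Q N j u \<le> K * (g u * exp (- P * real (length u)))) \<and>
    (\<forall>N j u. gap \<le> j \<longrightarrow> j + length u + gap \<le> N \<longrightarrow>
       g u * exp (- P * real (length u)) \<le> K * Q N j u)"
proof -
  obtain P d where Z1: "\<And>k. Z k \<le> exp (d + P * real k)" and Z2: "\<And>k. exp (P * real k - d) \<le> Z k"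
    using pressure_ex by blast
  define K1 where "K1 = D ^ 2 * exp (3 * d)"
  define K2 where "K2 = exp (3 * d + 2 * P * real gap) / gap_const ^ 2"
  have pos: "K1 > 0" "K2 > 0" using D gap_const_pos by (auto simp: K1_def K2_def)
  have up: "Q N j u \<le> K1 * (g u * exp (- P * real (length u)))" if "j + length u \<le> N" for N j u
  proof -
    define r where "r = N - j - length u"
    have N: "N = j + length u + r" using that by (simp add: r_def)
    have "(\<Sum>w1\<in>listsn j. \<Sum>w2\<in>listsn r. g (w1 @ u @ w2))
        \<le> (\<Sum>w1\<in>listsn j. \<Sum>w2\<in>listsn r. D ^ 2 * g u * (g w1 * g w2))"
    proof (intro sum_mono)
      fix w1 w2
      have "g (w1 @ u @ w2) \<le> D * g w1 * g (u @ w2)" by (rule g_upper)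
      also have "\<dots> \<le> D * g w1 * (D * g u * g w2)"
        using D g_nonneg by (intro mult_left_mono g_upper) auto
      finally show "g (w1 @ u @ w2) \<le> D ^ 2 * g u * (g w1 * g w2)"
        by (simp add: power2_eq_square ac_simps)
    qed
    also have "\<dots> = D ^ 2 * g u * (Z j * Z r)"
      unfolding Z_def prod_sum_listsn by (simp add: sum_distrib_left)
    also have "\<dots> \<le> D ^ 2 * g u * (exp (d + P * real j) * exp (d + P * real r))"
      using Z1 Z_pos[THEN less_imp_le] D g_nonneg by (intro mult_left_mono mult_mono) auto
    also have "\<dots> = K1 * (g u * exp (- P * real (length u))) * exp (P * real N - d)"
      by (simp add: K1_def N exp_add[symmetric] algebra_simps)
    also have "\<dots> \<le> K1 * (g u * exp (- P * real (length u))) * Z N"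
      using Z2 pos g_nonneg by (intro mult_left_mono) auto
    finally show ?thesis
      using Z_pos[of N] unfolding Q_def r_def[symmetric] by (simp add: divide_le_eq)
  qed
  have lo: "g u * exp (- P * real (length u)) \<le> K2 * Q N j u" if "gap \<le> j" "j + length u + gap \<le> N" for N j u
  proof -
    define i where "i = j - gap"
    define r where "r = N - j - length u - gap"
    have N: "N = i + length u + r + 2 * gap" "j = i + gap" "N - j - length u = gap + r"
      using that by (auto simp: r_def i_def)
    have "gap_const ^ 2 * g u * (exp (P * real i - d) * exp (P * real r - d)) \<le> gap_const ^ 2 * g u * (Z i * Z r)"
      using Z2 Z_pos[THEN less_imp_le] g_nonneg by (intro mult_left_mono mult_mono) auto
    also have "\<dots> = (\<Sum>v1\<in>listsn i. \<Sum>v2\<in>listsn r. gap_const ^ 2 * g u * (g v1 * g v2))"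
      unfolding Z_def prod_sum_listsn by (simp add: sum_distrib_left)
    also have "\<dots> \<le> (\<Sum>v1\<in>listsn i. \<Sum>v2\<in>listsn r. \<Sum>b\<in>listsn gap. \<Sum>a\<in>listsn gap. g (v1 @ a @ u @ b @ v2))"
    proof (intro sum_mono)
      fix v1 v2
      have "gap_const ^ 2 * g u * (g v1 * g v2) = gap_const * g v1 * (gap_const * (g u * g v2))"
        by (simp add: power2_eq_square ac_simps)
      also have "\<dots> \<le> gap_const * g v1 * (\<Sum>b\<in>listsn gap. g (u @ b @ v2))"
        using gap_const_pos g_nonneg by (intro mult_left_mono gap_sum) auto
      also have "\<dots> = (\<Sum>b\<in>listsn gap. gap_const * (g v1 * g (u @ b @ v2)))"
        by (simp add: sum_distrib_left ac_simps)
      also have "\<dots> \<le> (\<Sum>b\<in>listsn gap. \<Sum>a\<in>listsn gap. g (v1 @ a @ u @ b @ v2))"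
        by (intro sum_mono gap_sum)
      finally show "gap_const ^ 2 * g u * (g v1 * g v2) \<le> (\<Sum>b\<in>listsn gap. \<Sum>a\<in>listsn gap. g (v1 @ a @ u @ b @ v2))" .
    qed
    also have "\<dots> = (\<Sum>v1\<in>listsn i. \<Sum>b\<in>listsn gap. \<Sum>v2\<in>listsn r. \<Sum>a\<in>listsn gap. g (v1 @ a @ u @ b @ v2))"
      by (intro sum.cong refl sum.swap)
    also have "\<dots> = (\<Sum>v1\<in>listsn i. \<Sum>w2\<in>listsn (gap + r). \<Sum>a\<in>listsn gap. g (v1 @ a @ u @ w2))"
      by (simp add: sum_listsn_append)
    also have "\<dots> = (\<Sum>v1\<in>listsn i. \<Sum>a\<in>listsn gap. \<Sum>w2\<in>listsn (gap + r). g (v1 @ a @ u @ w2))"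
      by (intro sum.cong refl sum.swap)
    also have "\<dots> = (\<Sum>w1\<in>listsn j. \<Sum>w2\<in>listsn (N - j - length u). g (w1 @ u @ w2))"
      unfolding N(3) unfolding N(2) sum_listsn_append[of _ i gap] by simp
    also have "\<dots> = Q N j u * Z N" using Z_pos[of N] by (simp add: Q_def)
    also have "\<dots> \<le> Q N j u * exp (d + P * real N)"
      using Z1 Q_nonneg by (intro mult_left_mono) auto
    finally have "gap_const ^ 2 * g u * exp (P * real (i + r) - 2 * d) \<le> Q N j u * exp (d + P * real N)"
      by (simp add: exp_add[symmetric] algebra_simps)
    then have "gap_const ^ 2 * g u * exp (P * real (i + r) - 2 * d) * exp (- d - P * real N)
        \<le> Q N j u * exp (d + P * real N) * exp (- d - P * real N)"
      by (intro mult_right_mono) auto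
    also have "Q N j u * exp (d + P * real N) * exp (- d - P * real N) = Q N j u"
      by (simp add: mult.assoc exp_add[symmetric])
    finally have *: "gap_const ^ 2 * g u * exp (P * real (i + r) - 2 * d) * exp (- d - P * real N) \<le> Q N j u" .
    have "gap_const ^ 2 * g u * exp (P * real (i + r) - 2 * d) * exp (- d - P * real N)
        = gap_const ^ 2 * g u * (exp (- P * real (length u)) * exp (- (3 * d + 2 * P * real gap)))"
      unfolding mult.assoc exp_add[symmetric] by (simp add: N(1) algebra_simps)
    also have "\<dots> = g u * exp (- P * real (length u)) / K2"
      unfolding K2_def exp_minus using gap_const_pos by (simp add: field_simps)
    finally have "g u * exp (- P * real (length u)) / K2 \<le> Q N j u" using * by simp
    then show ?thesis using pos(2) by (simp add: pos_divide_le_eq mult.commute)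
  qed
  show ?thesis
  proof (rule exI[of _ P], rule exI[of _ "max K1 K2"], intro conjI allI impI)
    show "max K1 K2 > 0" using pos by simp
  next
    fix N j :: nat and u :: "'a list"
    assume "j + length u \<le> N"
    then have "Q N j u \<le> K1 * (g u * exp (- P * real (length u)))" by (rule up)
    also have "\<dots> \<le> max K1 K2 * (g u * exp (- P * real (length u)))"
      using g_nonneg by (intro mult_right_mono) auto
    finally show "Q N j u \<le> max K1 K2 * (g u * exp (- P * real (length u)))" .
  next
    fix N j :: nat and u :: "'a list"
    assume "gap \<le> j" "j + length u + gap \<le> N"
    then have "g u * exp (- P * real (length u)) \<le> K2 * Q N j u" by (rule lo)
    also have "\<dots> \<le> max K1 K2 * Q N j u"
      using Q_nonneg by (intro mult_right_mono) auto
    finally show "g u * exp (- P * real (length u)) \<le> max K1 K2 * Q N j u" .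
  qed
qed

text \<open>Positions are taken from the middle third of words of length \<open>3 * N\<close>. They
  are at distance at least \<open>N\<close> from both ends, which leaves room for \<open>u\<close>
  and for the bridges once \<open>N\<close> is large.\<close>

definition R :: "nat \<Rightarrow> 'a list \<Rightarrow> real" where
  "R N u = (\<Sum>j<N. Q (3 * N) (N + j) u) / real N"

lemma Q_le_1: "j + length u \<le> N \<Longrightarrow> Q N j u \<le> 1"
proof (induction u rule: rev_induct)
  case (snoc a u)
  have "Q N j (u @ [a]) \<le> (\<Sum>a\<in>UNIV. Q N j (u @ [a]))"
    by (rule member_le_sum) (auto simp: Q_nonneg)
  also have "\<dots> = Q N j u" using snoc.prems by (intro Q_right) simp
  also have "\<dots> \<le> 1" using snoc by simp
  finally show ?case .
qed (simp add: Q_Nil)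

lemma sum_div_bounds:
  assumes "N \<ge> 1" "\<And>j. j < N \<Longrightarrow> a \<le> F j" "\<And>j. j < N \<Longrightarrow> F j \<le> b"
  shows "a \<le> (\<Sum>j<N. F j) / real N" "(\<Sum>j<N. F j) / real N \<le> b"
proof -
  have "(\<Sum>j<N. a) \<le> (\<Sum>j<N. F j)" "(\<Sum>j<N. F j) \<le> (\<Sum>j<N. b)"
    using assms by (intro sum_mono; simp)+
  then show "a \<le> (\<Sum>j<N. F j) / real N" "(\<Sum>j<N. F j) / real N \<le> b"
    using assms(1) by (auto simp: field_simps)
qed

text \<open>A subsequential limit of the averages \<open>R N\<close>; averaging over the position
  makes the limit shift invariant.\<close>

lemma invariant_gibbs_weights_ex:
  obtains \<nu> :: "'a list \<Rightarrow> real" and P K :: real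
  where "K > 0" "\<And>u. \<nu> u \<ge> 0" "\<nu> [] = 1"
    "\<And>u. (\<Sum>a\<in>UNIV. \<nu> (u @ [a])) = \<nu> u" "\<And>u. (\<Sum>a\<in>UNIV. \<nu> (a # u)) = \<nu> u"
    "\<And>u. \<nu> u \<le> K * (g u * exp (- P * real (length u)))"
    "\<And>u. g u * exp (- P * real (length u)) \<le> K * \<nu> u"
proof -
  obtain P K where K: "K > 0"
    and up: "\<And>N j u. j + length u \<le> N \<Longrightarrow> Q N j u \<le> K * (g u * exp (- P * real (length u)))"
    and lo: "\<And>N j u. gap \<le> j \<Longrightarrow> j + length u + gap \<le> N \<Longrightarrow>
       g u * exp (- P * real (length u)) \<le> K * Q N j u"
    using Q_bounds_ex by blast
  \<comment> \<open>Set to zero where \<open>R N u\<close> is not known to lie between 0 and 1: the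
    diagonal argument asks for one bound valid for all \<open>N\<close> and
    \<open>u\<close>.\<close>
  define R' where "R' N u = (if length u \<le> N \<and> 1 \<le> N then R N u else 0)" for N u
  have R_bd: "0 \<le> R N u" "R N u \<le> 1" if "length u \<le> N" "N \<ge> 1" for N u
    unfolding R_def using that
    by (intro sum_div_bounds(1)[where b = 1] sum_div_bounds(2)[where a = 0] Q_nonneg Q_le_1; simp)+
  have "norm (R' N u) \<le> 1" for N u using R_bd[of u N] by (auto simp: R'_def)
  then obtain k where k: "strict_mono (k :: nat \<Rightarrow> nat)"
    "\<And>u. u \<in> UNIV \<Longrightarrow> \<exists>l. (\<lambda>n. R' (k n) u) \<longlonglongrightarrow> l"
    using function_convergent_subsequence[of UNIV R' 1] by (metis countableI_type)
  then obtain \<nu> where lim': "\<And>u. (\<lambda>n. R' (k n) u) \<longlonglongrightarrow> \<nu> u" by (metis UNIV_I)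
  have ev: "\<forall>\<^sub>F n in sequentially. M \<le> k n" for M
    using filterlim_subseq[OF k(1)] by (simp add: filterlim_at_top)
  have lim: "(\<lambda>n. R (k n) u) \<longlonglongrightarrow> \<nu> u" for u
  proof (rule Lim_transform_eventually[OF lim'])
    show "\<forall>\<^sub>F n in sequentially. R' (k n) u = R (k n) u"
      using ev[of "Suc (length u)"] by eventually_elim (simp add: R'_def)
  qed
  show ?thesis
  proof (rule that[OF K])
    fix u
    show "\<nu> u \<ge> 0"
    proof (rule tendsto_lowerbound[OF lim])
      show "\<forall>\<^sub>F n in sequentially. 0 \<le> R (k n) u"
        using ev[of "Suc (length u)"] by eventually_elim (auto intro: R_bd)
    qed simp
    show "\<nu> u \<le> K * (g u * exp (- P * real (length u)))"
    proof (rule tendsto_upperbound[OF lim])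
      show "\<forall>\<^sub>F n in sequentially. R (k n) u \<le> K * (g u * exp (- P * real (length u)))"
        using ev[of "Suc (length u)"]
        by eventually_elim (unfold R_def, rule sum_div_bounds(2)[where a = 0], auto simp: Q_nonneg intro!: up[simplified])
    qed simp
    show "g u * exp (- P * real (length u)) \<le> K * \<nu> u"
    proof (rule tendsto_lowerbound[OF tendsto_mult_left[OF lim]])
      show "\<forall>\<^sub>F n in sequentially. g u * exp (- P * real (length u)) \<le> K * R (k n) u"
        using ev[of "Suc (length u + gap)"]
      proof eventually_elim
        case (elim n)
        have "g u * exp (- P * real (length u)) / K \<le> R (k n) u"
          unfolding R_def
        proof (rule sum_div_bounds(1)[where b = 1])
          fix j assume "j < k n"
          then show "g u * exp (- P * real (length u)) / K \<le> Q (3 * k n) (k n + j) u"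
            using lo[of "k n + j" u "3 * k n"] elim K by (simp add: field_simps)
          show "Q (3 * k n) (k n + j) u \<le> 1" using \<open>j < k n\<close> elim by (intro Q_le_1) simp
        qed (use elim in simp)
        then show ?case using K by (simp add: field_simps)
      qed
    qed simp
    have "(\<lambda>n. \<Sum>a\<in>UNIV. R (k n) (u @ [a])) \<longlonglongrightarrow> (\<Sum>a\<in>UNIV. \<nu> (u @ [a]))"
      by (intro tendsto_sum lim)
    moreover have "(\<lambda>n. \<Sum>a\<in>UNIV. R (k n) (u @ [a])) \<longlonglongrightarrow> \<nu> u"
    proof (rule Lim_transform_eventually[OF lim])
      show "\<forall>\<^sub>F n in sequentially. R (k n) u = (\<Sum>a\<in>UNIV. R (k n) (u @ [a]))"
        using ev[of "Suc (length u)"]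
      proof eventually_elim
        case (elim n)
        have "(\<Sum>a\<in>UNIV. R (k n) (u @ [a])) = (\<Sum>j<k n. \<Sum>a\<in>UNIV. Q (3 * k n) (k n + j) (u @ [a])) / real (k n)"
          unfolding R_def sum_divide_distrib[symmetric] by (subst sum.swap) simp
        also have "(\<Sum>j<k n. \<Sum>a\<in>UNIV. Q (3 * k n) (k n + j) (u @ [a])) = (\<Sum>j<k n. Q (3 * k n) (k n + j) u)"
          using elim by (intro sum.cong refl Q_right) auto
        finally show ?case by (simp add: R_def)
      qed
    qed
    ultimately show "(\<Sum>a\<in>UNIV. \<nu> (u @ [a])) = \<nu> u" by (rule LIMSEQ_unique)
    have "(\<lambda>n. \<Sum>a\<in>UNIV. R (k n) (a # u)) \<longlonglongrightarrow> (\<Sum>a\<in>UNIV. \<nu> (a # u))"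
      by (intro tendsto_sum lim)
    moreover have "(\<lambda>n. \<Sum>a\<in>UNIV. R (k n) (a # u)) \<longlonglongrightarrow> \<nu> u"
    proof -
      have lim0: "(\<lambda>n. 1 / real (k n)) \<longlonglongrightarrow> 0"
        using LIMSEQ_subseq_LIMSEQ[OF lim_1_over_n k(1)] by (simp add: o_def)
      \<comment> \<open>The two averages run over positions shifted by one, so the difference
        telescopes to two boundary terms between 0 and 1, divided by \<open>k n\<close>.\<close>
      have "(\<lambda>n. (\<Sum>a\<in>UNIV. R (k n) (a # u)) - R (k n) u) \<longlonglongrightarrow> 0"
      proof (rule tendsto_rabs_zero_cancel, rule tendsto_sandwich[OF _ _ tendsto_const lim0])
        show "\<forall>\<^sub>F n in sequentially. \<bar>(\<Sum>a\<in>UNIV. R (k n) (a # u)) - R (k n) u\<bar> \<le> 1 / real (k n)"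
          using ev[of "Suc (length u)"]
        proof eventually_elim
          case (elim n)
          let ?q = "\<lambda>j. Q (3 * k n) (k n + j) u"
          have "(\<Sum>a\<in>UNIV. R (k n) (a # u)) = (\<Sum>j<k n. \<Sum>a\<in>UNIV. Q (3 * k n) (k n + j) (a # u)) / real (k n)"
            unfolding R_def sum_divide_distrib[symmetric] by (subst sum.swap) simp
          also have "(\<Sum>j<k n. \<Sum>a\<in>UNIV. Q (3 * k n) (k n + j) (a # u)) = (\<Sum>j<k n. ?q (Suc j))"
            using elim Q_left by (intro sum.cong refl) auto
          finally have "(\<Sum>a\<in>UNIV. R (k n) (a # u)) - R (k n) u = (\<Sum>j<k n. ?q (Suc j) - ?q j) / real (k n)"
            by (simp add: R_def diff_divide_distrib sum_subtractf)
          also have "(\<Sum>j<k n. ?q (Suc j) - ?q j) = ?q (k n) - ?q 0"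
            by (rule sum_lessThan_telescope)
          finally have *: "(\<Sum>a\<in>UNIV. R (k n) (a # u)) - R (k n) u = (?q (k n) - ?q 0) / real (k n)" .
          have "0 \<le> ?q (k n)" "?q (k n) \<le> 1" "0 \<le> ?q 0" "?q 0 \<le> 1"
            using elim by (auto intro!: Q_nonneg Q_le_1)
          then show ?case unfolding * abs_divide abs_of_nat by (intro divide_right_mono) auto
        qed
      qed simp
      from tendsto_add[OF this lim[of u]] show ?thesis by simp
    qed
    ultimately show "(\<Sum>a\<in>UNIV. \<nu> (a # u)) = \<nu> u" by (rule LIMSEQ_unique)
  next
    have "(\<lambda>n. R (k n) []) \<longlonglongrightarrow> 1"
    proof (rule Lim_transform_eventually[OF tendsto_const])
      show "\<forall>\<^sub>F n in sequentially. 1 = R (k n) []"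
        using ev[of 1] by eventually_elim (simp add: R_def Q_Nil)
    qed
    then show "\<nu> [] = 1" using lim LIMSEQ_unique by blast
  qed
qed

end

section \<open>From word weights to measures\<close>

lemma space_full_shift_space [simp]: "space full_shift_space = UNIV"
  by (simp add: full_shift_space_def space_PiM)

lemma measurable_coordinate [measurable]: "(\<lambda>x. x i) \<in> measurable full_shift_space (count_space UNIV)"
  unfolding full_shift_space_def by measurable

lemma measurable_shift [measurable]: "shift \<in> measurable full_shift_space full_shift_space"
  unfolding full_shift_space_def shift_def by (intro measurable_PiM_single') auto

lemma sets_win_eq [measurable]: "{x :: nat \<Rightarrow> 'a::finite. win x i n = w} \<in> sets full_shift_space"
proof -
  have "Measurable.pred full_shift_space (\<lambda>x :: nat \<Rightarrow> 'a. length w = n \<and> (\<forall>l<n. w ! l = x (i + l)))"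
    by measurable
  then show ?thesis unfolding win_eq_iff by (simp add: pred_def)
qed

lemma measurable_win [measurable]:
  "(\<lambda>x :: nat \<Rightarrow> 'a::finite. win x i n) \<in> measurable full_shift_space (count_space UNIV)"
  by (subst measurable_count_space_eq2_countable) (auto simp: vimage_def)

lemma emeasure_win_in:
  fixes M :: "(nat \<Rightarrow> 'a::finite) measure"
  assumes "sets M = sets full_shift_space" "W \<subseteq> listsn n"
  shows "emeasure M {x. win x i n \<in> W} = (\<Sum>w\<in>W. emeasure M {x. win x i n = w})"
proof -
  have "{x. win x i n \<in> W} = (\<Union>w\<in>W. {x. win x i n = w})" by auto
  moreover have "finite W" using assms(2) finite_subset by fastforce
  ultimately show ?thesis
    by (simp only:) (rule sum_emeasure[symmetric], auto simp: assms(1) disjoint_family_on_def)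
qed

lemma measure_eqI_cylinders:
  fixes M N :: "(nat \<Rightarrow> 'a::finite) measure"
  assumes M: "sets M = sets full_shift_space" and N: "sets N = sets full_shift_space"
    and "prob_space M"
    and eq: "\<And>w. emeasure M (cyl UNIV w) = emeasure N (cyl UNIV w)"
  shows "M = N"
proof (rule measure_eqI_PiM_infinite[where I = UNIV and M = "\<lambda>_. count_space UNIV"])
  show "sets M = sets (PiM UNIV (\<lambda>_. count_space UNIV))" "sets N = sets (PiM UNIV (\<lambda>_. count_space UNIV))"
    using M N by (auto simp: full_shift_space_def)
next
  fix A :: "nat \<Rightarrow> 'a set" and J :: "nat set"
  assume J: "finite J"
  define n where "n = Suc (Max (insert 0 J))"
  have n: "j < n" if "j \<in> J" for j
    using J that by (auto simp: n_def less_Suc_eq_le intro!: Max_ge)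
  define W where "W = {w :: 'a list. length w = n \<and> (\<forall>j\<in>J. w ! j \<in> A j)}"
  have "prod_emb UNIV (\<lambda>_. count_space UNIV) J (Pi\<^sub>E J A) = {x. win x 0 n \<in> W}"
    using n by (auto simp: prod_emb_def W_def PiE_iff space_PiM)
  moreover have "W \<subseteq> listsn n" by (auto simp: W_def)
  moreover have "emeasure M {x. win x 0 n = w} = emeasure N {x. win x 0 n = w}" if "w \<in> W" for w
    using eq[of w] that by (simp add: cyl_eq_win W_def)
  ultimately show "emeasure M (prod_emb UNIV (\<lambda>_. count_space UNIV) J (Pi\<^sub>E J A))
      = emeasure N (prod_emb UNIV (\<lambda>_. count_space UNIV) J (Pi\<^sub>E J A))"
    using emeasure_win_in[OF M] emeasure_win_in[OF N] by simp
qed (use assms(3) in \<open>simp add: prob_space.finite_measure\<close>)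

section \<open>Measures with prescribed values on cylinders\<close>

locale right_consistent =
  fixes \<nu> :: "'a::finite list \<Rightarrow> real"
  assumes nonneg: "\<nu> u \<ge> 0" and Nil: "\<nu> [] = 1"
    and right: "(\<Sum>a\<in>UNIV. \<nu> (u @ [a])) = \<nu> u"
begin

text \<open>The conditional law of the letter following \<open>u\<close>. On words of weight zero
  the law is arbitrary: both sides of \<open>pmf_next_letter\<close> vanish there.\<close>

definition next_letter :: "'a list \<Rightarrow> 'a pmf" where
  "next_letter u = (if \<nu> u = 0 then return_pmf undefined else embed_pmf (\<lambda>a. \<nu> (u @ [a]) / \<nu> u))"

lemma pmf_next_letter: "\<nu> u * pmf (next_letter u) a = \<nu> (u @ [a])"
proof (cases "\<nu> u = 0")
  case True
  then have "\<nu> (u @ [a]) = 0"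
    using right[of u] nonneg by (simp add: sum_nonneg_eq_0_iff)
  then show ?thesis using True by simp
next
  case False
  then have pos: "\<nu> u > 0" using nonneg[of u] by simp
  have "pmf (embed_pmf (\<lambda>a. \<nu> (u @ [a]) / \<nu> u)) a = \<nu> (u @ [a]) / \<nu> u"
  proof (rule pmf_embed_pmf)
    show "0 \<le> \<nu> (u @ [a]) / \<nu> u" for a using nonneg by simp
    have "(\<integral>\<^sup>+x. ennreal (\<nu> (u @ [x]) / \<nu> u) \<partial>count_space UNIV) = ennreal (\<Sum>x\<in>UNIV. \<nu> (u @ [x]) / \<nu> u)"
      using nonneg by (simp add: nn_integral_count_space_finite sum_ennreal)
    also have "\<dots> = 1" using pos by (simp add: sum_divide_distrib[symmetric] right)
    finally show "(\<integral>\<^sup>+x. ennreal (\<nu> (u @ [x]) / \<nu> u) \<partial>count_space UNIV) = 1" .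
  qed
  then show ?thesis using pos False by (simp add: next_letter_def)
qed

definition kernel :: "nat \<Rightarrow> (nat \<Rightarrow> 'a) \<Rightarrow> 'a measure" where
  "kernel n x = measure_pmf (next_letter (win x 0 n))"

lemma PiM_letters: "PiM {0..<n :: nat} (\<lambda>_. count_space (UNIV :: 'a set)) = count_space (PiE {0..<n} (\<lambda>_. UNIV))"
  by (rule count_space_PiM_finite) auto

lemma kernel_measurable:
  "kernel i \<in> measurable (PiM {0..<i} (\<lambda>_. count_space UNIV)) (subprob_algebra (count_space UNIV))"
  unfolding PiM_letters kernel_def measurable_count_space_eq1
  using measure_pmf_in_subprob_algebra by blast

sublocale IT: Ionescu_Tulcea kernel "\<lambda>_. count_space UNIV"
  by (intro Ionescu_Tulcea.intro kernel_measurable)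
    (simp add: kernel_def measure_pmf.prob_space_axioms)

text \<open>The chain rule: the last kernel multiplies the mass of the prefix by the conditional
  probability of the last letter.\<close>

lemma emeasure_C_win:
  "length w = n \<Longrightarrow> emeasure (IT.C 0 n (\<lambda>_. undefined)) {x \<in> PiE {0..<n} (\<lambda>_. UNIV). win x 0 n = w} = ennreal (\<nu> w)"
proof (induction n arbitrary: w)
  case 0
  then show ?case using PiM_letters[of 0] by (auto simp: Nil)
next
  case (Suc n)
  obtain u a where w: "w = u @ [a]" "length u = n"
    using Suc.prems by (cases w rule: rev_cases) auto
  let ?o = "\<lambda>_::nat. undefined :: 'a"
  let ?S = "\<lambda>n. PiM {0..<n} (\<lambda>_. count_space (UNIV :: 'a set))"
  let ?A = "{x \<in> PiE {0..<Suc n} (\<lambda>_. UNIV). win x 0 (Suc n) = w}"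
  let ?B = "{x \<in> PiE {0..<n} (\<lambda>_. UNIV). win x 0 n = u}"
  have o: "?o \<in> space (?S 0)" by (simp add: space_PiM)
  have A: "?A \<in> sets (?S (Suc n))" unfolding PiM_letters by auto
  have B: "?B \<in> sets (?S n)" unfolding PiM_letters by auto
  have spC: "space (IT.C 0 n ?o) = space (?S n)" using IT.space_C[OF o, of n] by simp
  have stC: "sets (IT.C 0 n ?o) = sets (?S n)" using IT.sets_C[OF o, of n] by simp
  have "emeasure (IT.C 0 (Suc n) ?o) ?A = (\<integral>\<^sup>+x. emeasure (IT.eP n x) ?A \<partial>IT.C 0 n ?o)"
    unfolding IT.C.simps add_0
  proof (rule emeasure_bind[OF _ _ A])
    show "space (IT.C 0 n ?o) \<noteq> {}" unfolding spC by (simp add: space_PiM PiE_eq_empty_iff)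
    show "IT.eP n \<in> measurable (IT.C 0 n ?o) (subprob_algebra (?S (Suc n)))"
      using IT.measurable_eP[of n] by (simp add: measurable_cong_sets[OF stC refl])
  qed
  also have "\<dots> = (\<integral>\<^sup>+x. ennreal (pmf (next_letter u) a) * indicator ?B x \<partial>IT.C 0 n ?o)"
  proof (rule nn_integral_cong)
    fix x assume "x \<in> space (IT.C 0 n ?o)"
    then have x: "x \<in> space (?S n)" unfolding spC .
    have "(\<lambda>b. x(n := b)) -` ?A \<inter> UNIV = (if win x 0 n = u then {a} else {})"
    proof -
      have "win (x(n := b)) 0 (Suc n) = win x 0 n @ [b]" for b
        by (auto simp: list_eq_iff_nth_eq nth_append less_Suc_eq)
      moreover have "x(n := b) \<in> PiE {0..<Suc n} (\<lambda>_. UNIV)" for b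
        using x by (auto simp: space_PiM PiE_iff extensional_def)
      ultimately show ?thesis by (auto simp: w)
    qed
    then have "emeasure (IT.eP n x) ?A = kernel n x (if win x 0 n = u then {a} else {})"
      using IT.emeasure_eP[OF x A] by simp
    also have "\<dots> = ennreal (pmf (next_letter u) a) * indicator ?B x"
      using x by (auto simp: kernel_def emeasure_pmf_single indicator_def space_PiM)
    finally show "emeasure (IT.eP n x) ?A = ennreal (pmf (next_letter u) a) * indicator ?B x" .
  qed
  also have "\<dots> = ennreal (pmf (next_letter u) a) * emeasure (IT.C 0 n ?o) ?B"
    using B by (intro nn_integral_cmult_indicator) (simp add: stC)
  also have "\<dots> = ennreal (pmf (next_letter u) a) * ennreal (\<nu> u)"
    using Suc.IH[OF w(2)] by simp
  also have "\<dots> = ennreal (\<nu> w)"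
    using pmf_next_letter[of u a] nonneg by (simp add: w(1) ennreal_mult[symmetric] mult.commute)
  finally show ?case .
qed

definition word_measure :: "(nat \<Rightarrow> 'a) measure" where
  "word_measure = IT.PF.lim"

lemma sets_word_measure [simp]: "sets word_measure = sets full_shift_space"
  by (simp add: word_measure_def full_shift_space_def)

lemma emeasure_word_measure: "emeasure word_measure (cyl UNIV w) = ennreal (\<nu> w)"
proof -
  let ?n = "length w"
  let ?B = "{x \<in> PiE {0..<?n} (\<lambda>_. UNIV). win x 0 ?n = w}"
  have B: "?B \<in> sets (PiM {0..<?n} (\<lambda>_. count_space (UNIV :: 'a set)))" unfolding PiM_letters by auto
  have "win (restrict x {0..<?n}) 0 ?n = win x 0 ?n" for x :: "nat \<Rightarrow> 'a"
    by (simp add: win_eq_iff)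
  then have "IT.PF.emb UNIV {0..<?n} ?B = cyl UNIV w"
    by (auto simp: prod_emb_def cyl_eq_win space_PiM)
  then have "emeasure word_measure (cyl UNIV w) = emeasure (IT.CI {0..<?n}) ?B"
    unfolding word_measure_def using IT.lim[OF _ B] by simp
  also have "\<dots> = emeasure (IT.C 0 ?n (\<lambda>_. undefined)) (IT.PF.emb {0..<?n} {0..<?n} ?B)"
    by (rule IT.emeasure_CI[OF subset_refl B])
  also have "IT.PF.emb {0..<?n} {0..<?n} ?B = ?B"
    using prod_emb_id[of ?B "{0..<?n}" "\<lambda>_. count_space UNIV"] by (auto simp: space_PiM)
  also have "emeasure (IT.C 0 ?n (\<lambda>_. undefined)) ?B = ennreal (\<nu> w)"
    by (rule emeasure_C_win) simp
  finally show ?thesis .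
qed

lemma prob_space_word_measure: "prob_space word_measure"
proof
  have "space word_measure = cyl UNIV []"
    using sets_eq_imp_space_eq[OF sets_word_measure] by simp
  then show "emeasure word_measure (space word_measure) = 1"
    using emeasure_word_measure[of "[]"] Nil by simp
qed

lemma measure_word_measure: "measure word_measure (cyl UNIV w) = \<nu> w"
  using emeasure_word_measure nonneg by (simp add: measure_def)

end

text \<open>The preimage of the cylinder of \<open>u\<close> is the disjoint union of the cylinders
  of \<open>a # u\<close>, and cylinders determine a measure. So left consistency of the weights
  amounts to invariance.\<close>

lemma emeasure_vimage_shift:
  fixes M :: "(nat \<Rightarrow> 'a::finite) measure"
  assumes M: "sets M = sets full_shift_space" "prob_space M"
    and inv: "\<And>u. (\<Sum>a\<in>UNIV. emeasure M (cyl UNIV (a # u))) = emeasure M (cyl UNIV u)"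
    and A: "A \<in> sets M"
  shows "emeasure M (shift -` A) = emeasure M A"
proof -
  have sp: "space M = UNIV" using sets_eq_imp_space_eq[OF M(1)] by simp
  have meas: "shift \<in> measurable M M"
    using measurable_shift by (simp add: measurable_cong_sets[OF M(1) M(1)])
  have "M = distr M M shift"
  proof (rule measure_eqI_cylinders[OF M(1) _ M(2)])
    fix w :: "'a list"
    have "emeasure (distr M M shift) (cyl UNIV w) = emeasure M (shift -` cyl UNIV w \<inter> space M)"
      by (intro emeasure_distr meas) (simp add: M(1) cyl_eq_win)
    also have "shift -` cyl UNIV w \<inter> space M = {x. win x 0 (Suc (length w)) \<in> (\<lambda>a. a # w) ` UNIV}"
    proof -
      have "win x 0 (Suc n) = x 0 # win x 1 n" for x :: "nat \<Rightarrow> 'a" and n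
        using win_add[of x 0 1 n] by simp
      then show ?thesis by (auto simp: sp cyl_eq_win)
    qed
    also have "emeasure M \<dots> = (\<Sum>v\<in>(\<lambda>a. a # w) ` UNIV. emeasure M {x. win x 0 (Suc (length w)) = v})"
      by (rule emeasure_win_in[OF M(1)]) auto
    also have "\<dots> = (\<Sum>a\<in>UNIV. emeasure M (cyl UNIV (a # w)))"
      by (subst sum.reindex) (auto simp: inj_on_def cyl_eq_win)
    finally show "emeasure M (cyl UNIV w) = emeasure (distr M M shift) (cyl UNIV w)"
      using inv by simp
  qed (simp add: M(1))
  then have "emeasure M A = emeasure (distr M M shift) A" by simp
  then show ?thesis using emeasure_distr[OF meas A] sp by simp
qed

lemma (in sft) X_measurable [measurable]: "X \<in> sets full_shift_space"
proof -
  have "X = (\<Inter>i. {x. win x i memory \<in> words memory X})"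
    using memory(2)[of memory] by auto
  moreover have "{x. win x i memory \<in> words memory X} \<in> sets full_shift_space" for i
    using measurable_sets[OF measurable_win, of "words memory X" i memory] by (simp add: vimage_def)
  then have "(\<Inter>i. {x. win x i memory \<in> words memory X}) \<in> sets full_shift_space"
    by (intro sets.countable_INT) auto
  ultimately show ?thesis by simp
qed

section \<open>Entropy and the Gibbs property of the equilibrium state\<close>

lemma win_Suc_right: "win x i (Suc n) = win x i n @ [x (i + n)]"
  using win_add[of x i n "Suc 0"] by simp

lemma win_Suc_left: "win x i (Suc n) = x i # win x (Suc i) n"
  using win_add[of x i "Suc 0" n] by simp

locale invariant_measure = sft X for X :: "(nat \<Rightarrow> 'a::finite) set" +
  fixes \<mu> :: "(nat \<Rightarrow> 'a) measure"
  assumes inv: "inv_prob X \<mu>"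
begin

lemma sets_mu [simp, measurable_cong]: "sets \<mu> = sets full_shift_space"
  using inv by (simp add: inv_prob_def)

lemma space_mu [simp]: "space \<mu> = UNIV"
  using sets_eq_imp_space_eq[OF sets_mu] by simp

sublocale prob_space \<mu>
  using inv by (simp add: inv_prob_def)

lemma AE_in_X: "AE x in \<mu>. x \<in> X"
proof (rule AE_prob_1)
  show "prob X = 1" using inv by (simp add: inv_prob_def measure_def)
qed

lemma emeasure_shift: "A \<in> sets \<mu> \<Longrightarrow> emeasure \<mu> (shift -` A) = emeasure \<mu> A"
  using inv by (simp add: inv_prob_def)

definition p :: "'a list \<Rightarrow> real" where
  "p w = measure \<mu> (cyl X w)"

lemma cyl_measurable [measurable]: "cyl X w \<in> sets full_shift_space"
proof -
  have "cyl X w = X \<inter> {x. win x 0 (length w) = w}" by (auto simp: cyl_eq_win)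
  then show ?thesis by simp
qed

text \<open>\<open>X\<close> has full measure, so \<open>p\<close> may be computed with cylinders of
  the full shift. Sums can then run over all lists, inadmissible ones having weight 0.\<close>

lemma p_eq: "p w = prob {x. win x 0 (length w) = w}"
  unfolding p_def by (rule finite_measure_eq_AE) (use AE_in_X in \<open>auto simp: cyl_eq_win\<close>)

lemma p_nonneg: "p w \<ge> 0"
  by (simp add: p_def)

lemma p_le_1: "p w \<le> 1"
  by (simp add: p_def)

lemma p_zero: "w \<notin> language X \<Longrightarrow> p w = 0"
  using cyl_nonempty_iff[of X w] by (auto simp: p_def)

lemma p_Nil: "p [] = 1"
  using prob_space by (simp add: p_eq)

lemma prob_win_in:
  assumes "W \<subseteq> listsn n"
  shows "prob {x. win x 0 n \<in> W} = sum p W"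
proof -
  have "prob {x. win x 0 n \<in> W} = enn2real (\<Sum>w\<in>W. emeasure \<mu> {x. win x 0 n = w})"
    unfolding measure_def by (subst emeasure_win_in[OF sets_mu assms]) simp
  also have "(\<Sum>w\<in>W. emeasure \<mu> {x. win x 0 n = w}) = (\<Sum>w\<in>W. ennreal (p w))"
    using assms by (intro sum.cong refl) (auto simp: p_eq emeasure_eq_measure)
  finally show ?thesis by (simp add: p_nonneg sum_nonneg)
qed

lemma p_right: "(\<Sum>a\<in>UNIV. p (u @ [a])) = p u"
proof -
  have "{x. win x 0 (length u) = u} = {x. win x 0 (Suc (length u)) \<in> (\<lambda>a. u @ [a]) ` UNIV}"
    by (auto simp: win_Suc_right)
  then have "p u = sum p ((\<lambda>a. u @ [a]) ` UNIV)"
    unfolding p_eq[of u] by (simp only:) (rule prob_win_in, auto)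
  then show ?thesis by (simp add: sum.reindex inj_on_def)
qed

lemma p_left: "(\<Sum>a\<in>UNIV. p (a # u)) = p u"
proof -
  have "shift -` {x. win x 0 (length u) = u} = {x. win x 0 (Suc (length u)) \<in> (\<lambda>a. a # u) ` UNIV}"
    by (auto simp: win_Suc_left)
  then have "prob (shift -` {x. win x 0 (length u) = u}) = sum p ((\<lambda>a. a # u) ` UNIV)"
    by (simp only:) (rule prob_win_in, auto)
  moreover have "prob (shift -` {x. win x 0 (length u) = u}) = p u"
    unfolding p_eq measure_def by (subst emeasure_shift) auto
  ultimately show ?thesis by (simp add: sum.reindex inj_on_def)
qed

lemma sum_p_right: "(\<Sum>v\<in>listsn k. p (u @ v)) = p u"
proof (induction k)
  case (Suc k)
  have "(\<Sum>v\<in>listsn (k + 1). p (u @ v)) = (\<Sum>v\<in>listsn k. \<Sum>a\<in>UNIV. p ((u @ v) @ [a]))"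
    unfolding sum_listsn_append One_nat_def sum_listsn_1 by simp
  also have "\<dots> = p u" unfolding p_right by (rule Suc)
  finally show ?case by simp
qed simp

lemma sum_p_left: "(\<Sum>u\<in>listsn k. p (u @ v)) = p v"
proof (induction k)
  case (Suc k)
  have "(\<Sum>u\<in>listsn (1 + k). p (u @ v)) = (\<Sum>a\<in>UNIV. \<Sum>u\<in>listsn k. p (a # (u @ v)))"
    unfolding sum_listsn_append One_nat_def sum_listsn_1 by simp
  also have "\<dots> = (\<Sum>u\<in>listsn k. p (u @ v))" by (subst sum.swap) (simp add: p_left)
  also have "\<dots> = p v" by (rule Suc)
  finally show ?case by simp
qed simp

lemma sum_p: "(\<Sum>w\<in>listsn k. p w) = 1"
  using sum_p_right[of "[]" k] by (simp add: p_Nil)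

lemma sum_words_eq:
  assumes "\<And>w. p w = 0 \<Longrightarrow> F w = 0"
  shows "(\<Sum>w\<in>words n X. F w) = (\<Sum>w\<in>listsn n. F w)"
  by (rule sum.mono_neutral_left) (auto simp: words_def intro!: assms p_zero)

section \<open>Entropy of an invariant measure\<close>

definition H :: "nat \<Rightarrow> real" where
  "H n = (\<Sum>w\<in>listsn n. - p w * ln (p w))"

lemma p_append_zero: "p (u @ v) \<noteq> 0 \<Longrightarrow> p u > 0 \<and> p v > 0"
proof -
  assume nz: "p (u @ v) \<noteq> 0"
  have "p (u @ v) \<le> (\<Sum>v\<in>listsn (length v). p (u @ v))"
    by (rule member_le_sum[where f = "\<lambda>v. p (u @ v)"]) (auto simp: p_nonneg)
  moreover have "p (u @ v) \<le> (\<Sum>u\<in>listsn (length u). p (u @ v))"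
    by (rule member_le_sum[where f = "\<lambda>u. p (u @ v)"]) (auto simp: p_nonneg)
  ultimately show ?thesis using nz p_nonneg[of "u @ v"] unfolding sum_p_left sum_p_right by linarith
qed

text \<open>The Gibbs inequality against the product of the marginals of the first \<open>m\<close>
  and the last \<open>k\<close> letters; by invariance both marginals are given by \<open>p\<close>
  itself.\<close>

lemma H_subadditive: "H (m + k) \<le> H m + H k"
proof -
  have "H (m + k) \<le> (\<Sum>w\<in>listsn (m + k). - p w * ln (p (take m w) * p (drop m w)))"
    unfolding H_def
  proof (rule gibbs_inequality)
    have "(\<Sum>w\<in>listsn (m + k). p (take m w) * p (drop m w)) = (\<Sum>u\<in>listsn m. \<Sum>v\<in>listsn k. p u * p v)"
      unfolding sum_listsn_append by simp
    also have "\<dots> = 1" by (simp add: sum_product[symmetric] sum_p)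
    finally show "(\<Sum>w\<in>listsn (m + k). p (take m w) * p (drop m w)) \<le> 1" by simp
  next
    fix w assume "w \<in> listsn (m + k)" "p (take m w) * p (drop m w) = 0"
    then show "p w = 0"
      using p_append_zero[of "take m w" "drop m w"] by (metis append_take_drop_id less_irrefl mult_eq_0_iff)
  qed (auto simp: p_nonneg sum_p)
  also have "\<dots> = (\<Sum>u\<in>listsn m. \<Sum>v\<in>listsn k. - p (u @ v) * ln (p u * p v))"
    unfolding sum_listsn_append by simp
  also have "\<dots> = (\<Sum>u\<in>listsn m. \<Sum>v\<in>listsn k. p (u @ v) * (- ln (p u)) + p (u @ v) * (- ln (p v)))"
  proof (intro sum.cong refl)
    fix u v
    show "- p (u @ v) * ln (p u * p v) = p (u @ v) * (- ln (p u)) + p (u @ v) * (- ln (p v))"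
      using p_append_zero[of u v] by (cases "p (u @ v) = 0") (auto simp: ln_mult algebra_simps)
  qed
  also have "\<dots> = (\<Sum>u\<in>listsn m. \<Sum>v\<in>listsn k. p (u @ v) * (- ln (p u)))
      + (\<Sum>u\<in>listsn m. \<Sum>v\<in>listsn k. p (u @ v) * (- ln (p v)))"
    by (simp only: sum.distrib)
  also have "(\<Sum>u\<in>listsn m. \<Sum>v\<in>listsn k. p (u @ v) * (- ln (p u))) = H m"
    unfolding sum_distrib_right[symmetric] sum_p_right H_def by simp
  also have "(\<Sum>u\<in>listsn m. \<Sum>v\<in>listsn k. p (u @ v) * (- ln (p v))) = H k"
    unfolding H_def by (subst sum.swap) (simp add: sum_distrib_right[symmetric] sum_p_left sum_negf)
  finally show ?thesis .
qed

lemma H_nonneg: "H n \<ge> 0"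
  unfolding H_def
proof (rule sum_nonneg)
  fix w
  show "0 \<le> - p w * ln (p w)"
    using p_nonneg[of w] p_le_1[of w]
    by (cases "p w = 0") (auto simp: mult_le_0_iff)
qed

text \<open>\<open>ms_entropy\<close> is a bare \<open>lim\<close>. Fekete's lemma shows that the
  limit exists, so inequalities at finite length can be passed to it.\<close>

lemma entropy_limit: "(\<lambda>n. H n / real n) \<longlonglongrightarrow> ms_entropy X \<mu>"
proof -
  obtain L where "(\<lambda>n. H n / real n) \<longlonglongrightarrow> L"
  proof (rule fekete[of H 0])
    show "H (m + k) \<le> H m + H k" for m k by (rule H_subadditive)
    show "- 0 * real m \<le> H m" for m using H_nonneg by simp
  qed (use that in blast)
  moreover have "(\<lambda>n. (1 / real n) * (\<Sum>w\<in>words n X. - measure \<mu> (cyl X w) * ln (measure \<mu> (cyl X w)))) = (\<lambda>n. H n / real n)"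
    unfolding p_def[symmetric] H_def by (subst sum_words_eq) auto
  ultimately show ?thesis unfolding ms_entropy_def by (simp only: limI)
qed

lemma integral_shift:
  fixes F :: "(nat \<Rightarrow> 'a) \<Rightarrow> real"
  assumes F [measurable]: "F \<in> borel_measurable full_shift_space"
  shows "(LINT x|\<mu>. F ((shift ^^ i) x)) = (LINT x|\<mu>. F x)"
proof (induction i)
  case (Suc i)
  have "distr \<mu> \<mu> shift = \<mu>"
  proof (rule measure_eqI)
    fix A assume "A \<in> sets (distr \<mu> \<mu> shift)"
    then show "emeasure (distr \<mu> \<mu> shift) A = emeasure \<mu> A"
      using emeasure_shift[of A] by (subst emeasure_distr) auto
  qed simp
  moreover have m: "(\<lambda>x. F ((shift ^^ i) x)) \<in> borel_measurable \<mu>"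
    by measurable
  ultimately have "(LINT x|\<mu>. F ((shift ^^ i) x)) = (LINT x|distr \<mu> \<mu> shift. F ((shift ^^ i) x))" by simp
  also have "\<dots> = (LINT x|\<mu>. F ((shift ^^ i) (shift x)))"
    by (rule integral_distr[OF _ m]) measurable
  finally show ?case using Suc by (simp add: funpow_swap1)
qed simp

end

section \<open>Birkhoff sums and bounded distortion\<close>

definition birkhoff_sum :: "((nat \<Rightarrow> 'a) \<Rightarrow> real) \<Rightarrow> nat \<Rightarrow> (nat \<Rightarrow> 'a) \<Rightarrow> real" where
  "birkhoff_sum f m x = (\<Sum>i<m. f ((shift ^^ i) x))"

lemma birkhoff_sum_add: "birkhoff_sum f (m + k) x = birkhoff_sum f m x + birkhoff_sum f k ((shift ^^ m) x)"
proof -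
  have "birkhoff_sum f (m + k) x = birkhoff_sum f m x + (\<Sum>i\<in>{m..<m + k}. f ((shift ^^ i) x))"
    unfolding birkhoff_sum_def atLeast0LessThan[symmetric] by (simp add: sum.atLeastLessThan_concat)
  also have "(\<Sum>i\<in>{m..<m + k}. f ((shift ^^ i) x)) = birkhoff_sum f k ((shift ^^ m) x)"
    unfolding birkhoff_sum_def
    by (rule sum.reindex_bij_witness[of _ "\<lambda>i. i + m" "\<lambda>i. i - m"]) (auto simp: shift_funpow)
  finally show ?thesis .
qed

locale holder_sft = mixing_sft X for X :: "(nat \<Rightarrow> 'a::finite) set" +
  fixes f :: "(nat \<Rightarrow> 'a) \<Rightarrow> real" and c \<theta> :: real
  assumes theta: "0 < \<theta>" "\<theta> < 1"
    and holder: "x \<in> X \<Longrightarrow> y \<in> X \<Longrightarrow> win x 0 k = win y 0 k \<Longrightarrow> \<bar>f x - f y\<bar> \<le> c * \<theta> ^ k"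
begin

lemma c_nonneg: "c \<ge> 0"
proof -
  obtain x where "x \<in> X" using nonempty by blast
  then show ?thesis using holder[of x x 0] by simp
qed

definition distortion :: real where
  "distortion = c / (1 - \<theta>)"

lemma distortion_nonneg: "distortion \<ge> 0"
  using theta c_nonneg by (simp add: distortion_def)

text \<open>At time \<open>i\<close> the two orbits still agree on \<open>m - i\<close> letters, so
  the differences are dominated by a geometric series, uniformly in \<open>m\<close>.\<close>

lemma birkhoff_distortion:
  assumes "x \<in> X" "y \<in> X" "win x 0 m = win y 0 m"
  shows "\<bar>birkhoff_sum f m x - birkhoff_sum f m y\<bar> \<le> distortion"
proof -
  have "\<bar>birkhoff_sum f m x - birkhoff_sum f m y\<bar> \<le> (\<Sum>i<m. \<bar>f ((shift ^^ i) x) - f ((shift ^^ i) y)\<bar>)"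
    unfolding birkhoff_sum_def sum_subtractf[symmetric] by (rule sum_abs)
  also have "\<dots> \<le> (\<Sum>i<m. c * \<theta> ^ (m - i))"
  proof (rule sum_mono)
    fix i assume i: "i \<in> {..<m}"
    have "win x i (m - i) = win y i (m - i)"
      using assms(3) win_add[of x 0 i "m - i"] win_add[of y 0 i "m - i"] i by simp
    then show "\<bar>f ((shift ^^ i) x) - f ((shift ^^ i) y)\<bar> \<le> c * \<theta> ^ (m - i)"
      using assms by (intro holder shift_closed) auto
  qed
  also have "\<dots> = c * (\<Sum>i<m. \<theta> ^ (Suc i))"
    unfolding sum_distrib_left[symmetric]
    by (rule arg_cong[where f = "\<lambda>t. c * t"], rule sum.reindex_bij_witness[of _ "\<lambda>i. m - Suc i" "\<lambda>i. m - Suc i"])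
      (auto simp: Suc_diff_Suc simp del: power_Suc)
  also have "\<dots> \<le> c * (\<Sum>i<m. \<theta> ^ i)"
    using theta c_nonneg by (intro mult_left_mono sum_mono) (auto simp: mult_left_le_one_le)
  also have "\<dots> \<le> c * (1 / (1 - \<theta>))"
  proof (intro mult_left_mono c_nonneg)
    have "(\<Sum>i<m. \<theta> ^ i) = (1 - \<theta> ^ m) / (1 - \<theta>)"
      using theta by (simp add: sum_gp_strict)
    also have "\<dots> \<le> 1 / (1 - \<theta>)" using theta by (intro divide_right_mono) auto
    finally show "(\<Sum>i<m. \<theta> ^ i) \<le> 1 / (1 - \<theta>)" .
  qed
  finally show ?thesis by (simp add: distortion_def)
qed

text \<open>Any point of the cylinder would do: by bounded distortion the choice changes
  \<open>weight\<close> by at most a factor \<open>exp distortion\<close>.\<close>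

definition point_of :: "'a list \<Rightarrow> (nat \<Rightarrow> 'a)" where
  "point_of w = (SOME x. x \<in> cyl X w)"

lemma point_of: "w \<in> language X \<Longrightarrow> point_of w \<in> X \<and> win (point_of w) 0 (length w) = w"
proof -
  assume "w \<in> language X"
  then have "\<exists>x. x \<in> cyl X w" using cyl_nonempty_iff[of X w] by blast
  from someI_ex[OF this] show ?thesis by (simp add: point_of_def cyl_eq_win)
qed

definition weight :: "'a list \<Rightarrow> real" where
  "weight w = (if w \<in> language X then exp (birkhoff_sum f (length w) (point_of w)) else 0)"

lemma ln_weight: "w \<in> language X \<Longrightarrow> ln (weight w) = birkhoff_sum f (length w) (point_of w)"
  by (simp add: weight_def)

lemma ln_weight_approx: "x \<in> X \<Longrightarrow> \<bar>birkhoff_sum f n x - ln (weight (win x 0 n))\<bar> \<le> distortion"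
  using point_of[of "win x 0 n"] win_in_words[of x 0 n] by (simp add: ln_weight birkhoff_distortion)

text \<open>The Birkhoff sum splits exactly along the point chosen for \<open>u @ v\<close>; passing
  to the points chosen for \<open>u\<close> and for \<open>v\<close> costs one
  \<open>distortion\<close> each.\<close>

lemma ln_weight_append:
  assumes "u @ v \<in> language X"
  shows "\<bar>ln (weight (u @ v)) - ln (weight u) - ln (weight v)\<bar> \<le> 2 * distortion"
proof -
  define x where "x = point_of (u @ v)"
  have x: "x \<in> X" "win x 0 (length u) = u" "win ((shift ^^ length u) x) 0 (length v) = v"
    using point_of[OF assms] by (auto simp: x_def win_add)
  have "ln (weight (u @ v)) = birkhoff_sum f (length u) x + birkhoff_sum f (length v) ((shift ^^ length u) x)"
    using assms by (simp add: ln_weight x_def birkhoff_sum_add)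
  then show ?thesis
    using ln_weight_approx[OF x(1), of "length u"] ln_weight_approx[OF shift_closed[OF x(1)], of "length v" "length u"]
    unfolding x by linarith
qed

lemma weight_pos: "w \<in> language X \<Longrightarrow> weight w > 0"
  by (simp add: weight_def)

sublocale weight: quasi_multiplicative X weight "exp (2 * distortion)"
proof unfold_locales
  show "1 \<le> exp (2 * distortion)" using distortion_nonneg by simp
next
  fix u v
  have E: "weight u * weight v \<le> exp (2 * distortion) * weight (u @ v)"
      "weight (u @ v) \<le> exp (2 * distortion) * (weight u * weight v)"
    if uv: "u @ v \<in> language X"
  proof -
    have pos: "weight (u @ v) > 0" "weight u > 0" "weight v > 0"
      using weight_pos[OF uv] weight_pos[OF language_appendD1[OF uv]] weight_pos[OF language_appendD2[OF uv]] by auto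
    have "exp (ln (weight u) + ln (weight v)) \<le> exp (2 * distortion + ln (weight (u @ v)))"
      "exp (ln (weight (u @ v))) \<le> exp (2 * distortion + (ln (weight u) + ln (weight v)))"
      using ln_weight_append[OF uv] by auto
    then show "weight u * weight v \<le> exp (2 * distortion) * weight (u @ v)"
      "weight (u @ v) \<le> exp (2 * distortion) * (weight u * weight v)"
      using pos by (simp_all add: exp_add)
  qed
  have nn: "weight w \<ge> 0" for w by (simp add: weight_def)
  show "weight (u @ v) \<le> exp (2 * distortion) * weight u * weight v"
  proof (cases "u @ v \<in> language X")
    case True
    then show ?thesis using E(2) by simp
  next
    case False
    then have "weight (u @ v) = 0" unfolding weight_def by (rule if_not_P)
    then show ?thesis using nn by simp
  qed
  show "weight u * weight v \<le> exp (2 * distortion) * weight (u @ v)" if "u @ v \<in> language X"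
    using E(1)[OF that] .
qed (auto simp: weight_def)

text \<open>\<open>f\<close> is controlled on \<open>X\<close> alone. Cut off outside, it becomes
  measurable on the whole shift space, as a pointwise limit of functions of finitely many letters
  and of membership in \<open>X\<close>.\<close>

definition f0 :: "(nat \<Rightarrow> 'a) \<Rightarrow> real" where
  "f0 x = indicator X x * f x"

lemma f0_measurable [measurable]: "f0 \<in> borel_measurable full_shift_space"
proof (rule borel_measurable_LIMSEQ_real)
  show "(\<lambda>n. indicator X x * f (point_of (win x 0 n))) \<longlonglongrightarrow> f0 x" for x
  proof (cases "x \<in> X")
    case True
    have "(\<lambda>n. f (point_of (win x 0 n)) - f x) \<longlonglongrightarrow> 0"
    proof (rule Lim_null_comparison)
      show "\<forall>\<^sub>F n in sequentially. norm (f (point_of (win x 0 n)) - f x) \<le> c * \<theta> ^ n"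
      proof (rule always_eventually, rule allI)
        fix n
        have "point_of (win x 0 n) \<in> X" "win (point_of (win x 0 n)) 0 n = win x 0 n"
          using point_of[of "win x 0 n"] win_in_words[OF True, of 0 n] by auto
        then show "norm (f (point_of (win x 0 n)) - f x) \<le> c * \<theta> ^ n"
          using holder[OF _ True] by simp
      qed
      show "(\<lambda>n. c * \<theta> ^ n) \<longlonglongrightarrow> 0"
        using theta by (intro tendsto_mult_right_zero LIMSEQ_realpow_zero) auto
    qed
    from tendsto_add[OF this tendsto_const[of "f x"]] show ?thesis
      using True by (simp add: f0_def)
  qed (simp add: f0_def)
  show "(\<lambda>x. indicator X x * f (point_of (win x 0 n))) \<in> borel_measurable full_shift_space" for n
    by (intro borel_measurable_times borel_measurable_indicator X_measurable
        measurable_compose[OF measurable_win]) simp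
qed

lemma f0_bounded: obtains B where "\<And>x. \<bar>f0 x\<bar> \<le> B"
proof -
  obtain y where y: "y \<in> X" using nonempty by blast
  have "\<bar>f0 x\<bar> \<le> \<bar>f y\<bar> + c" for x
    using holder[OF _ y, of x 0] c_nonneg by (cases "x \<in> X") (auto simp: f0_def)
  then show ?thesis using that by blast
qed

text \<open>The sum is the integral of a function of \<open>n\<close> letters that stays within
  \<open>distortion\<close> of the Birkhoff sum on \<open>X\<close>; the Birkhoff sum integrates to
  \<open>n\<close> times the energy by invariance.\<close>

lemma energy_bound:
  assumes "inv_prob X \<mu>"
  shows "\<bar>(\<Sum>w\<in>listsn n. measure \<mu> (cyl X w) * ln (weight w)) - real n * (LINT x:X|\<mu>. f x)\<bar> \<le> distortion"
proof -
  interpret invariant_measure X \<mu> by unfold_locales fact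
  obtain B where B: "\<And>x. \<bar>f0 x\<bar> \<le> B" using f0_bounded by blast
  have f0i: "integrable \<mu> (\<lambda>x. f0 ((shift ^^ i) x))" for i
    using B by (intro integrable_const_bound[where B = B]) auto
  have If: "(LINT x:X|\<mu>. f x) = (LINT x|\<mu>. f0 x)"
    by (simp add: set_lebesgue_integral_def f0_def)
  let ?A = "\<lambda>x. \<Sum>i<n. f0 ((shift ^^ i) x)"
  let ?B = "\<lambda>x. \<Sum>w\<in>listsn n. indicator {x. win x 0 n = w} x * ln (weight w)"
  have iA: "integrable \<mu> ?A" by (intro Bochner_Integration.integrable_sum f0i)
  have iB: "integrable \<mu> ?B" 
    by (intro Bochner_Integration.integrable_sum integrable_mult_left integrable_real_indicator) (auto simp: emeasure_eq_measure)
  have IA: "(LINT x|\<mu>. ?A x) = real n * (LINT x:X|\<mu>. f x)"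
    using f0i by (simp add: Bochner_Integration.integral_sum integral_shift If)
  have IB: "(LINT x|\<mu>. ?B x) = (\<Sum>w\<in>listsn n. p w * ln (weight w))"
  proof -
    have "(LINT x|\<mu>. ?B x) = (\<Sum>w\<in>listsn n. LINT x|\<mu>. indicator {x. win x 0 n = w} x * ln (weight w))"
      by (intro Bochner_Integration.integral_sum integrable_mult_left integrable_real_indicator) (auto simp: emeasure_eq_measure)
    also have "\<dots> = (\<Sum>w\<in>listsn n. p w * ln (weight w))"
      by (intro sum.cong refl) (auto simp: p_eq)
    finally show ?thesis .
  qed
  have AE: "AE x in \<mu>. \<bar>?B x - ?A x\<bar> \<le> distortion"
    using AE_in_X
  proof eventually_elim
    case (elim x)
    have "?A x = birkhoff_sum f n x"
      unfolding birkhoff_sum_def using shift_closed[OF elim] by (intro sum.cong refl) (simp add: f0_def)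
    moreover have "?B x = ln (weight (win x 0 n))"
      by (subst sum.remove[of _ "win x 0 n"]) (auto intro!: sum.neutral)
    ultimately show ?case using ln_weight_approx[OF elim, of n] by (simp add: abs_minus_commute)
  qed
  have "\<bar>(LINT x|\<mu>. ?B x - ?A x)\<bar> \<le> (LINT x|\<mu>. \<bar>?B x - ?A x\<bar>)"
    by (rule integral_abs_bound)
  also have "\<dots> \<le> (LINT x|\<mu>. distortion)"
    using AE iA iB by (intro integral_mono_AE) auto
  also have "\<dots> = distortion" using prob_space by simp
  also have "(LINT x|\<mu>. ?B x - ?A x) = (\<Sum>w\<in>listsn n. p w * ln (weight w)) - real n * (LINT x:X|\<mu>. f x)"
    using iA iB by (simp only: Bochner_Integration.integral_diff IA IB)
  finally show ?thesis by (simp add: p_def)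
qed

theorem gibbs_measure_quasi_bernoulli:
  assumes "gibbs_measure X f \<mu>"
  obtains C where "C \<ge> 1"
    "\<And>u v. measure \<mu> (cyl X (u @ v)) \<le> C * (measure \<mu> (cyl X u) * measure \<mu> (cyl X v))"
    "\<And>u v. u @ v \<in> language X \<Longrightarrow>
      measure \<mu> (cyl X u) * measure \<mu> (cyl X v) \<le> C * measure \<mu> (cyl X (u @ v))"
    "\<And>u. u \<in> language X \<Longrightarrow> measure \<mu> (cyl X u) > 0"
proof -
  obtain \<nu> P K where K: "K > 0" and \<nu>: "\<And>u. \<nu> u \<ge> 0" "\<nu> [] = 1"
    "\<And>u. (\<Sum>a\<in>UNIV. \<nu> (u @ [a])) = \<nu> u" "\<And>u. (\<Sum>a\<in>UNIV. \<nu> (a # u)) = \<nu> u"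
    and up: "\<And>u. \<nu> u \<le> K * (weight u * exp (- P * real (length u)))"
    and lo: "\<And>u. weight u * exp (- P * real (length u)) \<le> K * \<nu> u"
    by (rule weight.invariant_gibbs_weights_ex) blast
  interpret W: right_consistent \<nu> by unfold_locales (use \<nu> in auto)
  let ?M = "W.word_measure"
  interpret M: prob_space ?M by (rule W.prob_space_word_measure)
  have spM: "space ?M = UNIV" using sets_eq_imp_space_eq[OF W.sets_word_measure] by simp
  have \<nu>_zero: "\<nu> u = 0" if "u \<notin> language X" for u
    using up[of u] \<nu>(1)[of u] that by (simp add: weight_def)
  have \<nu>_pos: "\<nu> u > 0" if "u \<in> language X" for u
  proof -
    have "0 < weight u * exp (- P * real (length u))" using weight_pos[OF that] by simp
    then have "0 < K * \<nu> u" using lo[of u] by linarith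
    then show ?thesis using K by (simp add: zero_less_mult_iff)
  qed
  have shiftM: "emeasure ?M (shift -` A) = emeasure ?M A" if "A \<in> sets ?M" for A
    using that
    by (intro emeasure_vimage_shift W.prob_space_word_measure)
      (simp_all add: W.emeasure_word_measure \<nu> sum_ennreal)
  have winM: "emeasure ?M {x. win x i n = w} = ennreal (\<nu> w)" if "length w = n" for i n w
  proof (induction i)
    case 0
    then show ?case using W.emeasure_word_measure[of w] that by (simp add: cyl_eq_win)
  next
    case (Suc i)
    have "{x. win x (Suc i) n = w} = shift -` {x. win x i n = w}" by auto
    then show ?case using shiftM[of "{x. win x i n = w}"] Suc by simp
  qed
  \<comment> \<open>Each position shows an inadmissible window with probability zero, and there are
    countably many positions; by locality almost every point then lies in \<open>X\<close>.\<close>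
  have "AE x in ?M. \<forall>i. win x i memory \<in> words memory X"
    unfolding AE_all_countable
  proof
    fix i
    have "{x. win x i memory \<in> listsn memory - words memory X} \<in> null_sets ?M"
    proof (rule null_setsI)
      show "emeasure ?M {x. win x i memory \<in> listsn memory - words memory X} = 0"
        by (subst emeasure_win_in[of _ _ memory]) (auto simp: winM \<nu>_zero)
      show "{x. win x i memory \<in> listsn memory - words memory X} \<in> sets ?M"
        using measurable_sets[OF measurable_win, of "listsn memory - words memory X" i memory] by (simp add: vimage_def)
    qed
    then show "AE x in ?M. win x i memory \<in> words memory X"
      by (rule AE_I') auto
  qed
  then have "AE x in ?M. x \<in> X" using memory(2)[of memory] by simp
  then have "emeasure ?M X = emeasure ?M (space ?M)"
    using sets.top[of full_shift_space] by (intro emeasure_eq_AE) (auto simp: spM)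
  then have invM: "inv_prob X ?M"
    unfolding inv_prob_def using shiftM M.emeasure_space_1 W.prob_space_word_measure by auto
  interpret N: invariant_measure X ?M by unfold_locales (rule invM)
  have pN: "N.p w = \<nu> w" for w
    unfolding N.p_eq using W.measure_word_measure[of w] by (simp add: cyl_eq_win)
  have ln_up: "ln (\<nu> w) \<le> ln K + ln (weight w) - P * real (length w)" if "w \<in> language X" for w
  proof -
    have "ln (\<nu> w) \<le> ln (K * (weight w * exp (- P * real (length w))))"
      using up \<nu>_pos[OF that] by (intro ln_mono) auto
    then show ?thesis using K weight_pos[OF that] by (simp add: ln_mult)
  qed
  have ln_lo: "ln (\<nu> w) \<ge> - ln K + ln (weight w) - P * real (length w)" if "w \<in> language X" for w
  proof -
    have "ln (weight w * exp (- P * real (length w))) \<le> ln (K * \<nu> w)"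
      using lo weight_pos[OF that] by (intro ln_mono) auto
    then show ?thesis using K weight_pos[OF that] \<nu>_pos[OF that] by (simp add: ln_mult)
  qed
  \<comment> \<open>The Gibbs inequality against \<nu> bounds the entropy at length \<open>n\<close>
    by \<open>n\<close> times the pressure minus the energy, up to a constant that disappears after
    division by \<open>n\<close>.\<close>
  have upper: "ms_entropy X \<nu>' + (LINT x:X|\<nu>'. f x) \<le> P" if "inv_prob X \<nu>'" for \<nu>'
  proof -
    interpret N': invariant_measure X \<nu>' by unfold_locales (rule that)
    let ?I = "LINT x:X|\<nu>'. f x"
    have H: "N'.H n \<le> real n * (P - ?I) + (distortion + ln K)" for n
    proof -
      have "N'.H n = (\<Sum>w\<in>words n X. - N'.p w * ln (N'.p w))"
        unfolding N'.H_def by (rule N'.sum_words_eq[symmetric]) simp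
      also have "\<dots> \<le> (\<Sum>w\<in>words n X. - N'.p w * ln (\<nu> w))"
      proof (rule gibbs_inequality)
        show "sum N'.p (words n X) = 1"
          using N'.sum_words_eq[of N'.p n] N'.sum_p by simp
        have "sum \<nu> (words n X) \<le> sum \<nu> (listsn n)"
          using \<nu>(1) words_subset_listsn by (intro sum_mono2) auto
        also have "\<dots> = 1" using N.sum_p[of n] by (simp add: pN)
        finally show "sum \<nu> (words n X) \<le> 1" .
      next
        fix w assume w: "w \<in> words n X" "\<nu> w = 0"
        then have "w \<in> language X" by (auto simp: words_def)
        then show "N'.p w = 0" using \<nu>_pos[of w] w(2) by simp
      qed (auto simp: N'.p_nonneg \<nu>)
      also have "\<dots> \<le> (\<Sum>w\<in>words n X. N'.p w * (ln K + P * real n) - N'.p w * ln (weight w))"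
      proof (rule sum_mono)
        fix w assume "w \<in> words n X"
        then have w: "w \<in> language X" "length w = n" by (auto simp: words_def)
        have "N'.p w * (- ln (\<nu> w)) \<le> N'.p w * (ln K + P * real n - ln (weight w))"
          using ln_lo[OF w(1)] w N'.p_nonneg by (intro mult_left_mono) auto
        then show "- N'.p w * ln (\<nu> w) \<le> N'.p w * (ln K + P * real n) - N'.p w * ln (weight w)"
          by (simp add: algebra_simps)
      qed
      also have "\<dots> = (\<Sum>w\<in>listsn n. N'.p w * (ln K + P * real n) - N'.p w * ln (weight w))"
        by (rule N'.sum_words_eq) simp
      also have "\<dots> = ln K + P * real n - (\<Sum>w\<in>listsn n. N'.p w * ln (weight w))"
        by (simp add: sum_subtractf sum_distrib_right[symmetric] N'.sum_p)
      finally show ?thesis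
        using energy_bound[OF that, of n] unfolding N'.p_def[symmetric] by (simp add: algebra_simps abs_le_iff)
    qed
    have "(\<lambda>n. (P - ?I) + (distortion + ln K) / real n) \<longlonglongrightarrow> (P - ?I) + 0"
      by (intro tendsto_intros lim_const_over_n)
    moreover have "\<forall>\<^sub>F n in sequentially. N'.H n / real n \<le> (P - ?I) + (distortion + ln K) / real n"
      using eventually_gt_at_top[of 0]
    proof eventually_elim
      case (elim n)
      have "N'.H n / real n \<le> (real n * (P - ?I) + (distortion + ln K)) / real n"
        using H by (intro divide_right_mono) auto
      then show ?case using elim by (simp add: add_divide_distrib)
    qed
    ultimately have "ms_entropy X \<nu>' \<le> (P - ?I) + 0"
      by (rule tendsto_le[OF sequentially_bot _ N'.entropy_limit])
    then show ?thesis by simp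
  qed
  \<comment> \<open>For the constructed measure the upper bound on \<nu> gives the opposite
    inequality, so the pressure is attained.\<close>
  have lower: "ms_entropy X ?M + (LINT x:X|?M. f x) \<ge> P"
  proof -
    let ?I = "LINT x:X|?M. f x"
    have H: "real n * (P - ?I) - (distortion + ln K) \<le> N.H n" for n
    proof -
      have "ln K + (\<Sum>w\<in>listsn n. N.p w * ln (weight w)) - P * real n
          = (\<Sum>w\<in>listsn n. N.p w * (ln K - P * real n) + N.p w * ln (weight w))"
        by (simp add: sum.distrib sum_distrib_right[symmetric] N.sum_p)
      also have "\<dots> \<ge> (\<Sum>w\<in>listsn n. N.p w * ln (N.p w))"
      proof (rule sum_mono)
        fix w :: "'a list" assume w: "w \<in> listsn n"
        show "N.p w * ln (N.p w) \<le> N.p w * (ln K - P * real n) + N.p w * ln (weight w)"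
        proof (cases "w \<in> language X")
          case True
          have "N.p w * ln (N.p w) \<le> N.p w * (ln K + ln (weight w) - P * real n)"
            using ln_up[OF True] w N.p_nonneg[of w] by (intro mult_left_mono) (auto simp: pN)
          then show ?thesis by (simp add: algebra_simps)
        qed (simp add: N.p_zero)
      qed
      finally have "- N.H n \<le> ln K + (\<Sum>w\<in>listsn n. N.p w * ln (weight w)) - P * real n"
        by (simp add: N.H_def sum_negf)
      then show ?thesis
        using energy_bound[OF invM, of n] unfolding N.p_def[symmetric] by (simp add: algebra_simps abs_le_iff)
    qed
    have "(\<lambda>n. (P - ?I) - (distortion + ln K) / real n) \<longlonglongrightarrow> (P - ?I) - 0"
      by (intro tendsto_intros lim_const_over_n)
    moreover have "\<forall>\<^sub>F n in sequentially. (P - ?I) - (distortion + ln K) / real n \<le> N.H n / real n"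
      using eventually_gt_at_top[of 0]
    proof eventually_elim
      case (elim n)
      have "(real n * (P - ?I) - (distortion + ln K)) / real n \<le> N.H n / real n"
        using H by (intro divide_right_mono) auto
      then show ?case using elim by (simp add: diff_divide_distrib)
    qed
    ultimately have "(P - ?I) - 0 \<le> ms_entropy X ?M"
      by (rule tendsto_le[OF sequentially_bot N.entropy_limit])
    then show ?thesis by simp
  qed
  have "equilibrium_state X f ?M"
    unfolding equilibrium_state_def using invM upper lower by (meson order_trans)
  then have \<mu>: "\<mu> = ?M" using assms unfolding gibbs_measure_def by blast
  \<comment> \<open>Three comparisons of \<nu> with the weights, for \<open>u\<close>,
    \<open>v\<close> and \<open>u @ v\<close>, cost \<open>K\<close> each; quasi-multiplicativity of
    the weights costs the exponential.\<close>
  define C where "C = max 1 (K ^ 3 * exp (2 * distortion))"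
  let ?e = "\<lambda>u. weight u * exp (- P * real (length u))"
  have C: "K ^ 3 * exp (2 * distortion) \<le> C" by (simp add: C_def)
  have e: "?e u \<ge> 0" for u by (simp add: weight_def)
  show ?thesis
  proof (rule that[of C])
    show "C \<ge> 1" by (simp add: C_def)
    fix u v
    have "\<nu> (u @ v) \<le> K * (weight (u @ v) * exp (- P * real (length (u @ v))))" by (rule up)
    also have "\<dots> \<le> K * ((exp (2 * distortion) * weight u * weight v) * exp (- P * real (length (u @ v))))"
      using K weight.g_upper by (intro mult_left_mono mult_right_mono) auto
    also have "\<dots> = K * exp (2 * distortion) * (?e u * ?e v)"
      by (simp add: exp_add[symmetric] algebra_simps)
    also have "\<dots> \<le> K * exp (2 * distortion) * ((K * \<nu> u) * (K * \<nu> v))"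
      by (rule mult_left_mono, rule mult_mono[OF lo lo]) (use K e \<nu>(1) in auto)
    also have "\<dots> = K ^ 3 * exp (2 * distortion) * (\<nu> u * \<nu> v)"
      by (simp add: power3_eq_cube ac_simps)
    also have "\<dots> \<le> C * (\<nu> u * \<nu> v)" using C \<nu>(1) by (intro mult_right_mono) auto
    finally show "measure \<mu> (cyl X (u @ v)) \<le> C * (measure \<mu> (cyl X u) * measure \<mu> (cyl X v))"
      unfolding \<mu> N.p_def[symmetric] pN .
  next
    fix u v assume uv: "u @ v \<in> language X"
    have "\<nu> u * \<nu> v \<le> (K * ?e u) * (K * ?e v)"
      using K e up \<nu>(1) by (intro mult_mono) auto
    also have "\<dots> = K ^ 2 * ((weight u * weight v) * exp (- P * real (length (u @ v))))"
      by (simp add: exp_add[symmetric] algebra_simps power2_eq_square)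
    also have "\<dots> \<le> K ^ 2 * ((exp (2 * distortion) * weight (u @ v)) * exp (- P * real (length (u @ v))))"
      using K weight.g_lower[OF uv] by (intro mult_left_mono mult_right_mono) auto
    also have "\<dots> = K ^ 2 * exp (2 * distortion) * ?e (u @ v)" by (simp add: ac_simps)
    also have "\<dots> \<le> K ^ 2 * exp (2 * distortion) * (K * \<nu> (u @ v))"
      by (rule mult_left_mono[OF lo]) (use K in auto)
    also have "\<dots> = K ^ 3 * exp (2 * distortion) * \<nu> (u @ v)"
      by (simp add: power3_eq_cube power2_eq_square ac_simps)
    also have "\<dots> \<le> C * \<nu> (u @ v)" using C \<nu>(1) by (intro mult_right_mono) auto
    finally show "measure \<mu> (cyl X u) * measure \<mu> (cyl X v) \<le> C * measure \<mu> (cyl X (u @ v))"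
      unfolding \<mu> N.p_def[symmetric] pN .
  next
    fix u assume "u \<in> language X"
    then show "measure \<mu> (cyl X u) > 0" unfolding \<mu> N.p_def[symmetric] pN by (rule \<nu>_pos)
  qed
qed

end

section \<open>Repeated windows\<close>

lemma block_end_le: "b < K \<Longrightarrow> b * n + n \<le> K * (n::nat)"
  using mult_le_mono1[of "Suc b" K n] by simp

definition periodic :: "'a list \<Rightarrow> nat \<Rightarrow> 'a" where
  "periodic w = (\<lambda>i. w ! (i mod length w))"

definition cyclic_windows :: "nat \<Rightarrow> 'a list \<Rightarrow> 'a list set" where
  "cyclic_windows n w = (\<lambda>j. win (periodic w) j n) ` {..<length w}"

lemma finite_cyclic_windows [simp]: "finite (cyclic_windows n w)"
  by (simp add: cyclic_windows_def)

lemma card_cyclic_windows_le: "card (cyclic_windows n w) \<le> length w"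
  unfolding cyclic_windows_def using card_image_le[of "{..<length w}"] by fastforce

lemma win_periodic_in_cyclic_windows: "w \<noteq> [] \<Longrightarrow> win (periodic w) i n \<in> cyclic_windows n w"
proof -
  assume w: "w \<noteq> []"
  have "win (periodic w) i n = win (periodic w) (i mod length w) n"
    by (simp add: win_eq_iff periodic_def mod_add_left_eq)
  then show ?thesis unfolding cyclic_windows_def using w by (intro image_eqI[of _ _ "i mod length w"]) auto
qed

text \<open>Positions whose window brings nothing new. \<open>Ext\<close> stands for windows counted
  before: none in a first moment, the windows of another loop in the second moment.\<close>

definition repeats :: "nat \<Rightarrow> 'a list set \<Rightarrow> 'a list \<Rightarrow> nat set" where
  "repeats n Ext w = {j. j < length w \<and> (win (periodic w) j n \<in> Ext \<or>
     (\<exists>i<j. win (periodic w) i n = win (periodic w) j n))}"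

text \<open>The positions that are not repeats carry pairwise distinct windows, all outside
  \<open>Ext\<close>.\<close>

lemma card_repeats:
  assumes "finite Ext"
  shows "card Ext + length w \<le> card (Ext \<union> cyclic_windows n w) + card (repeats n Ext w)"
proof -
  let ?R = "repeats n Ext w" and ?w = "\<lambda>j. win (periodic w) j n"
  have R: "?R \<subseteq> {..<length w}" by (auto simp: repeats_def)
  have "inj_on ?w ({..<length w} - ?R)"
  proof (rule inj_onI)
    fix i j assume "i \<in> {..<length w} - ?R" "j \<in> {..<length w} - ?R" "?w i = ?w j"
    then show "i = j" by (cases i j rule: linorder_cases) (auto simp: repeats_def)
  qed
  then have "card ({..<length w} - ?R) = card (?w ` ({..<length w} - ?R))"
    by (rule card_image[symmetric])
  also have "\<dots> \<le> card (cyclic_windows n w - Ext)"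
    by (rule card_mono) (auto simp: cyclic_windows_def repeats_def)
  also have "\<dots> = card (Ext \<union> cyclic_windows n w) - card Ext"
  proof -
    have "card (Ext \<union> (cyclic_windows n w - Ext)) = card Ext + card (cyclic_windows n w - Ext)"
      using assms by (intro card_Un_disjoint) auto
    then show ?thesis by simp
  qed
  finally have "length w - card ?R \<le> card (Ext \<union> cyclic_windows n w) - card Ext"
    using R by (subst (asm) card_Diff_subset) (auto intro: finite_subset)
  moreover have "card Ext \<le> card (Ext \<union> cyclic_windows n w)"
    using assms by (intro card_mono) auto
  ultimately show ?thesis by linarith
qed

lemma sum_at_most_one:
  fixes F :: "'b \<Rightarrow> real"
  assumes "finite S" "B \<ge> 0" "\<And>v. v \<in> S \<Longrightarrow> E v \<Longrightarrow> F v \<le> B"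
    and "\<And>v v'. v \<in> S \<Longrightarrow> v' \<in> S \<Longrightarrow> E v \<Longrightarrow> E v' \<Longrightarrow> v = v'"
  shows "(\<Sum>v\<in>S. F v * of_bool (E v)) \<le> B"
proof (cases "\<exists>v\<in>S. E v")
  case True
  then obtain v where v: "v \<in> S" "E v" by blast
  have "(\<Sum>v\<in>S. F v * of_bool (E v)) = F v * of_bool (E v)"
  proof (rule sum.remove[OF assms(1) v(1), THEN trans])
    have "(\<Sum>v'\<in>S - {v}. F v' * of_bool (E v')) = 0"
      using assms(4) v by (intro sum.neutral) auto
    then show "F v * of_bool (E v) + (\<Sum>v'\<in>S - {v}. F v' * of_bool (E v')) = F v * of_bool (E v)" by simp
  qed
  then show ?thesis using assms(3)[OF v] v by simp
next
  case False
  then have "(\<Sum>v\<in>S. F v * of_bool (E v)) = 0" by (intro sum.neutral) auto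
  then show ?thesis using assms(2) by simp
qed

section \<open>The cost of repeated windows, block by block\<close>

locale quasi_bernoulli = mixing_sft X + invariant_measure X \<mu> for X :: "(nat \<Rightarrow> 'a::finite) set" and \<mu> +
  fixes C :: real
  assumes C: "C \<ge> 1"
    and p_upper: "p (u @ v) \<le> C * (p u * p v)"
    and p_lower: "u @ v \<in> language X \<Longrightarrow> p u * p v \<le> C * p (u @ v)"
    and p_pos: "u \<in> language X \<Longrightarrow> p u > 0"

locale quasi_bernoulli_decay = quasi_bernoulli X \<mu> C for X :: "(nat \<Rightarrow> 'a::finite) set" and \<mu> C +
  fixes C1 \<gamma> \<alpha> :: real
  assumes gamma: "0 < \<gamma>" "\<gamma> \<le> \<alpha>" and alpha: "\<alpha> \<le> 1" and C1: "C1 > 0"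
    and p_decay: "p u \<le> C1 * \<gamma> ^ length u"
begin

lemma alpha_pos: "\<alpha> > 0"
  using gamma by linarith

text \<open>After the first \<open>q\<close> letters at most one continuation satisfies
  \<open>E\<close>, and by the quasi-Bernoulli estimate and \<open>p_decay\<close> it has relative
  measure at most \<open>C * C1 * \<gamma> ^ r\<close>. All the gain from repetitions comes from
  here.\<close>

lemma sum_determined:
  assumes "\<And>v1 v2 v2'. length v1 = q \<Longrightarrow> length v2 = r \<Longrightarrow> length v2' = r \<Longrightarrow>
     E (v1 @ v2) \<Longrightarrow> E (v1 @ v2') \<Longrightarrow> v2 = v2'"
  shows "(\<Sum>v\<in>listsn (q + r). p (u @ v) * of_bool (E v)) \<le> C * C1 * \<gamma> ^ r * p u"
proof -
  have "(\<Sum>v\<in>listsn (q + r). p (u @ v) * of_bool (E v))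
      \<le> (\<Sum>v1\<in>listsn q. C * C1 * \<gamma> ^ r * p (u @ v1))"
    unfolding sum_listsn_append
  proof (intro sum_mono sum_at_most_one)
    fix v1 v2 :: "'a list" assume v: "v1 \<in> listsn q" "v2 \<in> listsn r"
    have "p (u @ v1 @ v2) \<le> C * (p (u @ v1) * p v2)" using p_upper[of "u @ v1" v2] by simp
    also have "\<dots> \<le> C * (p (u @ v1) * (C1 * \<gamma> ^ r))"
      using C p_decay[of v2] v p_nonneg by (intro mult_left_mono) auto
    finally show "p (u @ v1 @ v2) \<le> C * C1 * \<gamma> ^ r * p (u @ v1)" by (simp add: ac_simps)
  qed (use assms C C1 gamma p_nonneg in auto)
  also have "\<dots> = C * C1 * \<gamma> ^ r * p u"
    by (simp add: sum_distrib_left[symmetric] sum_p_right)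
  finally show ?thesis .
qed

text \<open>Only the \<open>n - q\<close> letters of the window inside block \<open>b\<close> are
  compared, here and in \<open>self_match\<close>. The condition then depends on the first
  \<open>b + 1\<close> blocks alone, and blocks can be summed out one after the other.\<close>

definition ext_match :: "nat \<Rightarrow> 'a list \<Rightarrow> 'a list \<Rightarrow> nat \<Rightarrow> nat \<Rightarrow> bool" where
  "ext_match n e w b q \<longleftrightarrow> (\<forall>l<n - q. w ! (b * n + q + l) = e ! l)"

definition self_match :: "nat \<Rightarrow> nat \<Rightarrow> 'a list \<Rightarrow> nat \<Rightarrow> nat \<Rightarrow> bool" where
  "self_match n i w b q \<longleftrightarrow> (\<forall>l<n - q. w ! (b * n + q + l) = w ! (i + l))"

text \<open>Once a repeat starts at offset \<open>q\<close> of block \<open>b\<close>, the remaining \<open>n - q\<close> letters of the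
  block are copies of known letters.\<close>

definition block_factor :: "nat \<Rightarrow> 'a list set \<Rightarrow> nat \<Rightarrow> 'a list \<Rightarrow> real" where
  "block_factor n Ext b w = 1 + (\<Sum>q<n. ((\<Sum>e\<in>Ext. of_bool (ext_match n e w b q))
     + (\<Sum>i<b * n + q. of_bool (self_match n i w b q))) * (1 / \<alpha>) ^ (n - q))"

lemma block_factor_ge_1: "block_factor n Ext b w \<ge> 1"
  unfolding block_factor_def using alpha_pos
  by (simp add: sum_nonneg)

lemma block_factor_append:
  assumes "length u = K * n" "b < K"
  shows "block_factor n Ext b (u @ v) = block_factor n Ext b u"
proof -
  have "b * n + n \<le> K * n" using assms(2) by (rule block_end_le)
  then have 1: "(u @ v) ! j = u ! j" if "j < b * n + n" for j
    using that assms(1) by (simp add: nth_append)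
  have "ext_match n e (u @ v) b q = ext_match n e u b q" for e q
    unfolding ext_match_def by (auto simp: 1)
  moreover have "self_match n i (u @ v) b q = self_match n i u b q" if "i < b * n + q" for i q
    unfolding self_match_def using that by (auto simp: 1)
  ultimately show ?thesis unfolding block_factor_def by simp
qed

text \<open>Let \<open>q\<close> be the offset of the first repeat in the block. At most
  \<open>n - q\<close> repeats can occur from there on, so the summand for \<open>q\<close> with its
  match suffices; summing over all offsets and sources is a union bound.\<close>

lemma inverse_power_card_block:
  assumes w: "length w = K * n" "b < K" and fin: "finite Ext"
  shows "(1 / \<alpha>) ^ card (repeats n Ext w \<inter> {b * n..<b * n + n}) \<le> block_factor n Ext b w"
proof (cases "repeats n Ext w \<inter> {b * n..<b * n + n} = {}")
  case True
  then show ?thesis using block_factor_ge_1 by simp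
next
  case False
  let ?B = "repeats n Ext w \<inter> {b * n..<b * n + n}"
  have bK: "b * n + n \<le> K * n" using assms(2) by (rule block_end_le)
  define j where "j = Min ?B"
  have j: "j \<in> ?B" "\<And>k. k \<in> ?B \<Longrightarrow> j \<le> k"
    unfolding j_def using False by (intro Min_in Min_le; blast)+
  define q where "q = j - b * n"
  have q: "j = b * n + q" "q < n" using j(1) by (auto simp: q_def)
  have per: "periodic w k = w ! k" if "k < b * n + n" for k
    using that bK w by (simp add: periodic_def)
  let ?t = "\<lambda>q. ((\<Sum>e\<in>Ext. of_bool (ext_match n e w b q))
     + (\<Sum>i<b * n + q. of_bool (self_match n i w b q))) * (1 / \<alpha>) ^ (n - q)"
  have "card ?B \<le> card {j..<b * n + n}" using j(2) by (intro card_mono) auto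
  then have "(1 / \<alpha>) ^ card ?B \<le> (1 / \<alpha>) ^ (n - q)"
    using alpha alpha_pos q by (intro power_increasing) auto
  also have "\<dots> \<le> ?t q"
  proof -
    have "1 \<le> (\<Sum>e\<in>Ext. of_bool (ext_match n e w b q)) + (\<Sum>i<b * n + q. of_bool (self_match n i w b q) :: real)"
    proof -
      from j(1) consider "win (periodic w) j n \<in> Ext" | i where "i < j" "win (periodic w) i n = win (periodic w) j n"
        by (auto simp: repeats_def)
      then show ?thesis
      proof cases
        case 1
        have m: "ext_match n (win (periodic w) j n) w b q"
          unfolding ext_match_def using q per by auto
        have "1 \<le> (\<Sum>e\<in>Ext. of_bool (ext_match n e w b q) :: real)"
          using member_le_sum[OF 1, of "\<lambda>e. of_bool (ext_match n e w b q) :: real"] m fin by simp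
        moreover have "0 \<le> (\<Sum>i<b * n + q. of_bool (self_match n i w b q) :: real)" by (intro sum_nonneg) auto
        ultimately show ?thesis by linarith
      next
        case 2
        have "self_match n i w b q"
          unfolding self_match_def
        proof (intro allI impI)
          fix l assume l: "l < n - q"
          have "win (periodic w) i n ! l = win (periodic w) j n ! l" using 2 by simp
          then show "w ! (b * n + q + l) = w ! (i + l)"
            using l q 2(1) per[of "i + l"] per[of "j + l"] by simp
        qed
        then have "1 \<le> (\<Sum>i<b * n + q. of_bool (self_match n i w b q) :: real)"
          using member_le_sum[of i "{..<b * n + q}" "\<lambda>i. of_bool (self_match n i w b q) :: real"] 2 q by simp
        moreover have "0 \<le> (\<Sum>e\<in>Ext. of_bool (ext_match n e w b q) :: real)" by (intro sum_nonneg) auto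
        ultimately show ?thesis by linarith
      qed
    qed
    then show ?thesis using alpha_pos by (simp add: mult_le_cancel_right1)
  qed
  also have "\<dots> \<le> (\<Sum>q<n. ?t q)"
    using q alpha_pos by (intro member_le_sum) (auto intro!: mult_nonneg_nonneg add_nonneg_nonneg sum_nonneg)
  also have "\<dots> \<le> block_factor n Ext b w" by (simp add: block_factor_def)
  finally show ?thesis .
qed

text \<open>The expected factor of one block: \<open>n\<close> offsets for the first repeat and, for
  each, at most \<open>N\<close> external windows and fewer than \<open>K * n\<close> earlier
  positions to copy from.\<close>

definition growth :: "nat \<Rightarrow> nat \<Rightarrow> nat \<Rightarrow> real" where
  "growth N K n = 1 + C * C1 * real n * real (N + K * n)"

lemma growth_ge_1: "growth N K n \<ge> 1"
  using C C1 by (simp add: growth_def)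

text \<open>Here \<gamma> \<le> \<alpha> enters: \<open>r\<close> determined letters have measure of
  order \<open>\<gamma> ^ r\<close>, which compensates \<open>r\<close> lost factors
  \<alpha>.\<close>

lemma decay_cancel: "C * C1 * \<gamma> ^ r * p u * (1 / \<alpha>) ^ r \<le> C * C1 * p u"
proof -
  have "\<gamma> ^ r * (1 / \<alpha>) ^ r = (\<gamma> / \<alpha>) ^ r" by (simp add: power_divide)
  also have "\<dots> \<le> 1" using gamma alpha_pos by (intro power_le_one) auto
  finally have "C * C1 * p u * (\<gamma> ^ r * (1 / \<alpha>) ^ r) \<le> C * C1 * p u * 1"
    using C C1 p_nonneg by (intro mult_left_mono) auto
  then show ?thesis by (simp add: ac_simps)
qed

lemma sum_block_factor:
  assumes u: "length u = b * n" and b: "b < K" and N: "card Ext \<le> N"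
  shows "(\<Sum>v\<in>listsn n. p (u @ v) * block_factor n Ext b (u @ v)) \<le> p u * growth N K n"
proof -
  have E: "(\<Sum>v\<in>listsn n. p (u @ v) * of_bool (ext_match n e (u @ v) b q)) * (1 / \<alpha>) ^ (n - q) \<le> C * C1 * p u"
    if "q < n" for e q
  proof -
    have "(\<Sum>v\<in>listsn (q + (n - q)). p (u @ v) * of_bool (ext_match n e (u @ v) b q)) \<le> C * C1 * \<gamma> ^ (n - q) * p u"
    proof (rule sum_determined)
      fix v1 v2 v2' :: "'a list"
      assume len: "length v1 = q" "length v2 = n - q" "length v2' = n - q"
        and m: "ext_match n e (u @ v1 @ v2) b q" "ext_match n e (u @ v1 @ v2') b q"
      show "v2 = v2'"
        by (rule nth_equalityI)
          (use m len u in \<open>auto simp: ext_match_def nth_append\<close>)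
    qed
    then have "(\<Sum>v\<in>listsn n. p (u @ v) * of_bool (ext_match n e (u @ v) b q)) * (1 / \<alpha>) ^ (n - q)
        \<le> C * C1 * \<gamma> ^ (n - q) * p u * (1 / \<alpha>) ^ (n - q)"
      using that alpha_pos by (intro mult_right_mono) auto
    also have "\<dots> \<le> C * C1 * p u" by (rule decay_cancel)
    finally show ?thesis .
  qed
  have S: "(\<Sum>v\<in>listsn n. p (u @ v) * of_bool (self_match n i (u @ v) b q)) * (1 / \<alpha>) ^ (n - q) \<le> C * C1 * p u"
    if "q < n" "i < b * n + q" for i q
  proof -
    have "(\<Sum>v\<in>listsn (q + (n - q)). p (u @ v) * of_bool (self_match n i (u @ v) b q)) \<le> C * C1 * \<gamma> ^ (n - q) * p u"
    proof (rule sum_determined)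
      fix v1 v2 v2' :: "'a list"
      assume len: "length v1 = q" "length v2 = n - q" "length v2' = n - q"
        and m: "self_match n i (u @ v1 @ v2) b q" "self_match n i (u @ v1 @ v2') b q"
      define x where "x = u @ v1"
      have x: "length x = b * n + q" using len u by (simp add: x_def)
      have m': "(x @ v2) ! (length x + l) = (x @ v2) ! (i + l)" "(x @ v2') ! (length x + l) = (x @ v2') ! (i + l)"
        if "l < n - q" for l
        using m that x unfolding self_match_def by (auto simp: x_def)
      \<comment> \<open>The copied stretch may overlap the letters being determined, but only at
        smaller offsets, because \<open>i\<close> lies before them; hence strong induction.\<close>
      have "v2 ! l = v2' ! l" if "l < n - q" for l
        using that
      proof (induction l rule: less_induct)
        case (less l)
        have "(x @ v2) ! (i + l) = (x @ v2') ! (i + l)"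
        proof (cases "i + l < length x")
          case False
          then have "i + l - length x < l" using \<open>i < b * n + q\<close> x by linarith
          then show ?thesis using False less by (simp add: nth_append)
        qed (simp add: nth_append)
        then show ?case using m'[OF less.prems] by simp
      qed
      then show "v2 = v2'" using len by (intro nth_equalityI) auto
    qed
    then have "(\<Sum>v\<in>listsn n. p (u @ v) * of_bool (self_match n i (u @ v) b q)) * (1 / \<alpha>) ^ (n - q)
        \<le> C * C1 * \<gamma> ^ (n - q) * p u * (1 / \<alpha>) ^ (n - q)"
      using that alpha_pos by (intro mult_right_mono) auto
    also have "\<dots> \<le> C * C1 * p u" by (rule decay_cancel)
    finally show ?thesis .
  qed
  let ?lhs = "\<Sum>v\<in>listsn n. p (u @ v) * block_factor n Ext b (u @ v)"
  let ?e = "\<lambda>q e v. p (u @ v) * of_bool (ext_match n e (u @ v) b q)"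
  let ?s = "\<lambda>q i v. p (u @ v) * of_bool (self_match n i (u @ v) b q)"
  let ?d = "\<lambda>q. (1 / \<alpha>) ^ (n - q)"
  have "?lhs = (\<Sum>v\<in>listsn n. p (u @ v))
     + (\<Sum>q<n. (\<Sum>e\<in>Ext. (\<Sum>v\<in>listsn n. ?e q e v) * ?d q)
       + (\<Sum>i<b * n + q. (\<Sum>v\<in>listsn n. ?s q i v) * ?d q))"
    (is "_ = _ + ?T")
  proof -
    have "?lhs = (\<Sum>v\<in>listsn n. p (u @ v))
     + (\<Sum>v\<in>listsn n. \<Sum>q<n. (\<Sum>e\<in>Ext. ?e q e v * ?d q)
       + (\<Sum>i<b * n + q. ?s q i v * ?d q))"
      unfolding block_factor_def
      by (simp only: distrib_left distrib_right sum.distrib sum_distrib_left sum_distrib_right mult.assoc mult_1_right)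
    also have "(\<Sum>v\<in>listsn n. \<Sum>q<n. (\<Sum>e\<in>Ext. ?e q e v * ?d q)
       + (\<Sum>i<b * n + q. ?s q i v * ?d q))
      = (\<Sum>q<n. (\<Sum>v\<in>listsn n. \<Sum>e\<in>Ext. ?e q e v * ?d q)
       + (\<Sum>v\<in>listsn n. \<Sum>i<b * n + q. ?s q i v * ?d q))"
      by (subst sum.swap) (simp only: sum.distrib)
    also have "\<dots> = (\<Sum>q<n. (\<Sum>e\<in>Ext. \<Sum>v\<in>listsn n. ?e q e v * ?d q)
       + (\<Sum>i<b * n + q. \<Sum>v\<in>listsn n. ?s q i v * ?d q))"
      by (intro sum.cong refl arg_cong2[where f = "(+)"] sum.swap)
    also have "\<dots> = ?T" by (simp only: sum_distrib_right)
    finally show ?thesis .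
  qed
  then have eq: "?lhs = p u + ?T"
    by (simp only: sum_p_right)
  have "?T \<le> (\<Sum>q<n. (\<Sum>e\<in>Ext. C * C1 * p u) + (\<Sum>i<b * n + q. C * C1 * p u))"
  proof (rule sum_mono, rule add_mono)
    fix q assume "q \<in> {..<n}"
    then have q: "q < n" by simp
    show "(\<Sum>e\<in>Ext. (\<Sum>v\<in>listsn n. ?e q e v) * ?d q)
        \<le> (\<Sum>e\<in>Ext. C * C1 * p u)"
      by (rule sum_mono) (rule E[OF q])
    show "(\<Sum>i<b * n + q. (\<Sum>v\<in>listsn n. ?s q i v) * ?d q)
        \<le> (\<Sum>i<b * n + q. C * C1 * p u)"
      by (rule sum_mono) (rule S[OF q], simp)
  qed
  also have "\<dots> \<le> (\<Sum>q<n. real (N + K * n) * (C * C1 * p u))"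
  proof (rule sum_mono)
    fix q assume q: "q \<in> {..<n}"
    have "b * n + n \<le> K * n" using b by (rule block_end_le)
    then have "card Ext + (b * n + q) \<le> N + K * n" using N q[unfolded lessThan_iff] by linarith
    then have "real (card Ext + (b * n + q)) \<le> real (N + K * n)" by (simp only: of_nat_le_iff)
    moreover have "0 \<le> C * C1 * p u" using C C1 p_nonneg by simp
    ultimately have "real (card Ext + (b * n + q)) * (C * C1 * p u) \<le> real (N + K * n) * (C * C1 * p u)"
      by (rule mult_right_mono)
    then show "(\<Sum>e\<in>Ext. C * C1 * p u) + (\<Sum>i<b * n + q. C * C1 * p u) \<le> real (N + K * n) * (C * C1 * p u)"
      by (simp add: algebra_simps)
  qed
  finally have "p u + ?T \<le> p u + real n * (real (N + K * n) * (C * C1 * p u))"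
    by (simp only: sum_constant card_lessThan add_le_cancel_left)
  also have "\<dots> = p u * growth N K n"
    by (simp add: growth_def algebra_simps)
  finally show ?thesis unfolding eq .
qed

text \<open>Factor \<open>b\<close> depends on the first \<open>b + 1\<close> blocks, so the last
  block is summed out first, with the others held fixed. The first \<open>k0\<close> blocks carry a
  free weight \<open>c\<close>: \<open>k0 = 0\<close> serves the mean, \<open>k0 = 1\<close> the
  pairs of loops with a common window.\<close>

lemma sum_block_factors:
  assumes N: "card Ext \<le> N" and K: "k0 + k \<le> K" and c: "\<And>u. c u \<ge> 0"
  shows "(\<Sum>w\<in>listsn ((k0 + k) * n). p w * (c (take (k0 * n) w) * (\<Prod>b\<in>{k0..<k0 + k}. block_factor n Ext b w)))
     \<le> (\<Sum>u\<in>listsn (k0 * n). p u * c u) * growth N K n ^ k"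
  using K
proof (induction k)
  case 0
  then show ?case by simp
next
  case (Suc k)
  let ?L = "(k0 + k) * n"
  let ?g = "\<lambda>u. c (take (k0 * n) u) * (\<Prod>b\<in>{k0..<k0 + k}. block_factor n Ext b u)"
  have g: "?g u \<ge> 0" for u
    using c block_factor_ge_1 by (intro mult_nonneg_nonneg prod_nonneg) (auto intro: order_trans[OF zero_le_one])
  have "(\<Sum>w\<in>listsn ((k0 + Suc k) * n). p w * (c (take (k0 * n) w) * (\<Prod>b\<in>{k0..<k0 + Suc k}. block_factor n Ext b w)))
    = (\<Sum>u\<in>listsn ?L. \<Sum>v\<in>listsn n. p (u @ v) * (c (take (k0 * n) (u @ v)) * (\<Prod>b\<in>{k0..<k0 + Suc k}. block_factor n Ext b (u @ v))))"
  proof -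
    have "(k0 + Suc k) * n = ?L + n" by simp
    then show ?thesis by (simp only: sum_listsn_append)
  qed
  also have "\<dots> = (\<Sum>u\<in>listsn ?L. ?g u * (\<Sum>v\<in>listsn n. p (u @ v) * block_factor n Ext (k0 + k) (u @ v)))"
    unfolding sum_distrib_left
  proof (intro sum.cong refl)
    fix u v :: "'a list" assume u: "u \<in> listsn ?L" and "v \<in> listsn n"
    have "(\<Prod>b\<in>{k0..<k0 + Suc k}. block_factor n Ext b (u @ v))
        = (\<Prod>b\<in>{k0..<k0 + k}. block_factor n Ext b (u @ v)) * block_factor n Ext (k0 + k) (u @ v)"
      by simp
    also have "(\<Prod>b\<in>{k0..<k0 + k}. block_factor n Ext b (u @ v)) = (\<Prod>b\<in>{k0..<k0 + k}. block_factor n Ext b u)"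
      using u by (intro prod.cong refl block_factor_append[where K = "k0 + k"]) auto
    finally have "(\<Prod>b\<in>{k0..<k0 + Suc k}. block_factor n Ext b (u @ v))
        = (\<Prod>b\<in>{k0..<k0 + k}. block_factor n Ext b u) * block_factor n Ext (k0 + k) (u @ v)" .
    moreover have "take (k0 * n) (u @ v) = take (k0 * n) u" using u by simp
    ultimately show "p (u @ v) * (c (take (k0 * n) (u @ v)) * (\<Prod>b\<in>{k0..<k0 + Suc k}. block_factor n Ext b (u @ v)))
        = ?g u * (p (u @ v) * block_factor n Ext (k0 + k) (u @ v))"
      by (simp only: ac_simps)
  qed
  also have "\<dots> \<le> (\<Sum>u\<in>listsn ?L. ?g u * (p u * growth N K n))"
    using Suc.prems N by (intro sum_mono mult_left_mono g sum_block_factor) auto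
  also have "\<dots> = (\<Sum>u\<in>listsn ?L. p u * ?g u) * growth N K n"
    unfolding sum_distrib_right by (intro sum.cong refl) (simp add: ac_simps)
  also have "\<dots> \<le> ((\<Sum>u\<in>listsn (k0 * n). p u * c u) * growth N K n ^ k) * growth N K n"
    using Suc.IH Suc.prems order_trans[OF zero_le_one growth_ge_1] by (intro mult_right_mono) auto
  finally show ?case by (simp add: ac_simps)
qed

lemma power_card_union_le:
  assumes "finite Ext"
  shows "\<alpha> ^ card (Ext \<union> cyclic_windows n w) \<le> \<alpha> ^ (card Ext + length w) * (1 / \<alpha>) ^ card (repeats n Ext w)"
proof -
  have "\<alpha> ^ card (Ext \<union> cyclic_windows n w) * \<alpha> ^ card (repeats n Ext w) \<le> \<alpha> ^ (card Ext + length w)"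
    unfolding power_add[symmetric]
    using card_repeats[OF assms, of w n] alpha alpha_pos by (intro power_decreasing) auto
  then show ?thesis using alpha_pos by (simp add: field_simps power_divide)
qed

lemma prod_card_blocks:
  assumes "length w = K * n"
  shows "(1 / \<alpha>) ^ card (repeats n Ext w) = (\<Prod>b<K. (1 / \<alpha>) ^ card (repeats n Ext w \<inter> {b * n..<b * n + n}))"
proof -
  have "repeats n Ext w \<subseteq> {..<K * n}" using assms by (auto simp: repeats_def)
  then have "(\<Union>b<K. repeats n Ext w \<inter> {b * n..<b * n + n}) = repeats n Ext w"
  proof (intro subset_antisym subsetI)
    fix j assume "repeats n Ext w \<subseteq> {..<K * n}" "j \<in> repeats n Ext w"
    then have j: "j < K * n" by auto
    then have "n > 0" by (cases n) auto
    have "j div n < K" using j by (simp add: less_mult_imp_div_less)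
    moreover have "j \<in> {j div n * n..<j div n * n + n}"
      using \<open>n > 0\<close> div_mult_mod_eq[of j n] mod_less_divisor[OF \<open>n > 0\<close>, of j]
      by (simp only: atLeastLessThan_iff) linarith
    ultimately show "j \<in> (\<Union>b<K. repeats n Ext w \<inter> {b * n..<b * n + n})" using \<open>j \<in> repeats n Ext w\<close> by blast
  qed auto
  moreover have "card (\<Union>b<K. repeats n Ext w \<inter> {b * n..<b * n + n}) = (\<Sum>b<K. card (repeats n Ext w \<inter> {b * n..<b * n + n}))"
  proof (rule card_UN_disjoint)
    show "\<forall>i\<in>{..<K}. \<forall>j\<in>{..<K}. i \<noteq> j \<longrightarrow>
       (repeats n Ext w \<inter> {i * n..<i * n + n}) \<inter> (repeats n Ext w \<inter> {j * n..<j * n + n}) = {}"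
    proof (intro ballI impI)
      fix i j :: nat assume "i \<noteq> j"
      have "k div n = i" if "k \<in> {i * n..<i * n + n}" for i k
        using that by (auto intro!: div_nat_eqI simp: mult.commute)
      then show "(repeats n Ext w \<inter> {i * n..<i * n + n}) \<inter> (repeats n Ext w \<inter> {j * n..<j * n + n}) = {}"
        using \<open>i \<noteq> j\<close> by blast
    qed
  qed auto
  ultimately show ?thesis by (simp add: power_sum)
qed

text \<open>For windows that are words of \<open>X\<close>, \<alpha> to their number is the
  probability that the random set misses them all, so this is a first moment. The main term is what
  pairwise distinct windows would give.\<close>

proposition sum_power_windows:
  assumes "finite Ext" "card Ext \<le> N"
  shows "(\<Sum>w\<in>listsn (K * n). p w * \<alpha> ^ card (Ext \<union> cyclic_windows n w)) \<le> \<alpha> ^ (card Ext + K * n) * growth N K n ^ K"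
proof -
  have "(\<Sum>w\<in>listsn (K * n). p w * \<alpha> ^ card (Ext \<union> cyclic_windows n w))
      \<le> (\<Sum>w\<in>listsn (K * n). p w * (\<alpha> ^ (card Ext + K * n) * (\<Prod>b<K. block_factor n Ext b w)))"
  proof (intro sum_mono mult_left_mono p_nonneg)
    fix w :: "'a list" assume w: "w \<in> listsn (K * n)"
    have "(1 / \<alpha>) ^ card (repeats n Ext w) \<le> (\<Prod>b<K. block_factor n Ext b w)"
      using w alpha_pos by (subst prod_card_blocks[of w K n]) (auto intro!: prod_mono inverse_power_card_block[where K = K] simp: assms(1))
    then show "\<alpha> ^ card (Ext \<union> cyclic_windows n w) \<le> \<alpha> ^ (card Ext + K * n) * (\<Prod>b<K. block_factor n Ext b w)"
      using power_card_union_le[OF assms(1), of n w] w alpha_pos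
      by (auto intro: order_trans mult_left_mono)
  qed
  also have "\<dots> = \<alpha> ^ (card Ext + K * n) * (\<Sum>w\<in>listsn (K * n). p w * (\<Prod>b<K. block_factor n Ext b w))"
    by (simp add: sum_distrib_left ac_simps)
  also have "(\<Sum>w\<in>listsn (K * n). p w * (\<Prod>b<K. block_factor n Ext b w)) \<le> growth N K n ^ K"
    using sum_block_factors[OF assms(2), of 0 K K "\<lambda>_. 1" n] by (simp add: atLeast0LessThan p_Nil)
  finally show ?thesis using alpha_pos by simp
qed

text \<open>The first block is one of at most \<open>N\<close> words, each of measure at most
  \<open>C1 * \<gamma> ^ n\<close>, while its repeats lose at most \<open>n\<close> factors
  \<alpha>. The other \<open>K - 1\<close> blocks are treated as before.\<close>

proposition sum_power_windows_meeting:
  assumes "finite Ext" "card Ext \<le> N" "Ext \<subseteq> listsn n" "K \<ge> 1" "n \<ge> 1"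
  shows "(\<Sum>w\<in>{w \<in> listsn (K * n). win (periodic w) 0 n \<in> Ext}. p w * \<alpha> ^ card (Ext \<union> cyclic_windows n w))
     \<le> \<alpha> ^ (card Ext + K * n) * (real N * C1 * (\<gamma> / \<alpha>) ^ n * growth N K n ^ (K - 1))"
proof -
  have nK: "n \<le> K * n" using assms(4) by simp
  let ?c = "\<lambda>u. of_bool (u \<in> Ext) * (1 / \<alpha>) ^ n"
  have "(\<Sum>w\<in>{w \<in> listsn (K * n). win (periodic w) 0 n \<in> Ext}. p w * \<alpha> ^ card (Ext \<union> cyclic_windows n w))
      \<le> (\<Sum>w\<in>{w \<in> listsn (K * n). win (periodic w) 0 n \<in> Ext}.
           p w * (\<alpha> ^ (card Ext + K * n) * (?c (take n w) * (\<Prod>b\<in>{1..<K}. block_factor n Ext b w))))"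
  proof (intro sum_mono mult_left_mono p_nonneg)
    fix w :: "'a list" assume "w \<in> {w \<in> listsn (K * n). win (periodic w) 0 n \<in> Ext}"
    then have w: "length w = K * n" "win (periodic w) 0 n \<in> Ext" by auto
    have "win (periodic w) 0 n = take n w"
      using w nK less_le_trans[OF _ nK] by (auto simp: win_eq_iff periodic_def)
    then have t: "take n w \<in> Ext" using w by simp
    have "(1 / \<alpha>) ^ card (repeats n Ext w)
       = (1 / \<alpha>) ^ card (repeats n Ext w \<inter> {0 * n..<0 * n + n}) *
         (\<Prod>b\<in>{1..<K}. (1 / \<alpha>) ^ card (repeats n Ext w \<inter> {b * n..<b * n + n}))"
      unfolding prod_card_blocks[OF w(1)] atLeast0LessThan[symmetric]
      using assms(4) by (subst prod.atLeast_Suc_lessThan) auto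
    also have "\<dots> \<le> (1 / \<alpha>) ^ n * (\<Prod>b\<in>{1..<K}. block_factor n Ext b w)"
    proof (intro mult_mono prod_mono conjI inverse_power_card_block[OF w(1) _ assms(1)])
      have "card (repeats n Ext w \<inter> {0 * n..<0 * n + n}) \<le> card {0..<n}" by (intro card_mono) auto
      then show "(1 / \<alpha>) ^ card (repeats n Ext w \<inter> {0 * n..<0 * n + n}) \<le> (1 / \<alpha>) ^ n"
        using alpha alpha_pos by (intro power_increasing) auto
    qed (use alpha_pos in \<open>auto intro!: prod_nonneg\<close>)
    finally have "(1 / \<alpha>) ^ card (repeats n Ext w) \<le> ?c (take n w) * (\<Prod>b\<in>{1..<K}. block_factor n Ext b w)"
      using t by simp
    then show "\<alpha> ^ card (Ext \<union> cyclic_windows n w) \<le> \<alpha> ^ (card Ext + K * n) * (?c (take n w) * (\<Prod>b\<in>{1..<K}. block_factor n Ext b w))"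
      using order_trans[OF power_card_union_le[OF assms(1), of n w], OF mult_left_mono] w(1) alpha_pos
      by (metis less_imp_le zero_less_power)
  qed
  also have "\<dots> \<le> (\<Sum>w\<in>listsn (K * n).
           p w * (\<alpha> ^ (card Ext + K * n) * (?c (take n w) * (\<Prod>b\<in>{1..<K}. block_factor n Ext b w))))"
    using alpha_pos p_nonneg order_trans[OF zero_le_one block_factor_ge_1]
    by (intro sum_mono2 mult_nonneg_nonneg prod_nonneg) auto
  also have "\<dots> = \<alpha> ^ (card Ext + K * n) * (\<Sum>w\<in>listsn ((1 + (K - 1)) * n). p w * (?c (take (1 * n) w) * (\<Prod>b\<in>{1..<1 + (K - 1)}. block_factor n Ext b w)))"
    using assms(4) unfolding sum_distrib_left by (intro sum.cong) (auto simp: ac_simps)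
  also have "\<dots> \<le> \<alpha> ^ (card Ext + K * n) * ((\<Sum>u\<in>listsn (1 * n). p u * ?c u) * growth N K n ^ (K - 1))"
    using alpha_pos assms by (intro mult_left_mono sum_block_factors) auto
  also have "(\<Sum>u\<in>listsn (1 * n). p u * ?c u) = (\<Sum>u\<in>Ext. p u * (1 / \<alpha>) ^ n)"
    using assms(3) by (intro sum.mono_neutral_cong_right) auto
  also have "\<dots> \<le> (\<Sum>u\<in>Ext. C1 * (\<gamma> / \<alpha>) ^ n)"
  proof (rule sum_mono)
    fix u assume "u \<in> Ext"
    then have "p u * (1 / \<alpha>) ^ n \<le> (C1 * \<gamma> ^ n) * (1 / \<alpha>) ^ n"
      using p_decay[of u] assms(3) alpha_pos by (intro mult_right_mono) auto
    then show "p u * (1 / \<alpha>) ^ n \<le> C1 * (\<gamma> / \<alpha>) ^ n" by (simp add: power_divide)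
  qed
  also have "\<dots> \<le> real N * C1 * (\<gamma> / \<alpha>) ^ n"
    using assms(2) C1 gamma alpha_pos by (simp add: mult_right_mono)
  finally show ?thesis using alpha_pos order_trans[OF zero_le_one growth_ge_1]
    by (simp add: mult_left_mono mult_right_mono)
qed

end

section \<open>Escape rates\<close>

definition avoids :: "nat \<Rightarrow> 'a list set \<Rightarrow> 'a list \<Rightarrow> bool" where
  "avoids n F w \<longleftrightarrow> (\<forall>i. i + n \<le> length w \<longrightarrow> take n (drop i w) \<notin> F)"

lemma avoids_appendD: "avoids n F (u @ v) \<Longrightarrow> avoids n F u \<and> avoids n F v"
  unfolding avoids_def
proof (intro conjI allI impI)
  assume a: "\<forall>i. i + n \<le> length (u @ v) \<longrightarrow> take n (drop i (u @ v)) \<notin> F"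
  fix i
  show "take n (drop i u) \<notin> F" if "i + n \<le> length u"
    using a[rule_format, of i] that by simp
  show "take n (drop i v) \<notin> F" if "i + n \<le> length v"
    using a[rule_format, of "length u + i"] that by simp
qed

lemma take_drop_win: "i + n \<le> m \<Longrightarrow> take n (drop i (win x j m)) = win x (j + i) n"
  by (auto simp: list_eq_iff_nth_eq add.assoc)

lemma avoids_win_iff: "avoids n F (win x 0 m) \<longleftrightarrow> (\<forall>i. i + n \<le> m \<longrightarrow> win x i n \<notin> F)"
  unfolding avoids_def by (auto simp: take_drop_win)

context quasi_bernoulli
begin

definition survival :: "nat \<Rightarrow> 'a list set \<Rightarrow> nat \<Rightarrow> real" where
  "survival n F m = (\<Sum>w\<in>listsn m. p w * of_bool (avoids n F w))"

lemma survival_nonneg: "survival n F m \<ge> 0"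
  unfolding survival_def by (intro sum_nonneg) (simp add: p_nonneg)

text \<open>Windows across the cut are forgotten, which only increases the measure;
  \<open>p_upper\<close> then separates the two pieces.\<close>

lemma survival_submultiplicative: "survival n F (m + k) \<le> C * (survival n F m * survival n F k)"
proof -
  have "survival n F (m + k) \<le> (\<Sum>u\<in>listsn m. \<Sum>v\<in>listsn k.
      C * ((p u * of_bool (avoids n F u)) * (p v * of_bool (avoids n F v))))"
    unfolding survival_def sum_listsn_append
  proof (intro sum_mono)
    fix u v
    show "p (u @ v) * of_bool (avoids n F (u @ v)) \<le> C * ((p u * of_bool (avoids n F u)) * (p v * of_bool (avoids n F v)))"
      using p_upper[of u v] C p_nonneg avoids_appendD[of n F u v] by (cases "avoids n F (u @ v)") auto
  qed
  also have "\<dots> = C * (survival n F m * survival n F k)"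
    unfolding survival_def sum_product by (simp add: sum_distrib_left)
  finally show ?thesis .
qed

text \<open>The windows of length \<open>n\<close> at \<open>m\<close> consecutive positions cover
  \<open>m + n - 1\<close> letters.\<close>

lemma measure_survivors:
  assumes F: "F \<subseteq> words n X" and m: "m \<ge> 1" and n: "n \<ge> 1"
  shows "measure \<mu> (survivors X (hole X F) m) = survival n F (m + n - 1)"
proof -
  let ?M = "m + n - 1"
  have iff: "x \<in> survivors X (hole X F) m \<longleftrightarrow> win x 0 ?M \<in> {w \<in> listsn ?M. avoids n F w}" if x: "x \<in> X" for x
  proof -
    have "(shift ^^ j) x \<in> hole X F \<longleftrightarrow> win x j n \<in> F" for j
    proof -
      have "(shift ^^ j) x \<in> hole X F \<longleftrightarrow> (\<exists>w\<in>F. win x j (length w) = w)"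
        using shift_closed[OF x, of j] by (auto simp: hole_def cyl_eq_win)
      also have "\<dots> \<longleftrightarrow> win x j n \<in> F"
      proof
        assume "\<exists>w\<in>F. win x j (length w) = w"
        then obtain w where w: "w \<in> F" "win x j (length w) = w" by blast
        then have "length w = n" using F by (auto simp: words_def)
        then show "win x j n \<in> F" using w by simp
      qed (intro bexI[of _ "win x j n"], auto)
      finally show ?thesis .
    qed
    then have "x \<in> survivors X (hole X F) m \<longleftrightarrow> (\<forall>j<m. win x j n \<notin> F)"
      using x by (simp add: survivors_def)
    also have "\<dots> \<longleftrightarrow> avoids n F (win x 0 ?M)"
      unfolding avoids_win_iff using m n by (intro iff_allI) auto
    finally show ?thesis by simp
  qed
  have S: "survivors X (hole X F) m = X \<inter> {x. win x 0 ?M \<in> {w \<in> listsn ?M. avoids n F w}}"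
    using iff by (auto simp: survivors_def)
  have win_in: "{x. win x 0 ?M \<in> {w \<in> listsn ?M. avoids n F w}} \<in> sets \<mu>"
    using measurable_sets[OF measurable_win, of "{w \<in> listsn ?M. avoids n F w}" 0 ?M] by (simp add: vimage_def)
  have "measure \<mu> (survivors X (hole X F) m) = prob {x. win x 0 ?M \<in> {w \<in> listsn ?M. avoids n F w}}"
  proof (rule finite_measure_eq_AE)
    show "survivors X (hole X F) m \<in> sets \<mu>" unfolding S using win_in by simp
    show "AE x in \<mu>. x \<in> survivors X (hole X F) m \<longleftrightarrow> x \<in> {x. win x 0 ?M \<in> {w \<in> listsn ?M. avoids n F w}}"
      using AE_in_X by eventually_elim (simp add: iff)
  qed (rule win_in)
  also have "\<dots> = sum p {w \<in> listsn ?M. avoids n F w}"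
    by (rule prob_win_in) auto
  also have "\<dots> = survival n F ?M"
    unfolding survival_def by (intro sum.mono_neutral_cong_left) auto
  finally show ?thesis .
qed

text \<open>This excludes superexponential decay: a positive survival probability is at least the
  measure of one word, so a rate that is not \<open>- \<infinity>\<close> by extinction is
  finite.\<close>

lemma p_lower_bound: obtains \<delta> where "\<delta> > 0" "\<And>w. w \<in> language X \<Longrightarrow> p w \<ge> \<delta> ^ length w"
proof -
  define d where "d = Min (p ` words 1 X)"
  have fin: "finite (p ` words 1 X)" "p ` words 1 X \<noteq> {}" using words_nonempty by auto
  have d: "d > 0" unfolding d_def using fin by (auto simp: words_def intro!: p_pos)
  have "p w \<ge> (d / C) ^ length w" if "w \<in> language X" for w
    using that
  proof (induction w rule: rev_induct)
    case (snoc a w)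
    have "[a] \<in> words 1 X" using language_appendD2[OF snoc.prems] by simp
    then have "d \<le> p [a]" unfolding d_def using fin by (intro Min_le) auto
    then have "(d / C) ^ length w * d \<le> p w * p [a]"
      using snoc.IH[OF language_appendD1[OF snoc.prems]] d p_nonneg by (intro mult_mono) auto
    also have "\<dots> \<le> C * p (w @ [a])" by (rule p_lower[OF snoc.prems])
    finally show ?case using C by (simp add: field_simps)
  qed (simp add: p_Nil)
  then show ?thesis using that[of "d / C"] d C by auto
qed

lemma survival_zero_mono:
  assumes "survival n F m = 0" "m \<le> k"
  shows "survival n F k = 0"
proof -
  have "survival n F (m + (k - m)) \<le> C * (survival n F m * survival n F (k - m))"
    by (rule survival_submultiplicative)
  then show ?thesis using assms survival_nonneg[of n F k] by simp
qed

lemma escape_seq_eq: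
  assumes "F \<subseteq> words n X" "m \<ge> 1" "n \<ge> 1"
  shows "escape_seq \<mu> X (hole X F) m =
     (if survival n F (m + n - 1) = 0 then - \<infinity> else ereal (ln (survival n F (m + n - 1)) / real m))"
  unfolding escape_seq_def log_ext_def measure_survivors[OF assms] using assms(2) by simp

text \<open>Either survival vanishes at some length, hence at all larger ones, or its logarithm is
  almost subadditive. The last inequality ties the rate to every finite length, which is what the
  upper tail uses.\<close>

lemma escape_limit:
  assumes F: "F \<subseteq> words n X" and n: "n \<ge> 1"
  shows "((\<exists>m. survival n F m = 0) \<and> escape_seq \<mu> X (hole X F) \<longlonglongrightarrow> - \<infinity>) \<or>
     (\<exists>L. (\<forall>m. survival n F m > 0) \<and> escape_seq \<mu> X (hole X F) \<longlonglongrightarrow> ereal L \<and>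
       (\<lambda>m. ln (survival n F m) / real m) \<longlonglongrightarrow> L \<and> (\<forall>m\<ge>1. L * real m \<le> ln (survival n F m) + ln C))"
proof (cases "\<exists>m. survival n F m = 0")
  case True
  then obtain m0 where m0: "survival n F m0 = 0" by blast
  have "\<forall>\<^sub>F m in sequentially. - \<infinity> = escape_seq \<mu> X (hole X F) m"
    using eventually_ge_at_top[of "Suc m0"]
  proof eventually_elim
    case (elim m)
    then have "survival n F (m + n - 1) = 0" by (intro survival_zero_mono[OF m0]) (use n in simp)
    then show ?case using escape_seq_eq[OF F _ n, of m] elim by simp
  qed
  then have "escape_seq \<mu> X (hole X F) \<longlonglongrightarrow> - \<infinity>" by (rule Lim_transform_eventually[OF tendsto_const])
  then show ?thesis using True by blast
next
  case False
  then have pos: "survival n F m > 0" for m using survival_nonneg[of n F m] by (simp add: less_le)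
  obtain \<delta> where d: "\<delta> > 0" "\<And>w. w \<in> language X \<Longrightarrow> p w \<ge> \<delta> ^ length w" by (rule p_lower_bound) blast
  have lnC: "ln C \<ge> 0" using C by simp
  obtain L where L: "(\<lambda>m. ln (survival n F m) / real m) \<longlonglongrightarrow> L"
    "\<And>m. m \<ge> 1 \<Longrightarrow> L * real m \<le> ln (survival n F m) + ln C"
  proof (rule almost_subadditive_limit[of "\<lambda>m. ln (survival n F m)" "ln C" "- ln \<delta>"])
    fix m k :: nat
    have "ln (survival n F (m + k)) \<le> ln (C * (survival n F m * survival n F k))"
      using survival_submultiplicative pos by (intro ln_mono) auto
    also have "\<dots> = ln C + (ln (survival n F m) + ln (survival n F k))"
      using C pos[of m] pos[of k] by (simp add: ln_mult)
    finally show "ln (survival n F (m + k)) \<le> ln (survival n F m) + ln (survival n F k) + ln C" by simp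
  next
    fix m :: nat
    obtain w where w: "w \<in> listsn m" "p w * of_bool (avoids n F w) \<noteq> 0"
      using pos[of m] unfolding survival_def by (metis (no_types, lifting) less_irrefl sum.neutral)
    then have "w \<in> language X" using p_zero[of w] by auto
    then have "\<delta> ^ m \<le> p w * of_bool (avoids n F w)" using d w by (auto split: if_splits)
    also have "\<dots> \<le> survival n F m" unfolding survival_def
      using w by (intro member_le_sum) (auto simp: p_nonneg)
    finally have "ln (\<delta> ^ m) \<le> ln (survival n F m)" using d pos by (intro ln_mono) auto
    then show "- (- ln \<delta>) * real m \<le> ln (survival n F m) + ln C"
      using lnC d by (simp add: ln_realpow mult.commute)
  qed (use that in blast)
  \<comment> \<open>Survival up to time \<open>m\<close> is read on words of length
    \<open>m + n - 1\<close>, but the rate divides by \<open>m\<close>; the ratio of the two tends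
    to 1.\<close>
  have "(\<lambda>m. ln (survival n F (m + (n - 1))) / real (m + (n - 1)) * (1 + real (n - 1) / real m)) \<longlonglongrightarrow> L * (1 + 0)"
    by (intro tendsto_intros lim_const_over_n LIMSEQ_ignore_initial_segment[OF L(1)])
  then have "(\<lambda>m. ereal (ln (survival n F (m + (n - 1))) / real (m + (n - 1)) * (1 + real (n - 1) / real m))) \<longlonglongrightarrow> ereal L"
    by simp
  then have "escape_seq \<mu> X (hole X F) \<longlonglongrightarrow> ereal L"
  proof (rule Lim_transform_eventually)
    show "\<forall>\<^sub>F m in sequentially. ereal (ln (survival n F (m + (n - 1))) / real (m + (n - 1)) * (1 + real (n - 1) / real m))
        = escape_seq \<mu> X (hole X F) m"
      using eventually_ge_at_top[of 1]
    proof eventually_elim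
      case (elim m)
      have "1 + real (n - 1) / real m = real (m + (n - 1)) / real m"
        using elim by (simp add: add_divide_distrib)
      then have "ln (survival n F (m + (n - 1))) / real (m + (n - 1)) * (1 + real (n - 1) / real m)
          = ln (survival n F (m + (n - 1))) / real m"
        using elim by simp
      then show ?case
        using escape_seq_eq[OF F elim n] pos[of "m + n - 1"] n by simp
    qed
  qed
  then show ?thesis using L pos by blast
qed

lemma escape_rate_defined:
  assumes "F \<subseteq> words n X" "n \<ge> 1"
  shows "escape_rate_defined \<mu> X (hole X F)"
  using escape_limit[OF assms] unfolding escape_rate_defined_def by blast

text \<open>By submultiplicativity a large rate is visible at every finite length, in particular at
  \<open>K * n\<close>, where the expectation is under control.\<close>

lemma survival_lower_bound:
  assumes F: "F \<subseteq> words n X" "n \<ge> 1" and m: "m \<ge> 1" and ge: "escape_rate \<mu> X (hole X F) \<ge> ereal r"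
  shows "exp (r * real m) \<le> C * survival n F m"
  using escape_limit[OF F]
proof
  assume "(\<exists>m. survival n F m = 0) \<and> escape_seq \<mu> X (hole X F) \<longlonglongrightarrow> - \<infinity>"
  then show ?thesis using ge limI[of "escape_seq \<mu> X (hole X F)"] by (auto simp: escape_rate_def)
next
  assume "\<exists>L. (\<forall>m. survival n F m > 0) \<and> escape_seq \<mu> X (hole X F) \<longlonglongrightarrow> ereal L \<and>
       (\<lambda>m. ln (survival n F m) / real m) \<longlonglongrightarrow> L \<and> (\<forall>m\<ge>1. L * real m \<le> ln (survival n F m) + ln C)"
  then obtain L where pos: "survival n F m > 0" and L: "escape_seq \<mu> X (hole X F) \<longlonglongrightarrow> ereal L"
      "L * real m \<le> ln (survival n F m) + ln C" using m by blast
  have "r \<le> L" using ge limI[OF L(1)] by (simp add: escape_rate_def)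
  then have "r * real m \<le> L * real m" by (intro mult_right_mono) auto
  also have "\<dots> \<le> ln (C * survival n F m)" using L(2) C pos by (simp add: ln_mult)
  finally show ?thesis using C pos by (simp add: ln_ge_iff)
qed

section \<open>Loops and lower bounds for survival\<close>

definition loops :: "nat \<Rightarrow> 'a list set" where
  "loops m = {w \<in> listsn m. periodic w \<in> X}"

definition loop_survival :: "nat \<Rightarrow> 'a list set \<Rightarrow> nat \<Rightarrow> real" where
  "loop_survival n F m = (\<Sum>w\<in>loops m. p w * of_bool (cyclic_windows n w \<inter> F = {}))"

lemma finite_loops [simp]: "finite (loops m)"
  by (simp add: loops_def)

lemma cyclic_windows_subset_words: "w \<in> loops m \<Longrightarrow> cyclic_windows n w \<subseteq> words n X"
  by (auto simp: loops_def cyclic_windows_def intro!: win_in_words)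

text \<open>Loops sharing their first \<open>n\<close> letters can be concatenated freely: every window of
  length \<open>n\<close> of the concatenation is a cyclic window of one of the loops.\<close>

definition loops_at :: "nat \<Rightarrow> 'a list set \<Rightarrow> nat \<Rightarrow> 'a list \<Rightarrow> 'a list set" where
  "loops_at n F m s = {w \<in> loops m. take n w = s \<and> cyclic_windows n w \<inter> F = {}}"

lemma concat_loops:
  assumes n: "memory \<le> n" "n \<le> m" and ws: "ws \<noteq> []" "set ws \<subseteq> loops_at n F m s"
  shows "concat ws \<in> language X" "length (concat ws) = length ws * m" "avoids n F (concat ws)"
proof -
  define t where "t = length ws"
  have t: "t \<ge> 1" using ws(1) by (cases ws) (auto simp: t_def)
  have m: "m \<ge> 1" "n \<ge> 1" using n memory(1) by auto
  \<comment> \<open>The index of the loop read at position \<open>i\<close>. Past the end the last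
    loop is repeated, so that \<open>y\<close> below is an infinite sequence.\<close>
  define k where "k i = min (i div m) (t - 1)" for i
  have wk: "ws ! k i \<in> loops_at n F m s" for i
    using ws(2) t nth_mem[of "k i" ws] by (auto simp: k_def t_def min_def)
  have lenk: "length (ws ! k i) = m" for i using wk[of i] by (simp add: loops_at_def loops_def)
  have start: "ws ! k i ! r = s ! r" if "r < n" for i r
  proof -
    have "take n (ws ! k i) = s" using wk[of i] by (simp add: loops_at_def)
    then show ?thesis using that nth_take[of r n "ws ! k i"] by simp
  qed
  define y where "y i = ws ! k i ! (i mod m)" for i
  have win_y: "win y i n = win (periodic (ws ! k i)) (i mod m) n" for i
    unfolding win_eq_iff
  proof (intro conjI allI impI)
    fix l assume l: "l < n"
    have "y (i + l) = periodic (ws ! k i) (i mod m + l)"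
    proof (cases "i mod m + l < m")
      case True
      have d: "(i + l) div m = i div m"
      proof -
        have "i + l = i div m * m + (i mod m + l)" by simp
        then show ?thesis using True m by (metis div_mult_self3 div_less add.right_neutral not_one_le_zero)
      qed
      moreover have "(i + l) mod m = i mod m + l"
        using True mod_add_left_eq[of i m l] by simp
      moreover have "k (i + l) = k i" using d by (simp add: k_def)
      ultimately show ?thesis using True by (simp add: y_def periodic_def lenk)
    next
      \<comment> \<open>The window runs over the end of the loop. It reads fewer than
        \<open>n\<close> letters of the next one, and these belong to the common prefix
        \<open>s\<close>, just as in the periodic continuation.\<close>
      case False
      have im: "i mod m < m" using m by simp
      have e: "(i mod m + l) mod m = i mod m + l - m"
      proof -
        have "i mod m + l - m < m" using l n im by linarith
        then show ?thesis using False le_mod_geq[of m "i mod m + l"] by simp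
      qed
      have lt: "i mod m + l - m < n" using l im by linarith
      have "(i + l) mod m = i mod m + l - m" using e mod_add_left_eq[of i m l] by simp
      then show ?thesis using e lt start[OF lt, of "i + l"] start[OF lt, of i] by (simp add: y_def periodic_def lenk)
    qed
    then show "win (periodic (ws ! k i)) (i mod m) n ! l = y (i + l)" using l by simp
  qed simp
  have in_cw: "win y i n \<in> cyclic_windows n (ws ! k i)" for i
    unfolding win_y cyclic_windows_def using m lenk by (intro imageI) auto
  then have yX: "y \<in> X"
    using memory(2)[OF n(1), of y] cyclic_windows_subset_words[of _ m n] wk unfolding loops_at_def by blast
  have y_avoid: "win y i n \<notin> F" for i
    using in_cw[of i] wk[of i] by (auto simp: loops_at_def)
  have len: "length w = m" if "w \<in> set ws" for w
    using ws(2) that by (auto simp: loops_at_def loops_def)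
  have cc: "length (concat vs) = length vs * m \<and> (\<forall>i<length vs * m. concat vs ! i = vs ! (i div m) ! (i mod m))"
    if "\<forall>w\<in>set vs. length w = m" for vs :: "'a list list"
    using that
  proof (induction vs)
    case (Cons v vs)
    show ?case
    proof (intro conjI allI impI)
      show "length (concat (v # vs)) = length (v # vs) * m" using Cons by simp
      fix i assume i: "i < length (v # vs) * m"
      show "concat (v # vs) ! i = (v # vs) ! (i div m) ! (i mod m)"
      proof (cases "i < m")
        case True
        then show ?thesis using Cons by (simp add: nth_append)
      next
        case False
        then have "concat (v # vs) ! i = vs ! ((i - m) div m) ! ((i - m) mod m)"
          using Cons i by (simp add: nth_append)
        moreover have "i div m = Suc ((i - m) div m)" using False m by (simp add: le_div_geq)
        moreover have "i mod m = (i - m) mod m" using False by (simp add: le_mod_geq)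
        ultimately show ?thesis by simp
      qed
    qed
  qed simp
  show l: "length (concat ws) = length ws * m" using cc len by blast
  have "win y 0 (t * m) = concat ws"
    unfolding win_eq_iff
  proof (intro conjI allI impI)
    show "length (concat ws) = t * m" using l by (simp add: t_def)
    fix i assume i: "i < t * m"
    then have "i div m < t" by (simp add: less_mult_imp_div_less)
    then show "concat ws ! i = y (0 + i)" using cc[of ws] len i by (simp add: y_def k_def t_def min_def)
  qed
  then show "concat ws \<in> language X" "avoids n F (concat ws)"
    using win_in_words[OF yX, of 0 "t * m"] y_avoid l avoids_win_iff[of n F y "t * m"] by (auto simp: t_def)
qed

text \<open>\<open>C\<close> pays for one junction per loop. All loops have length \<open>m\<close>,
  so a concatenation determines its factors and no mass is counted twice.\<close>

lemma survival_ge_loops: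
  assumes n: "memory \<le> n" "n \<le> m" and t: "t \<ge> 1"
  shows "((\<Sum>w\<in>loops_at n F m s. p w) / C) ^ t \<le> survival n F (t * m)"
proof -
  let ?S = "loops_at n F m s"
  define T where "T t = concat ` {ws. length ws = t \<and> set ws \<subseteq> ?S}" for t
  have finS: "finite ?S" by (simp add: loops_at_def)
  have SL: "?S \<subseteq> listsn m" by (auto simp: loops_at_def loops_def)
  have S_eq: "(\<Sum>w\<in>?S. p w) = (\<Sum>u\<in>listsn m. p u * of_bool (u \<in> ?S))"
    using SL by (intro sum.mono_neutral_cong_left) auto
  have "((\<Sum>w\<in>?S. p w) / C) ^ t \<le> (\<Sum>w\<in>listsn (t * m). p w * of_bool (w \<in> T t))"
  proof (induction t)
    case 0
    have "T 0 = {[]}" by (auto simp: T_def)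
    then show ?case by (simp add: p_Nil)
  next
    case (Suc t)
    let ?B = "\<Sum>v\<in>listsn (t * m). p v * of_bool (v \<in> T t)"
    have "((\<Sum>w\<in>?S. p w) / C) ^ Suc t \<le> ((\<Sum>w\<in>?S. p w) / C) * ?B"
      unfolding power_Suc using C
      by (intro mult_left_mono Suc divide_nonneg_nonneg sum_nonneg p_nonneg) auto
    also have "((\<Sum>w\<in>?S. p w) / C) * ?B = (\<Sum>u\<in>listsn m. p u * of_bool (u \<in> ?S)) / C * ?B"
      unfolding S_eq ..
    also have "\<dots> = (\<Sum>u\<in>listsn m. \<Sum>v\<in>listsn (t * m). (p u * p v) / C * (of_bool (u \<in> ?S) * of_bool (v \<in> T t)))"
      unfolding times_divide_eq_left sum_product sum_divide_distrib
      by (intro sum.cong refl) (simp add: ac_simps)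
    also have "\<dots> \<le> (\<Sum>u\<in>listsn m. \<Sum>v\<in>listsn (t * m). p (u @ v) * of_bool (u @ v \<in> T (Suc t)))"
    proof (intro sum_mono)
      fix u v
      show "(p u * p v) / C * (of_bool (u \<in> ?S) * of_bool (v \<in> T t)) \<le> p (u @ v) * of_bool (u @ v \<in> T (Suc t))"
      proof (cases "u \<in> ?S \<and> v \<in> T t")
        case True
        then obtain ws where ws: "v = concat ws" "length ws = t" "set ws \<subseteq> ?S" by (auto simp: T_def)
        have uv: "u @ v = concat (u # ws)" using ws by simp
        then have "u @ v \<in> T (Suc t)"
          unfolding T_def using True ws by (intro image_eqI[of _ _ "u # ws"]) auto
        moreover have "u @ v \<in> language X"
          unfolding uv using True ws by (intro concat_loops(1)[OF n]) auto
        then have "(p u * p v) / C \<le> p (u @ v)" using p_lower[of u v] C by (simp add: field_simps)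
        ultimately show ?thesis using True by simp
      qed (use p_nonneg in auto)
    qed
    also have "\<dots> = (\<Sum>w\<in>listsn (m + t * m). p w * of_bool (w \<in> T (Suc t)))"
      by (simp only: sum_listsn_append)
    finally show ?case by simp
  qed
  also have "\<dots> \<le> survival n F (t * m)"
    unfolding survival_def
  proof (intro sum_mono mult_left_mono p_nonneg)
    fix w
    show "of_bool (w \<in> T t) \<le> (of_bool (avoids n F w) :: real)"
    proof (cases "w \<in> T t")
      case True
      then obtain ws where ws: "w = concat ws" "length ws = t" "set ws \<subseteq> ?S" by (auto simp: T_def)
      then have "ws \<noteq> []" using t by auto
      then have "avoids n F w" unfolding ws(1) using ws(3) by (rule concat_loops(3)[OF n])
      then show ?thesis by simp
    qed simp
  qed
  finally show ?thesis .
qed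

text \<open>If the loops of one class have mass \<open>A * C\<close> with \<open>A > 0\<close>,
  iterating them keeps survival at length \<open>t * m\<close> above \<open>A ^ t\<close>. Survival
  then never vanishes, and the rate is at least \<open>ln A / m\<close>.\<close>

lemma loops_at_upper_bound:
  assumes F: "F \<subseteq> words n X" and n: "memory \<le> n" "n \<le> m"
    and le: "escape_rate \<mu> X (hole X F) \<le> ereal r"
  shows "(\<Sum>w\<in>loops_at n F m s. p w) \<le> C * exp (r * real m)"
proof (cases "(\<Sum>w\<in>loops_at n F m s. p w) > 0")
  case True
  define A where "A = (\<Sum>w\<in>loops_at n F m s. p w) / C"
  have A: "A > 0" using True C by (simp add: A_def)
  have m1: "m \<ge> 1" "n \<ge> 1" using n memory(1) by auto
  have low: "A ^ t \<le> survival n F (t * m)" if "t \<ge> 1" for t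
    unfolding A_def by (rule survival_ge_loops[OF n that])
  have "survival n F k \<noteq> 0" for k
  proof
    assume "survival n F k = 0"
    moreover have "k \<le> Suc k * m" using mult_le_mono2[OF m1(1), of "Suc k"] by simp
    ultimately have "survival n F (Suc k * m) = 0" by (rule survival_zero_mono)
    then show False using low[of "Suc k"] zero_less_power[OF A, of "Suc k"] by simp
  qed
  then obtain L where L: "escape_seq \<mu> X (hole X F) \<longlonglongrightarrow> ereal L"
      "(\<lambda>m. ln (survival n F m) / real m) \<longlonglongrightarrow> L"
    using escape_limit[OF F m1(2)] by blast
  have "L \<le> r" using le limI[OF L(1)] by (simp add: escape_rate_def)
  have "strict_mono (\<lambda>t. t * m)" using m1 by (auto simp: strict_mono_def)
  then have lim: "(\<lambda>t. ln (survival n F (t * m)) / real (t * m)) \<longlonglongrightarrow> L"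
    using LIMSEQ_subseq_LIMSEQ[OF L(2)] by (simp only: o_def)
  have "ln A / real m \<le> L"
  proof (rule tendsto_lowerbound[OF lim])
    show "\<forall>\<^sub>F t in sequentially. ln A / real m \<le> ln (survival n F (t * m)) / real (t * m)"
      using eventually_ge_at_top[of 1]
    proof eventually_elim
      case (elim t)
      have "ln (A ^ t) \<le> ln (survival n F (t * m))"
        using low[OF elim] A by (intro ln_mono) (auto intro: less_le_trans[OF zero_less_power])
      then have "real t * ln A / real (t * m) \<le> ln (survival n F (t * m)) / real (t * m)"
        using A by (intro divide_right_mono) (auto simp: ln_realpow)
      then show ?case using elim by simp
    qed
  qed simp
  then have "ln A / real m \<le> r" using \<open>L \<le> r\<close> by linarith
  then have "ln A \<le> r * real m" using m1 by (simp add: pos_divide_le_eq)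
  then have "exp (ln A) \<le> exp (r * real m)" by simp
  then have "A \<le> exp (r * real m)" using A by simp
  then show ?thesis using C by (simp add: A_def field_simps)
next
  case False
  moreover have "0 \<le> C * exp (r * real m)" using C by simp
  ultimately show ?thesis by linarith
qed

text \<open>Loops concatenate only within a class of common prefix; the number of possible prefixes
  is the price of summing over the classes.\<close>

lemma loop_survival_upper_bound:
  assumes F: "F \<subseteq> words n X" and n: "memory \<le> n" "n \<le> m"
    and le: "escape_rate \<mu> X (hole X F) \<le> ereal r"
  shows "loop_survival n F m \<le> real (CARD('a)) ^ n * (C * exp (r * real m))"
proof -
  have "loop_survival n F m = (\<Sum>w\<in>{w \<in> loops m. cyclic_windows n w \<inter> F = {}}. p w)"
    unfolding loop_survival_def by (intro sum.mono_neutral_cong_right) auto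
  also have "{w \<in> loops m. cyclic_windows n w \<inter> F = {}} = (\<Union>s\<in>listsn n. loops_at n F m s)"
    using n by (auto simp: loops_at_def loops_def)
  also have "(\<Sum>w\<in>\<dots>. p w) = (\<Sum>s\<in>listsn n. \<Sum>w\<in>loops_at n F m s. p w)"
    by (rule sum.UNION_disjoint) (auto simp: loops_at_def)
  also have "\<dots> \<le> (\<Sum>s\<in>(listsn n :: 'a list set). C * exp (r * real m))"
    by (intro sum_mono loops_at_upper_bound[OF F n le])
  also have "\<dots> = real (CARD('a)) ^ n * (C * exp (r * real m))"
    using card_lists_length_eq[of "UNIV :: 'a set" n] by simp
  finally show ?thesis .
qed

end

section \<open>Random holes\<close>

context quasi_bernoulli
begin

section \<open>Mass and rotation of loops\<close>

lemma loops_language: "w \<in> loops m \<Longrightarrow> w \<in> language X"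
proof -
  assume w: "w \<in> loops m"
  have "win (periodic w) 0 (length w) = w"
    by (simp add: win_eq_iff periodic_def)
  then show ?thesis using w win_in_words[of "periodic w" 0 "length w"] by (simp add: loops_def)
qed

text \<open>As \<open>u\<close> repeats the beginning of \<open>w\<close>, every window of length
  \<open>memory\<close> of the periodic sequence already occurs in \<open>w @ u\<close>; locality
  does the rest.\<close>

lemma loop_if_closes:
  assumes u: "length u = memory" "take memory w = u" and w: "w @ u \<in> language X"
  shows "w \<in> loops (length w)"
proof -
  let ?k = memory and ?m = "length w"
  have k: "?k \<le> ?m" using u by (metis length_take min.cobounded1)
  have k1: "?k \<ge> 1" by (rule memory(1))
  obtain x where x: "x \<in> X" "win x 0 (?m + ?k) = w @ u"
    using w u(1) by (auto simp: words_eq_win)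
  have xi: "x i = periodic w i" if "i < ?m + ?k" for i
  proof -
    have "x i = (w @ u) ! i" unfolding x(2)[symmetric] using that by simp
    also have "\<dots> = periodic w i"
    proof (cases "i < ?m")
      case False
      then have i: "i mod ?m = i - ?m" "i - ?m < ?k"
        using that k by (auto simp: le_mod_geq)
      have "u ! (i - ?m) = w ! (i - ?m)" using u(2) i(2) nth_take[of "i - ?m" ?k w] by simp
      then show ?thesis using False i by (simp add: nth_append periodic_def)
    qed (simp add: nth_append periodic_def)
    finally show ?thesis .
  qed
  have "win (periodic w) i ?k \<in> words ?k X" for i
  proof -
    have "0 < ?m" using k k1 by linarith
    then have m: "i mod ?m < ?m" by simp
    have "win (periodic w) i ?k = win (periodic w) (i mod ?m) ?k"
      by (simp add: win_eq_iff periodic_def mod_add_left_eq)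
    also have "\<dots> = win x (i mod ?m) ?k"
      using m by (auto simp: win_eq_iff xi)
    finally show ?thesis using win_in_words[OF x(1)] by simp
  qed
  then show ?thesis using memory(2)[of ?k "periodic w"] by (simp add: loops_def)
qed

text \<open>Every word \<open>v\<close> of length \<open>k\<close> is completed to a loop
  \<open>u @ a @ v @ b\<close>, from which it can be read off, at the cost of a constant factor; the
  masses of these words add up to 1.\<close>

lemma loops_mass: obtains c where "c > 0" "\<And>m. m \<ge> memory + 2 * gap \<Longrightarrow> c \<le> (\<Sum>w\<in>loops m. p w)"
proof -
  obtain \<delta> where d: "\<delta> > 0" "\<And>w. w \<in> language X \<Longrightarrow> p w \<ge> \<delta> ^ length w" by (rule p_lower_bound) blast
  obtain u where "u \<in> words memory X" using words_nonempty by blast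
  then have u: "u \<in> language X" "length u = memory" by (auto simp: words_def)
  \<comment> \<open>Lower bounds for the measures of \<open>u\<close> and of the two bridges, with
    one factor \<open>C\<close> for each of the three junctions.\<close>
  define c where "c = \<delta> ^ (memory + 2 * gap) / C ^ 3"
  have "c \<le> (\<Sum>w\<in>loops m. p w)" if m: "m \<ge> memory + 2 * gap" for m
  proof -
    define k where "k = m - memory - 2 * gap"
    have mk: "m = memory + gap + k + gap" using m by (simp add: k_def)
    have "\<forall>v. \<exists>w. v \<in> words k X \<longrightarrow> w \<in> loops m \<and> take k (drop (memory + gap) w) = v \<and> c * p v \<le> p w"
    proof (intro allI)
      fix v
      show "\<exists>w. v \<in> words k X \<longrightarrow> w \<in> loops m \<and> take k (drop (memory + gap) w) = v \<and> c * p v \<le> p w"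
      proof (cases "v \<in> words k X")
        case True
        then have v: "v \<in> language X" "length v = k" by (auto simp: words_def)
        obtain a where a: "length a = gap" "u @ a @ v \<in> language X" using gap[OF u(1) v(1)] by blast
        obtain b where b: "length b = gap" "(u @ a @ v) @ b @ u \<in> language X" using gap[OF a(2) u(1)] by blast
        define w where "w = u @ a @ v @ b"
        have len: "length w = m" using u a b v by (simp add: w_def mk)
        have "w \<in> loops (length w)"
          by (rule loop_if_closes[OF u(2)]) (use u b in \<open>auto simp: w_def\<close>)
        then have wl: "w \<in> loops m" using len by simp
        have wL: "u @ a @ v @ b \<in> language X" using loops_language[OF wl] by (simp add: w_def)
        note L1 = language_appendD2[OF wL]
        note L2 = language_appendD2[OF L1]
        have pu: "p u \<ge> \<delta> ^ memory" "p a \<ge> \<delta> ^ gap" "p b \<ge> \<delta> ^ gap"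
          using d(2)[OF u(1)] u(2) d(2)[OF language_appendD1[OF L1]] a(1)
            d(2)[OF language_appendD2[OF L2]] b(1) by auto
        have "\<delta> ^ memory * (\<delta> ^ gap * (p v * \<delta> ^ gap)) \<le> p u * (p a * (p v * p b))"
          using pu d(1) p_nonneg by (intro mult_mono mult_nonneg_nonneg) auto
        also have "\<dots> \<le> p u * (p a * (C * p (v @ b)))"
          using p_nonneg by (intro mult_left_mono p_lower L2) auto
        also have "\<dots> = C * (p u * (p a * p (v @ b)))" by simp
        also have "\<dots> \<le> C * (p u * (C * p (a @ v @ b)))"
          using p_nonneg C by (intro mult_left_mono p_lower L1) auto
        also have "\<dots> = C ^ 2 * (p u * p (a @ v @ b))" by (simp add: power2_eq_square)
        also have "\<dots> \<le> C ^ 2 * (C * p w)"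
          unfolding w_def using C by (intro mult_left_mono p_lower wL) auto
        finally have "\<delta> ^ (memory + 2 * gap) * p v \<le> C ^ 3 * p w"
          by (simp add: power_add power2_eq_square power3_eq_cube mult_2 mult_2_right ac_simps)
        then have "c * p v \<le> p w" using C by (simp add: c_def field_simps)
        moreover have "take k (drop (memory + gap) w) = v"
          using u a v by (simp add: w_def)
        ultimately show ?thesis using wl by blast
      qed simp
    qed
    then obtain W where W: "\<And>v. v \<in> words k X \<Longrightarrow> W v \<in> loops m \<and> take k (drop (memory + gap) (W v)) = v \<and> c * p v \<le> p (W v)"
      by metis
    have inj: "inj_on W (words k X)" by (rule inj_onI) (metis W)
    have "(\<Sum>v\<in>words k X. p v) = 1"
      using sum_words_eq[of p k] sum_p by simp
    then have "c = (\<Sum>v\<in>words k X. c * p v)" by (simp add: sum_distrib_left[symmetric])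
    also have "\<dots> \<le> (\<Sum>v\<in>words k X. p (W v))" using W by (intro sum_mono) blast
    also have "\<dots> = (\<Sum>w\<in>W ` words k X. p w)" using inj by (simp add: sum.reindex)
    also have "\<dots> \<le> (\<Sum>w\<in>loops m. p w)" using W by (intro sum_mono2) (auto simp: p_nonneg)
    finally show ?thesis .
  qed
  moreover have "c > 0" using d C by (simp add: c_def)
  ultimately show ?thesis using that by blast
qed

lemma periodic_rotate: "w \<noteq> [] \<Longrightarrow> periodic (rotate r w) i = periodic w (i + r)"
  by (simp add: periodic_def nth_rotate mod_add_right_eq add.commute)

lemma win_periodic_rotate: "w \<noteq> [] \<Longrightarrow> win (periodic (rotate r w)) i n = win (periodic w) (i + r) n"
  by (simp add: win_eq_iff periodic_rotate ac_simps)

lemma cyclic_windows_rotate: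
  assumes w: "w \<noteq> []" and r: "r \<le> length w"
  shows "cyclic_windows n (rotate r w) = cyclic_windows n w"
proof
  have w': "rotate r w \<noteq> []" using w by simp
  show "cyclic_windows n (rotate r w) \<subseteq> cyclic_windows n w"
    using w by (auto simp: cyclic_windows_def[of n "rotate r w"] win_periodic_rotate intro!: win_periodic_in_cyclic_windows)
  show "cyclic_windows n w \<subseteq> cyclic_windows n (rotate r w)"
  proof
    fix v assume "v \<in> cyclic_windows n w"
    then obtain j where v: "v = win (periodic w) j n" by (auto simp: cyclic_windows_def)
    have "v = win (periodic (rotate r w)) (j + (length w - r)) n"
      unfolding win_periodic_rotate[OF w] v using r by (simp add: win_eq_iff periodic_def)
        (metis add.assoc add.commute mod_add_self2)
    then show "v \<in> cyclic_windows n (rotate r w)" using win_periodic_in_cyclic_windows[OF w'] by simp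
  qed
qed

lemma rotate_loops: "w \<in> loops m \<Longrightarrow> rotate r w \<in> loops m"
proof (cases "w = []")
  case False
  assume w: "w \<in> loops m"
  have "periodic (rotate r w) = (shift ^^ r) (periodic w)"
    using False by (simp add: fun_eq_iff shift_funpow periodic_rotate)
  then show ?thesis using w shift_closed[of "periodic w" r] by (simp add: loops_def)
qed simp

text \<open>With \<open>w = u @ v\<close>, both \<open>w\<close> and its rotation
  \<open>v @ u\<close> are compared with \<open>p u * p v\<close>.\<close>

lemma p_rotate_le:
  assumes w: "w \<in> loops m" and r: "r \<le> m"
  shows "p w \<le> C ^ 2 * p (rotate r w)"
proof -
  define u v where "u = take r w" and "v = drop r w"
  have len: "length w = m" using w by (simp add: loops_def)
  have w_eq: "w = u @ v" by (simp add: u_def v_def)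
  have rot: "rotate r w = v @ u"
    using r len rotate_append[of u v] by (simp add: u_def v_def)
  have "p w \<le> C * (p u * p v)" unfolding w_eq by (rule p_upper)
  also have "\<dots> = C * (p v * p u)" by simp
  also have "\<dots> \<le> C * (C * p (v @ u))"
    using C loops_language[OF rotate_loops[OF w, of r]] unfolding rot by (intro mult_left_mono p_lower) auto
  finally show ?thesis by (simp add: rot power2_eq_square)
qed

end

section \<open>Expectation over the random hole\<close>

definition hole_expectation :: "(nat \<Rightarrow> 'a) set \<Rightarrow> real \<Rightarrow> nat \<Rightarrow> ('a list set \<Rightarrow> real) \<Rightarrow> real" where
  "hole_expectation X \<alpha> n Y = (\<Sum>F\<in>Pow (words n X). (1 - \<alpha>) ^ card F * \<alpha> ^ card (words n X - F) * Y F)"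

lemma hole_prob_eq_expectation: "hole_prob X \<alpha> n E = hole_expectation X \<alpha> n (\<lambda>F. of_bool (E F))"
  unfolding hole_prob_def hole_expectation_def by (intro sum.cong) auto

lemma hole_expectation_mono:
  assumes "0 \<le> \<alpha>" "\<alpha> \<le> 1" "\<And>F. F \<subseteq> words n X \<Longrightarrow> Y F \<le> Y' F"
  shows "hole_expectation X \<alpha> n Y \<le> hole_expectation X \<alpha> n Y'"
  unfolding hole_expectation_def using assms by (intro sum_mono mult_left_mono) auto

lemma hole_expectation_add: "hole_expectation X \<alpha> n (\<lambda>F. Y F + Y' F) = hole_expectation X \<alpha> n Y + hole_expectation X \<alpha> n Y'"
  by (simp add: hole_expectation_def distrib_left sum.distrib)

lemma hole_expectation_cmult: "hole_expectation X \<alpha> n (\<lambda>F. c * Y F) = c * hole_expectation X \<alpha> n Y"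
  by (simp add: hole_expectation_def sum_distrib_left ac_simps)

lemma hole_expectation_sum: "hole_expectation X \<alpha> n (\<lambda>F. \<Sum>i\<in>I. Y i F) = (\<Sum>i\<in>I. hole_expectation X \<alpha> n (Y i))"
  unfolding hole_expectation_def sum_distrib_left by (rule sum.swap)

text \<open>Each word of \<open>D\<close> has to be left out, which contributes a factor \<alpha>.
  The sum over subsets of the remaining words expands a product of factors
  \<open>(1 - \<alpha>) + \<alpha> = 1\<close>.\<close>

lemma hole_expectation_disjoint:
  fixes X :: "(nat \<Rightarrow> 'a::finite) set"
  assumes "D \<subseteq> words n X"
  shows "hole_expectation X \<alpha> n (\<lambda>F. of_bool (D \<inter> F = {})) = \<alpha> ^ card D"
proof -
  let ?B = "words n X"
  have fin: "finite ?B" "finite D" using assms finite_subset[OF _ finite_words] by auto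
  have "hole_expectation X \<alpha> n (\<lambda>F. of_bool (D \<inter> F = {}))
      = (\<Sum>F\<in>Pow (?B - D). (1 - \<alpha>) ^ card F * \<alpha> ^ card (?B - F))"
    unfolding hole_expectation_def using fin by (intro sum.mono_neutral_cong_right) auto
  also have "\<dots> = (\<Sum>F\<in>Pow (?B - D). \<alpha> ^ card D * ((1 - \<alpha>) ^ card F * \<alpha> ^ card (?B - D - F)))"
  proof (intro sum.cong refl)
    fix F assume F: "F \<in> Pow (?B - D)"
    have "?B - F = D \<union> (?B - D - F)" using F assms by auto
    then have "card (?B - F) = card D + card (?B - D - F)"
      using fin by (subst card_Un_disjoint[symmetric]) auto
    then show "(1 - \<alpha>) ^ card F * \<alpha> ^ card (?B - F) = \<alpha> ^ card D * ((1 - \<alpha>) ^ card F * \<alpha> ^ card (?B - D - F))"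
      by (simp add: power_add)
  qed
  also have "\<dots> = \<alpha> ^ card D * (\<Sum>F\<in>Pow (?B - D). (\<Prod>i\<in>F. 1 - \<alpha>) * (\<Prod>i\<in>?B - D - F. \<alpha>))"
    by (simp add: sum_distrib_left)
  also have "(\<Sum>F\<in>Pow (?B - D). (\<Prod>i\<in>F. 1 - \<alpha>) * (\<Prod>i\<in>?B - D - F. \<alpha>)) = (\<Prod>i\<in>?B - D. (1 - \<alpha>) + \<alpha>)"
    using fin by (intro prod_add[symmetric]) auto
  finally show ?thesis by simp
qed

lemma hole_expectation_const:
  fixes X :: "(nat \<Rightarrow> 'a::finite) set"
  shows "hole_expectation X \<alpha> n (\<lambda>F. c) = c"
  using hole_expectation_cmult[of X \<alpha> n c "\<lambda>_. 1"] hole_expectation_disjoint[of "{}" n X \<alpha>] by simp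

section \<open>Moment estimates and the two tails\<close>

context quasi_bernoulli_decay
begin

lemma alpha_le_ge: "0 \<le> \<alpha>" "\<alpha> \<le> 1"
  using alpha_pos alpha by auto

text \<open>At most \<open>n\<close> positions have a window wrapping around the end. Thus the
  estimate for cyclic windows also serves for linear words, at the price of
  \<open>(1 / \<alpha>) ^ n\<close>.\<close>

lemma linear_windows_card:
  assumes "n \<le> length w" "n \<ge> 1"
  shows "card (cyclic_windows n w) \<le> card ((\<lambda>i. take n (drop i w)) ` {i. i + n \<le> length w}) + n"
proof -
  let ?m = "length w"
  let ?L = "(\<lambda>i. take n (drop i w)) ` {i. i + n \<le> ?m}"
  have fin: "finite {i. i + n \<le> ?m}" by (rule finite_subset[of _ "{..?m}"]) auto
  have "cyclic_windows n w \<subseteq> ?L \<union> (\<lambda>j. win (periodic w) j n) ` {?m - n..<?m}"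
  proof
    fix v assume "v \<in> cyclic_windows n w"
    then obtain j where j: "j < ?m" "v = win (periodic w) j n" by (auto simp: cyclic_windows_def)
    show "v \<in> ?L \<union> (\<lambda>j. win (periodic w) j n) ` {?m - n..<?m}"
    proof (cases "j + n \<le> ?m")
      case True
      then have "v = take n (drop j w)" unfolding j(2) win_eq_iff by (auto simp: periodic_def)
      then show ?thesis using True by blast
    next
      case False
      then show ?thesis using j by auto
    qed
  qed
  then have "card (cyclic_windows n w) \<le> card (?L \<union> (\<lambda>j. win (periodic w) j n) ` {?m - n..<?m})"
    using fin by (intro card_mono) auto
  also have "\<dots> \<le> card ?L + card ((\<lambda>j. win (periodic w) j n) ` {?m - n..<?m})" by (rule card_Un_le)
  also have "card ((\<lambda>j. win (periodic w) j n) ` {?m - n..<?m}) \<le> card {?m - n..<?m}"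
    by (rule card_image_le) simp
  finally show ?thesis using assms by simp
qed

lemma expected_survival:
  assumes n: "n \<ge> 1" and K: "K \<ge> 1"
  shows "hole_expectation X \<alpha> n (\<lambda>F. survival n F (K * n)) \<le> (1 / \<alpha>) ^ n * (\<alpha> ^ (K * n) * growth N K n ^ K)"
proof -
  let ?L = "\<lambda>w. (\<lambda>i. take n (drop i w)) ` {i. i + n \<le> length w}"
  have nK: "n \<le> K * n" using K by simp
  have "hole_expectation X \<alpha> n (\<lambda>F. survival n F (K * n))
      = (\<Sum>w\<in>listsn (K * n). p w * hole_expectation X \<alpha> n (\<lambda>F. of_bool (avoids n F w)))"
    unfolding survival_def hole_expectation_sum hole_expectation_cmult ..
  also have "\<dots> \<le> (\<Sum>w\<in>listsn (K * n). p w * ((1 / \<alpha>) ^ n * \<alpha> ^ card (cyclic_windows n w)))"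
  proof (rule sum_mono)
    fix w :: "'a list" assume w: "w \<in> listsn (K * n)"
    show "p w * hole_expectation X \<alpha> n (\<lambda>F. of_bool (avoids n F w)) \<le> p w * ((1 / \<alpha>) ^ n * \<alpha> ^ card (cyclic_windows n w))"
    proof (cases "w \<in> language X")
      case True
      have L: "?L w \<subseteq> words n X"
      proof
        fix v assume "v \<in> ?L w"
        then obtain i where i: "i + n \<le> length w" "v = take n (drop i w)" by blast
        obtain x where x: "x \<in> X" "w = win x 0 (length w)" using True by (auto simp: words_eq_win)
        have "v = win x (0 + i) n" unfolding i(2) by (subst x(2)) (rule take_drop_win[OF i(1)])
        then show "v \<in> words n X" using win_in_words[OF x(1)] by simp
      qed
      have "avoids n F w \<longleftrightarrow> ?L w \<inter> F = {}" for F unfolding avoids_def by blast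
      then have "hole_expectation X \<alpha> n (\<lambda>F. of_bool (avoids n F w)) = \<alpha> ^ card (?L w)"
        using hole_expectation_disjoint[OF L] by simp
      moreover have "\<alpha> ^ (card (?L w) + n) \<le> \<alpha> ^ card (cyclic_windows n w)"
        using linear_windows_card[of n w] w nK n alpha_le_ge by (intro power_decreasing) auto
      then have "\<alpha> ^ card (?L w) \<le> (1 / \<alpha>) ^ n * \<alpha> ^ card (cyclic_windows n w)"
        using alpha_pos by (simp add: power_add power_divide field_simps)
      ultimately show ?thesis using p_nonneg by (simp add: mult_left_mono)
    qed (simp add: p_zero)
  qed
  also have "\<dots> = (1 / \<alpha>) ^ n * (\<Sum>w\<in>listsn (K * n). p w * \<alpha> ^ card ({} \<union> cyclic_windows n w))"
    by (simp add: sum_distrib_left ac_simps)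
  also have "\<dots> \<le> (1 / \<alpha>) ^ n * (\<alpha> ^ (card ({} :: 'a list set) + K * n) * growth N K n ^ K)"
    using alpha_pos by (intro mult_left_mono sum_power_windows) auto
  finally show ?thesis by simp
qed

lemma upper_tail:
  assumes n: "n \<ge> 1" and K: "K \<ge> 1"
  shows "hole_prob X \<alpha> n (\<lambda>F. escape_rate \<mu> X (hole X F) \<ge> ereal (ln \<alpha> + \<epsilon>))
    \<le> C * growth N K n ^ K * ((1 / \<alpha>) ^ n * exp (- \<epsilon> * real (K * n)))"
proof -
  let ?m = "K * n"
  have m: "?m \<ge> 1" using n K by simp
  define z where "z = exp (- (ln \<alpha> + \<epsilon>) * real ?m)"
  have "hole_prob X \<alpha> n (\<lambda>F. escape_rate \<mu> X (hole X F) \<ge> ereal (ln \<alpha> + \<epsilon>))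
      \<le> hole_expectation X \<alpha> n (\<lambda>F. (C * z) * survival n F ?m)"
    unfolding hole_prob_eq_expectation
  proof (rule hole_expectation_mono[OF alpha_le_ge])
    fix F assume F: "F \<subseteq> words n X"
    show "of_bool (ereal (ln \<alpha> + \<epsilon>) \<le> escape_rate \<mu> X (hole X F)) \<le> (C * z) * survival n F ?m"
    proof (cases "ereal (ln \<alpha> + \<epsilon>) \<le> escape_rate \<mu> X (hole X F)")
      case True
      have "exp ((ln \<alpha> + \<epsilon>) * real ?m) * z \<le> C * survival n F ?m * z"
        using survival_lower_bound[OF F n m True] by (intro mult_right_mono) (auto simp: z_def)
      moreover have "exp ((ln \<alpha> + \<epsilon>) * real ?m) * z = 1"
        unfolding z_def exp_add[symmetric] by (simp add: algebra_simps)
      ultimately show ?thesis using True by (simp add: ac_simps)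
    next
      case False
      then show ?thesis using survival_nonneg C by (simp add: z_def)
    qed
  qed
  also have "\<dots> = (C * z) * hole_expectation X \<alpha> n (\<lambda>F. survival n F ?m)"
    by (rule hole_expectation_cmult)
  also have "\<dots> \<le> (C * z) * ((1 / \<alpha>) ^ n * (\<alpha> ^ ?m * growth N K n ^ K))"
    using C by (intro mult_left_mono expected_survival n K) (auto simp: z_def)
  also have "\<dots> = C * growth N K n ^ K * ((1 / \<alpha>) ^ n * (\<alpha> ^ ?m * z))" by (simp add: ac_simps)
  also have "\<alpha> ^ ?m * z = exp (- \<epsilon> * real ?m)"
  proof -
    have "\<alpha> ^ ?m = exp (ln \<alpha> * real ?m)"
      using alpha_pos by (metis exp_ln exp_of_nat_mult mult.commute)
    then show ?thesis unfolding z_def by (simp add: exp_add[symmetric] algebra_simps)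
  qed
  finally show ?thesis .
qed

text \<open>Rotating the second loop moves a common window to position 0, where
  \<open>sum_power_windows_meeting\<close> applies. There are \<open>K * n\<close> rotations, each
  costs \<open>C ^ 2\<close> in measure, and the first loop has at most \<open>K * n\<close>
  windows.\<close>

lemma sum_meeting_loops:
  assumes w: "w \<in> loops (K * n)" and n: "n \<ge> 1" and K: "K \<ge> 1"
  shows "(\<Sum>w'\<in>loops (K * n). p w' * \<alpha> ^ card (cyclic_windows n w \<union> cyclic_windows n w') *
      of_bool (cyclic_windows n w \<inter> cyclic_windows n w' \<noteq> {}))
    \<le> \<alpha> ^ card (cyclic_windows n w) * (\<alpha> ^ (K * n) * (C ^ 2 * C1 * real (K * n) ^ 2 * (\<gamma> / \<alpha>) ^ n * growth (K * n) K n ^ (K - 1)))"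
proof -
  let ?m = "K * n" and ?D = "cyclic_windows n w"
  have m: "?m \<ge> 1" using n K by simp
  have lenw: "length w = ?m" using w by (simp add: loops_def)
  have Dsub: "?D \<subseteq> listsn n" by (auto simp: cyclic_windows_def)
  have Dcard: "card ?D \<le> ?m" using card_cyclic_windows_le[of n w] lenw by simp
  let ?h = "\<lambda>w'. p w' * \<alpha> ^ card (?D \<union> cyclic_windows n w')"
  have h0: "?h w' \<ge> 0" for w' using p_nonneg alpha_le_ge by simp
  let ?B = "\<alpha> ^ (card ?D + ?m) * (real ?m * C1 * (\<gamma> / \<alpha>) ^ n * growth ?m K n ^ (K - 1))"
  have "(\<Sum>w'\<in>loops ?m. ?h w' * of_bool (?D \<inter> cyclic_windows n w' \<noteq> {}))
      \<le> (\<Sum>w'\<in>loops ?m. \<Sum>r<?m. C ^ 2 * (?h (rotate r w') * of_bool (win (periodic (rotate r w')) 0 n \<in> ?D)))"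
  proof (rule sum_mono)
    fix w' assume w': "w' \<in> loops ?m"
    have len: "length w' = ?m" using w' by (simp add: loops_def)
    have ne: "w' \<noteq> []" using len m by auto
    let ?t = "\<lambda>r. C ^ 2 * (?h (rotate r w') * of_bool (win (periodic (rotate r w')) 0 n \<in> ?D))"
    have t0: "?t r \<ge> 0" for r using h0 C by simp
    show "?h w' * of_bool (?D \<inter> cyclic_windows n w' \<noteq> {}) \<le> (\<Sum>r<?m. ?t r)"
    proof (cases "?D \<inter> cyclic_windows n w' \<noteq> {}")
      case True
      then obtain r where r: "r < ?m" "win (periodic w') r n \<in> ?D"
        using len by (auto simp: cyclic_windows_def[of n w'])
      have "?h w' \<le> (C ^ 2 * p (rotate r w')) * \<alpha> ^ card (?D \<union> cyclic_windows n w')"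
        using p_rotate_le[OF w', of r] r alpha_le_ge by (intro mult_right_mono) auto
      also have "\<dots> = ?t r"
        using r len ne by (simp add: cyclic_windows_rotate win_periodic_rotate)
      also have "\<dots> \<le> (\<Sum>r<?m. ?t r)" using r t0 by (intro member_le_sum) auto
      finally show ?thesis using True by simp
    next
      case False
      then show ?thesis using t0 by (simp add: sum_nonneg)
    qed
  qed
  also have "\<dots> = (\<Sum>r<?m. C ^ 2 * (\<Sum>w'\<in>loops ?m. ?h (rotate r w') * of_bool (win (periodic (rotate r w')) 0 n \<in> ?D)))"
    unfolding sum_distrib_left by (rule sum.swap)
  also have "\<dots> \<le> (\<Sum>r<?m. C ^ 2 * ?B)"
  proof (intro sum_mono mult_left_mono)
    fix r
    \<comment> \<open>Rotation is injective, so each word is counted at most once after the change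
      of variables.\<close>
    have inj: "inj_on (rotate r) (loops ?m)"
      by (rule inj_on_subset[OF inj_fn[OF inj_rotate1, of r], folded rotate_def]) simp
    have "(\<Sum>w'\<in>loops ?m. ?h (rotate r w') * of_bool (win (periodic (rotate r w')) 0 n \<in> ?D))
        = (\<Sum>w''\<in>rotate r ` loops ?m. ?h w'' * of_bool (win (periodic w'') 0 n \<in> ?D))"
      by (subst sum.reindex[OF inj]) (simp only: o_def)
    also have "\<dots> \<le> (\<Sum>w''\<in>listsn ?m. ?h w'' * of_bool (win (periodic w'') 0 n \<in> ?D))"
      using h0 by (intro sum_mono2) (auto simp: loops_def)
    also have "\<dots> = (\<Sum>w''\<in>{w'' \<in> listsn ?m. win (periodic w'') 0 n \<in> ?D}. ?h w'')"
      by (intro sum.mono_neutral_cong_right) auto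
    also have "\<dots> \<le> ?B"
      by (rule sum_power_windows_meeting) (use Dcard Dsub n K in auto)
    finally show "(\<Sum>w'\<in>loops ?m. ?h (rotate r w') * of_bool (win (periodic (rotate r w')) 0 n \<in> ?D)) \<le> ?B" .
  qed (use C in auto)
  also have "\<dots> = \<alpha> ^ card ?D * (\<alpha> ^ ?m * (C ^ 2 * C1 * real ?m ^ 2 * (\<gamma> / \<alpha>) ^ n * growth ?m K n ^ (K - 1)))"
    by (simp add: power_add power2_eq_square ac_simps)
  finally show ?thesis .
qed

definition mean_loops :: "nat \<Rightarrow> nat \<Rightarrow> real" where
  "mean_loops K n = hole_expectation X \<alpha> n (\<lambda>F. loop_survival n F (K * n))"

lemma mean_loops_eq: "mean_loops K n = (\<Sum>w\<in>loops (K * n). p w * \<alpha> ^ card (cyclic_windows n w))"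
  unfolding mean_loops_def loop_survival_def hole_expectation_sum hole_expectation_cmult
  by (intro sum.cong refl) (simp add: hole_expectation_disjoint cyclic_windows_subset_words)

text \<open>Loops without a common window avoid the random set independently, so their pairs cancel
  against the squared mean and only meeting pairs remain.\<close>

lemma variance_loops:
  assumes n: "n \<ge> 1" and K: "K \<ge> 1"
  shows "hole_expectation X \<alpha> n (\<lambda>F. (loop_survival n F (K * n) - mean_loops K n) ^ 2)
    \<le> (\<alpha> ^ (K * n)) ^ 2 * (C ^ 2 * C1 * real (K * n) ^ 2 * (\<gamma> / \<alpha>) ^ n * growth (K * n) K n ^ (2 * K - 1))"
proof -
  let ?m = "K * n" and ?D = "cyclic_windows n" and ?M = "mean_loops K n"
  let ?E = "hole_expectation X \<alpha> n" and ?A = "\<lambda>F. loop_survival n F (K * n)"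
  define V where "V = \<alpha> ^ ?m * (C ^ 2 * C1 * real ?m ^ 2 * (\<gamma> / \<alpha>) ^ n * growth ?m K n ^ (K - 1))"
  have V0: "V \<ge> 0"
    using alpha_le_ge C C1 gamma order_trans[OF zero_le_one growth_ge_1] by (simp add: V_def)
  have "?E (\<lambda>F. (?A F - ?M) ^ 2) = ?E (\<lambda>F. ?A F ^ 2 + ((- 2 * ?M) * ?A F + ?M ^ 2))"
    by (rule arg_cong[where f = ?E]) (simp add: fun_eq_iff power2_eq_square algebra_simps)
  also have "\<dots> = ?E (\<lambda>F. ?A F ^ 2) - ?M ^ 2"
    unfolding hole_expectation_add hole_expectation_cmult hole_expectation_const mean_loops_def[symmetric]
    by (simp add: power2_eq_square)
  also have "?E (\<lambda>F. ?A F ^ 2) = (\<Sum>w\<in>loops ?m. \<Sum>w'\<in>loops ?m. p w * p w' * \<alpha> ^ card (?D w \<union> ?D w'))"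
  proof -
    have "?A F ^ 2 = (\<Sum>w\<in>loops ?m. \<Sum>w'\<in>loops ?m. (p w * p w') * of_bool ((?D w \<union> ?D w') \<inter> F = {}))" for F
      unfolding power2_eq_square loop_survival_def sum_product
      by (intro sum.cong refl) (auto simp: Int_Un_distrib2)
    then have "?E (\<lambda>F. ?A F ^ 2) = (\<Sum>w\<in>loops ?m. \<Sum>w'\<in>loops ?m. (p w * p w') * ?E (\<lambda>F. of_bool ((?D w \<union> ?D w') \<inter> F = {})))"
      by (simp only: hole_expectation_sum hole_expectation_cmult)
    also have "\<dots> = (\<Sum>w\<in>loops ?m. \<Sum>w'\<in>loops ?m. p w * p w' * \<alpha> ^ card (?D w \<union> ?D w'))"
      by (intro sum.cong refl arg_cong2[where f = "(*)"] hole_expectation_disjoint)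
        (use cyclic_windows_subset_words in blast)
    finally show ?thesis .
  qed
  also have "?M ^ 2 = (\<Sum>w\<in>loops ?m. \<Sum>w'\<in>loops ?m. p w * p w' * \<alpha> ^ (card (?D w) + card (?D w')))"
    unfolding power2_eq_square mean_loops_eq sum_product by (intro sum.cong refl) (simp add: power_add)
  also have "(\<Sum>w\<in>loops ?m. \<Sum>w'\<in>loops ?m. p w * p w' * \<alpha> ^ card (?D w \<union> ?D w'))
      - (\<Sum>w\<in>loops ?m. \<Sum>w'\<in>loops ?m. p w * p w' * \<alpha> ^ (card (?D w) + card (?D w')))
      = (\<Sum>w\<in>loops ?m. \<Sum>w'\<in>loops ?m. p w * p w' * \<alpha> ^ card (?D w \<union> ?D w') - p w * p w' * \<alpha> ^ (card (?D w) + card (?D w')))"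
    by (simp only: sum_subtractf)
  also have "\<dots> \<le> (\<Sum>w\<in>loops ?m. \<Sum>w'\<in>loops ?m. p w * (p w' * \<alpha> ^ card (?D w \<union> ?D w') * of_bool (?D w \<inter> ?D w' \<noteq> {})))"
  proof (intro sum_mono)
    fix w w'
    show "p w * p w' * \<alpha> ^ card (?D w \<union> ?D w') - p w * p w' * \<alpha> ^ (card (?D w) + card (?D w'))
        \<le> p w * (p w' * \<alpha> ^ card (?D w \<union> ?D w') * of_bool (?D w \<inter> ?D w' \<noteq> {}))"
    proof (cases "?D w \<inter> ?D w' = {}")
      case True
      then have "card (?D w \<union> ?D w') = card (?D w) + card (?D w')" by (intro card_Un_disjoint) auto
      then show ?thesis using True by simp
    next
      case False
      have "0 \<le> p w * p w' * \<alpha> ^ (card (?D w) + card (?D w'))" using p_nonneg alpha_le_ge by simp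
      then show ?thesis using False by simp
    qed
  qed
  also have "\<dots> = (\<Sum>w\<in>loops ?m. p w * (\<Sum>w'\<in>loops ?m. p w' * \<alpha> ^ card (?D w \<union> ?D w') * of_bool (?D w \<inter> ?D w' \<noteq> {})))"
    by (simp only: sum_distrib_left)
  also have "\<dots> \<le> (\<Sum>w\<in>loops ?m. p w * (\<alpha> ^ card (?D w) * V))"
    unfolding V_def by (intro sum_mono mult_left_mono p_nonneg sum_meeting_loops n K)
  also have "\<dots> = (\<Sum>w\<in>loops ?m. p w * \<alpha> ^ card (?D w)) * V"
    unfolding sum_distrib_right by (simp only: mult.assoc)
  also have "\<dots> \<le> (\<Sum>w\<in>listsn ?m. p w * \<alpha> ^ card (?D w)) * V"
    using V0 p_nonneg alpha_le_ge by (intro mult_right_mono sum_mono2) (auto simp: loops_def)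
  also have "\<dots> \<le> (\<alpha> ^ ?m * growth ?m K n ^ K) * V"
    using sum_power_windows[of "{}" ?m n K] V0 by (intro mult_right_mono) auto
  also have "\<dots> = (\<alpha> ^ ?m) ^ 2 * (C ^ 2 * C1 * real ?m ^ 2 * (\<gamma> / \<alpha>) ^ n * (growth ?m K n ^ K * growth ?m K n ^ (K - 1)))"
    by (simp add: V_def power2_eq_square ac_simps)
  \<comment> \<open>\<open>K\<close> blocks come from the first loop, but only \<open>K - 1\<close>
    from the second, whose first block is a window of the first.\<close>
  also have "growth ?m K n ^ K * growth ?m K n ^ (K - 1) = growth ?m K n ^ (2 * K - 1)"
    using K by (simp add: power_add[symmetric] mult_2)
  finally show ?thesis .
qed

text \<open>Repeated windows only raise the chance of avoidance, since a loop of length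
  \<open>K * n\<close> has at most that many windows.\<close>

lemma mean_loops_lower:
  assumes "c \<le> (\<Sum>w\<in>loops (K * n). p w)"
  shows "c * \<alpha> ^ (K * n) \<le> mean_loops K n"
proof -
  have "c * \<alpha> ^ (K * n) \<le> (\<Sum>w\<in>loops (K * n). p w) * \<alpha> ^ (K * n)"
    using assms alpha_le_ge by (intro mult_right_mono) auto
  also have "\<dots> = (\<Sum>w\<in>loops (K * n). p w * \<alpha> ^ (K * n))" by (simp add: sum_distrib_right)
  also have "\<dots> \<le> mean_loops K n"
    unfolding mean_loops_eq
  proof (intro sum_mono mult_left_mono power_decreasing p_nonneg)
    fix w assume "w \<in> loops (K * n)"
    then show "card (cyclic_windows n w) \<le> K * n"
      using card_cyclic_windows_le[of n w] by (simp add: loops_def)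
  qed (use alpha_le_ge in auto)
  finally show ?thesis .
qed

text \<open>On the bad event the loop survival is at most half of
  \<open>c * \<alpha> ^ (K * n)\<close>, a lower bound for its mean: by \<open>large\<close> the
  deviation at length \<open>K * n\<close> outweighs the number of prefixes. The square of that half
  produces the factor 4 in Chebyshev's inequality.\<close>

lemma lower_tail:
  assumes n: "n \<ge> 1" "memory \<le> n" and K: "K \<ge> 1"
    and c: "c > 0" "c \<le> (\<Sum>w\<in>loops (K * n). p w)"
    and large: "real (CARD('a)) ^ n * (C * exp (- \<epsilon> * real (K * n))) \<le> c / 2"
  shows "hole_prob X \<alpha> n (\<lambda>F. escape_rate \<mu> X (hole X F) \<le> ereal (ln \<alpha> - \<epsilon>))
    \<le> 4 / c ^ 2 * (C ^ 2 * C1 * real (K * n) ^ 2 * (\<gamma> / \<alpha>) ^ n * growth (K * n) K n ^ (2 * K - 1))"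
proof -
  let ?m = "K * n" and ?M = "mean_loops K n"
  have nm: "n \<le> ?m" using K by simp
  have M: "c * \<alpha> ^ ?m \<le> ?M" by (rule mean_loops_lower[OF c(2)])
  have ca: "c * \<alpha> ^ ?m > 0" using c alpha_pos by simp
  have "hole_prob X \<alpha> n (\<lambda>F. escape_rate \<mu> X (hole X F) \<le> ereal (ln \<alpha> - \<epsilon>))
      \<le> hole_expectation X \<alpha> n (\<lambda>F. (4 / (c * \<alpha> ^ ?m) ^ 2) * (loop_survival n F ?m - ?M) ^ 2)"
    unfolding hole_prob_eq_expectation
  proof (rule hole_expectation_mono[OF alpha_le_ge])
    fix F assume F: "F \<subseteq> words n X"
    show "of_bool (escape_rate \<mu> X (hole X F) \<le> ereal (ln \<alpha> - \<epsilon>)) \<le> (4 / (c * \<alpha> ^ ?m) ^ 2) * (loop_survival n F ?m - ?M) ^ 2"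
    proof (cases "escape_rate \<mu> X (hole X F) \<le> ereal (ln \<alpha> - \<epsilon>)")
      case True
      have "loop_survival n F ?m \<le> real (CARD('a)) ^ n * (C * exp ((ln \<alpha> - \<epsilon>) * real ?m))"
        by (rule loop_survival_upper_bound[OF F n(2) nm True])
      also have "exp ((ln \<alpha> - \<epsilon>) * real ?m) = exp (- \<epsilon> * real ?m) * \<alpha> ^ ?m"
      proof -
        have "\<alpha> ^ ?m = exp (ln \<alpha> * real ?m)"
          using alpha_pos by (metis exp_ln exp_of_nat_mult mult.commute)
        then show ?thesis by (simp add: exp_add[symmetric] algebra_simps)
      qed
      also have "real (CARD('a)) ^ n * (C * (exp (- \<epsilon> * real ?m) * \<alpha> ^ ?m))
          = real (CARD('a)) ^ n * (C * exp (- \<epsilon> * real ?m)) * \<alpha> ^ ?m" by simp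
      also have "\<dots> \<le> c / 2 * \<alpha> ^ ?m" using large alpha_le_ge by (intro mult_right_mono) auto
      finally have "c * \<alpha> ^ ?m / 2 \<le> ?M - loop_survival n F ?m" using M by simp
      then have "(c * \<alpha> ^ ?m / 2) ^ 2 \<le> (?M - loop_survival n F ?m) ^ 2"
        using ca by (intro power_mono) auto
      also have "\<dots> = (loop_survival n F ?m - ?M) ^ 2" by (rule power2_commute)
      finally have "(4 / (c * \<alpha> ^ ?m) ^ 2) * (c * \<alpha> ^ ?m / 2) ^ 2 \<le> (4 / (c * \<alpha> ^ ?m) ^ 2) * (loop_survival n F ?m - ?M) ^ 2"
        by (intro mult_left_mono) auto
      moreover have "(4 / (c * \<alpha> ^ ?m) ^ 2) * (c * \<alpha> ^ ?m / 2) ^ 2 = 1"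
        using alpha_pos c(1) by (simp add: power_divide)
      ultimately have "1 \<le> (4 / (c * \<alpha> ^ ?m) ^ 2) * (loop_survival n F ?m - ?M) ^ 2" by linarith
      then show ?thesis by (rule order_trans[rotated]) simp
    qed simp
  qed
  also have "\<dots> = (4 / (c * \<alpha> ^ ?m) ^ 2) * hole_expectation X \<alpha> n (\<lambda>F. (loop_survival n F ?m - ?M) ^ 2)"
    by (rule hole_expectation_cmult)
  also have "\<dots> \<le> (4 / (c * \<alpha> ^ ?m) ^ 2) * ((\<alpha> ^ ?m) ^ 2 * (C ^ 2 * C1 * real ?m ^ 2 * (\<gamma> / \<alpha>) ^ n * growth ?m K n ^ (2 * K - 1)))"
    by (intro mult_left_mono variance_loops n K) auto
  also have "\<dots> = 4 / c ^ 2 * (C ^ 2 * C1 * real ?m ^ 2 * (\<gamma> / \<alpha>) ^ n * growth ?m K n ^ (2 * K - 1))"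
    using alpha_pos c(1) by (simp add: power_mult_distrib)
  finally show ?thesis .
qed

end

section \<open>Polynomials against exponentials\<close>

lemma power_times_geometric_tendsto_0:
  fixes x :: real
  assumes "0 < x" "x < 1"
  shows "(\<lambda>n. real n ^ J * x ^ n) \<longlonglongrightarrow> 0"
proof -
  \<comment> \<open>With this root, \<open>n ^ (J + 1) * x ^ n\<close> is the power
    \<open>J + 1\<close> of \<open>n * y ^ n\<close>, which tends to 0.\<close>
  define y where "y = root (Suc J) x"
  have y: "0 < y" "y < 1" "y ^ Suc J = x"
    using assms real_root_pow_pos[of "Suc J" x] by (auto simp: y_def simp del: power_Suc)
  have "(\<lambda>n. real n * y ^ n) \<longlonglongrightarrow> 0"
    using powser_times_n_limit_0[of y] y by simp
  then have 1: "(\<lambda>n. (real n * y ^ n) ^ Suc J) \<longlonglongrightarrow> 0 ^ Suc J" by (rule tendsto_power)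
  show ?thesis
  proof (rule tendsto_sandwich[OF _ _ tendsto_const])
    show "(\<lambda>n. (real n * y ^ n) ^ Suc J) \<longlonglongrightarrow> 0" using 1 by simp
    show "\<forall>\<^sub>F n in sequentially. 0 \<le> real n ^ J * x ^ n" using assms by simp
    show "\<forall>\<^sub>F n in sequentially. real n ^ J * x ^ n \<le> (real n * y ^ n) ^ Suc J"
      using eventually_ge_at_top[of 1]
    proof eventually_elim
      case (elim n)
      have "(real n * y ^ n) ^ Suc J = real n ^ Suc J * x ^ n"
        unfolding power_mult_distrib y(3)[symmetric] by (simp only: power_mult[symmetric] mult.commute)
      moreover have "real n ^ J * x ^ n \<le> real n ^ Suc J * x ^ n"
        using elim assms by (intro mult_right_mono power_increasing) auto
      ultimately show ?case by (simp only:)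
    qed
  qed
qed

lemma poly_times_geometric_less_exp:
  fixes B \<theta> :: real
  assumes "0 < \<theta>" "\<theta> < 1"
  shows "\<exists>\<rho>>0. \<exists>N. \<forall>n\<ge>N. B * real n ^ J * \<theta> ^ n < exp (- \<rho> * real n)"
proof -
  \<comment> \<open>One factor \<open>s ^ n\<close> absorbs the polynomial; the other one remains
    and gives the rate \<rho> as \<open>- ln s\<close>.\<close>
  define s where "s = sqrt \<theta>"
  have s: "0 < s" "s < 1" "\<theta> = s * s" using assms by (auto simp: s_def)
  have "(\<lambda>n. B * (real n ^ J * s ^ n)) \<longlonglongrightarrow> B * 0"
    by (intro tendsto_mult_left power_times_geometric_tendsto_0 s)
  then have "\<forall>\<^sub>F n in sequentially. B * (real n ^ J * s ^ n) < 1"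
    by (intro order_tendstoD(2)[where y = "B * 0"]) auto
  then obtain N where N: "\<And>n. n \<ge> N \<Longrightarrow> B * (real n ^ J * s ^ n) < 1"
    by (auto simp: eventually_sequentially)
  show ?thesis
  proof (intro exI[of _ "- ln s"] exI[of _ N] conjI allI impI)
    show "- ln s > 0" using s by simp
    fix n assume "n \<ge> N"
    have "B * real n ^ J * \<theta> ^ n = B * (real n ^ J * s ^ n) * s ^ n"
      by (simp add: s(3) power_mult_distrib)
    also have "\<dots> < 1 * s ^ n" using N[OF \<open>n \<ge> N\<close>] s by (intro mult_strict_right_mono) auto
    also have "1 * s ^ n = exp (- (- ln s) * real n)"
      using s by (simp add: exp_of_nat2_mult)
    finally show "B * real n ^ J * \<theta> ^ n < exp (- (- ln s) * real n)" .
  qed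
qed

section \<open>Concentration of the escape rate\<close>

context quasi_bernoulli_decay
begin

lemma growth_le:
  assumes "n \<ge> 1"
  shows "growth (K * n) K n \<le> (1 + 2 * C * C1 * real K) * real n ^ 2"
proof -
  have "1 \<le> real n ^ 2" using assms by simp
  moreover have "growth (K * n) K n = 1 + 2 * C * C1 * real K * real n ^ 2"
    by (simp add: growth_def power2_eq_square algebra_simps)
  ultimately show ?thesis by (simp add: distrib_right)
qed

theorem escape_rate_concentration:
  assumes strict: "\<gamma> < \<alpha>" and eps: "\<epsilon> > 0"
  shows "\<exists>\<rho>>0. \<exists>N. \<forall>n\<ge>N.
           hole_prob X \<alpha> n (\<lambda>F. \<not> escape_rate_defined \<mu> X (hole X F)) = 0 \<and>
           hole_prob X \<alpha> n (\<lambda>F. escape_rate_defined \<mu> X (hole X F) \<and>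
               \<bar>escape_rate \<mu> X (hole X F) - ereal (ln \<alpha>)\<bar> \<ge> ereal \<epsilon>)
             < exp (- \<rho> * real n)"
proof -
  obtain c where c: "c > 0" "\<And>m. m \<ge> memory + 2 * gap \<Longrightarrow> c \<le> (\<Sum>w\<in>loops m. p w)"
    by (rule loops_mass) blast
  define a where "a = real (CARD('a))"
  have a1: "a \<ge> 1" by (simp add: a_def Suc_le_eq)
  \<comment> \<open>Chosen so that \<open>exp (- \<epsilon> * K)\<close> beats both
    \<open>1 / \<alpha>\<close> and the alphabet size \<open>a\<close>, each with a factor
    \<open>exp (- 1)\<close> to spare.\<close>
  obtain K :: nat where K: "(1 - ln \<alpha> + ln a) / \<epsilon> \<le> real K" using real_arch_simple by blast
  have lna: "ln a \<ge> 0" "ln \<alpha> \<le> 0" using a1 alpha alpha_pos by auto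
  have K': "\<epsilon> * real K \<ge> 1 - ln \<alpha> + ln a" using K eps by (simp add: field_simps)
  have K1: "K \<ge> 1"
  proof (rule ccontr)
    assume "\<not> K \<ge> 1"
    then have "K = 0" by simp
    then show False using K' lna by simp
  qed
  have expK: "(1 / \<alpha>) ^ n * exp (- \<epsilon> * real (K * n)) \<le> exp (- 1) ^ n"
    "a ^ n * exp (- \<epsilon> * real (K * n)) \<le> exp (- 1) ^ n" for n
  proof -
    have e: "exp (- \<epsilon> * real (K * n)) = exp (- (\<epsilon> * real K)) ^ n"
      by (simp add: exp_of_nat_mult[symmetric] algebra_simps)
    have "1 / \<alpha> = exp (- ln \<alpha>)" using alpha_pos by (simp add: exp_minus divide_inverse)
    then have "1 / \<alpha> * exp (- (\<epsilon> * real K)) \<le> exp (- 1)"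
      using K' lna by (simp add: exp_add[symmetric])
    then show "(1 / \<alpha>) ^ n * exp (- \<epsilon> * real (K * n)) \<le> exp (- 1) ^ n"
      unfolding e power_mult_distrib[symmetric] using alpha_pos by (intro power_mono) auto
    have "exp (ln a + - (\<epsilon> * real K)) \<le> exp (- 1)" using K' lna by simp
    then have "a * exp (- (\<epsilon> * real K)) \<le> exp (- 1)" unfolding exp_add using a1 by simp
    then show "a ^ n * exp (- \<epsilon> * real (K * n)) \<le> exp (- 1) ^ n"
      unfolding e power_mult_distrib[symmetric] using a1 by (intro power_mono) auto
  qed
  have "(\<lambda>n. C * exp (- 1) ^ n) \<longlonglongrightarrow> C * 0"
    by (intro tendsto_mult_left LIMSEQ_realpow_zero) auto
  then have "\<forall>\<^sub>F n in sequentially. C * exp (- 1) ^ n < c / 2"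
    using c(1) by (intro order_tendstoD(2)[where y = "C * 0"]) auto
  then obtain N0 where N0: "\<And>n. n \<ge> N0 \<Longrightarrow> C * exp (- 1) ^ n < c / 2"
    by (auto simp: eventually_sequentially)
  define g where "g = 1 + 2 * C * C1 * real K"
  have g1: "g \<ge> 1" using C C1 by (simp add: g_def)
  define \<theta> where "\<theta> = max (exp (- 1)) (\<gamma> / \<alpha>)"
  have th: "0 < \<theta>" "\<theta> < 1" using strict alpha_pos by (auto simp: \<theta>_def less_max_iff_disj)
  define B where "B = (C + 4 / c ^ 2 * (C ^ 2 * C1 * real K ^ 2)) * g ^ (2 * K)"
  \<comment> \<open>\<open>growth\<close> is at most quadratic in \<open>n\<close> and is raised to
    a power of at most \<open>2 * K\<close>; the factor \<open>(K * n) ^ 2\<close> of the variance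
    adds the remaining 2 to the exponent.\<close>
  obtain \<rho> N1 where \<rho>: "\<rho> > 0" "\<And>n. n \<ge> N1 \<Longrightarrow> B * real n ^ (4 * K + 2) * \<theta> ^ n < exp (- \<rho> * real n)"
    using poly_times_geometric_less_exp[OF th, of B "4 * K + 2"] by blast
  define N where "N = N0 + N1 + memory + 2 * gap + 1"
  show ?thesis
  proof (intro exI[of _ \<rho>] exI[of _ N] conjI allI impI)
    show "\<rho> > 0" by (rule \<rho>)
    fix n assume "n \<ge> N"
    then have n: "n \<ge> 1" "memory \<le> n" "n \<ge> N0" "n \<ge> N1" "n \<ge> memory + 2 * gap" by (auto simp: N_def)
    have defd: "escape_rate_defined \<mu> X (hole X F)" if "F \<subseteq> words n X" for F
      by (rule escape_rate_defined[OF that n(1)])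
    have "hole_prob X \<alpha> n (\<lambda>F. \<not> escape_rate_defined \<mu> X (hole X F)) = (\<Sum>F\<in>Pow (words n X). 0)"
      unfolding hole_prob_def using defd by (intro sum.cong refl) auto
    then show "hole_prob X \<alpha> n (\<lambda>F. \<not> escape_rate_defined \<mu> X (hole X F)) = 0" by simp
    let ?up = "\<lambda>F. escape_rate \<mu> X (hole X F) \<ge> ereal (ln \<alpha> + \<epsilon>)"
    let ?lo = "\<lambda>F. escape_rate \<mu> X (hole X F) \<le> ereal (ln \<alpha> - \<epsilon>)"
    \<comment> \<open>The rate may be \<open>- \<infinity>\<close>; that case falls into the lower
      tail.\<close>
    have split: "?up F \<or> ?lo F" if "\<bar>escape_rate \<mu> X (hole X F) - ereal (ln \<alpha>)\<bar> \<ge> ereal \<epsilon>" for F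
      using that by (cases "escape_rate \<mu> X (hole X F)") (auto simp: abs_if split: if_splits)
    have gr: "growth (K * n) K n ^ k \<le> g ^ (2 * K) * real n ^ (4 * K)" if "k \<le> 2 * K" for k
    proof -
      have "growth (K * n) K n ^ k \<le> (g * real n ^ 2) ^ k"
        unfolding g_def using growth_le[OF n(1), of K] order_trans[OF zero_le_one growth_ge_1]
        by (intro power_mono) auto
      also have "\<dots> \<le> (g * real n ^ 2) ^ (2 * K)"
        using g1 n that by (intro power_increasing mult_ge1_I) auto
      also have "\<dots> = g ^ (2 * K) * real n ^ (4 * K)"
        by (simp add: power_mult_distrib power_mult[symmetric])
      finally show ?thesis .
    qed
    have "hole_prob X \<alpha> n (\<lambda>F. escape_rate_defined \<mu> X (hole X F) \<and>
               \<bar>escape_rate \<mu> X (hole X F) - ereal (ln \<alpha>)\<bar> \<ge> ereal \<epsilon>)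
        \<le> hole_expectation X \<alpha> n (\<lambda>F. of_bool (?up F) + of_bool (?lo F))"
      unfolding hole_prob_eq_expectation
    proof (rule hole_expectation_mono[OF alpha_le_ge])
      fix F assume "F \<subseteq> words n X"
      show "of_bool (escape_rate_defined \<mu> X (hole X F) \<and> ereal \<epsilon> \<le> \<bar>escape_rate \<mu> X (hole X F) - ereal (ln \<alpha>)\<bar>)
          \<le> (of_bool (?up F) + of_bool (?lo F) :: real)"
        using split[of F] by (cases "ereal \<epsilon> \<le> \<bar>escape_rate \<mu> X (hole X F) - ereal (ln \<alpha>)\<bar>") auto
    qed
    also have "\<dots> = hole_prob X \<alpha> n ?up + hole_prob X \<alpha> n ?lo"
      unfolding hole_prob_eq_expectation hole_expectation_add ..
    also have "hole_prob X \<alpha> n ?up \<le> C * g ^ (2 * K) * real n ^ (4 * K + 2) * \<theta> ^ n"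
    proof -
      have gr': "growth (K * n) K n ^ K \<le> g ^ (2 * K) * real n ^ (4 * K + 2)"
      proof -
        have "growth (K * n) K n ^ K \<le> g ^ (2 * K) * real n ^ (4 * K)" by (rule gr) simp
        also have "\<dots> \<le> g ^ (2 * K) * real n ^ (4 * K + 2)"
          using g1 n by (intro mult_left_mono power_increasing) auto
        finally show ?thesis .
      qed
      \<comment> \<open>The upper tail holds for every \<open>N\<close> in \<open>growth\<close>;
        taking \<open>K * n\<close> lets both tails share the bound \<open>gr\<close>.\<close>
      have "hole_prob X \<alpha> n ?up \<le> C * growth (K * n) K n ^ K * ((1 / \<alpha>) ^ n * exp (- \<epsilon> * real (K * n)))"
        by (rule upper_tail[OF n(1) K1])
      also have "\<dots> \<le> C * (g ^ (2 * K) * real n ^ (4 * K + 2)) * \<theta> ^ n"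
      proof (intro mult_mono gr' refl)
        have "exp (- 1) ^ n \<le> \<theta> ^ n" by (intro power_mono) (auto simp: \<theta>_def)
        then show "(1 / \<alpha>) ^ n * exp (- \<epsilon> * real (K * n)) \<le> \<theta> ^ n" using expK(1)[of n] by linarith
      qed (use C g1 alpha_pos order_trans[OF zero_le_one growth_ge_1] in auto)
      finally show ?thesis by (simp add: mult.assoc)
    qed
    also have "hole_prob X \<alpha> n ?lo \<le> 4 / c ^ 2 * (C ^ 2 * C1 * real K ^ 2) * g ^ (2 * K) * real n ^ (4 * K + 2) * \<theta> ^ n"
    proof -
      have "c \<le> (\<Sum>w\<in>loops (K * n). p w)"
      proof (rule c(2))
        have "n \<le> K * n" using K1 by simp
        then show "memory + 2 * gap \<le> K * n" using n(5) by linarith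
      qed
      moreover have "real (CARD('a)) ^ n * (C * exp (- \<epsilon> * real (K * n))) \<le> c / 2"
      proof -
        have "C * (a ^ n * exp (- \<epsilon> * real (K * n))) \<le> C * exp (- 1) ^ n"
          using C expK(2) by (intro mult_left_mono) auto
        then show ?thesis using N0[OF n(3)] by (simp add: a_def ac_simps)
      qed
      ultimately have "hole_prob X \<alpha> n ?lo
          \<le> 4 / c ^ 2 * (C ^ 2 * C1 * real (K * n) ^ 2 * (\<gamma> / \<alpha>) ^ n * growth (K * n) K n ^ (2 * K - 1))"
        using lower_tail[OF n(1,2) K1 c(1)] by blast
      also have "\<dots> \<le> 4 / c ^ 2 * (C ^ 2 * C1 * real (K * n) ^ 2 * \<theta> ^ n * (g ^ (2 * K) * real n ^ (4 * K)))"
      proof (intro mult_left_mono mult_mono gr)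
        show "2 * K - 1 \<le> 2 * K" by simp
        show "(\<gamma> / \<alpha>) ^ n \<le> \<theta> ^ n" using gamma alpha_pos by (intro power_mono) (auto simp: \<theta>_def)
      qed (use C C1 gamma alpha_pos th order_trans[OF zero_le_one growth_ge_1] in auto)
      also have "\<dots> = 4 / c ^ 2 * (C ^ 2 * C1 * real K ^ 2) * g ^ (2 * K) * real n ^ (4 * K + 2) * \<theta> ^ n"
        by (simp add: power_add power2_eq_square)
      finally show ?thesis .
    qed
    also have "C * g ^ (2 * K) * real n ^ (4 * K + 2) * \<theta> ^ n
        + 4 / c ^ 2 * (C ^ 2 * C1 * real K ^ 2) * g ^ (2 * K) * real n ^ (4 * K + 2) * \<theta> ^ n
        = B * real n ^ (4 * K + 2) * \<theta> ^ n"
      by (simp only: B_def distrib_right)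
    also have "\<dots> < exp (- \<rho> * real n)" by (rule \<rho>(2)[OF n(4)])
    finally show "hole_prob X \<alpha> n (\<lambda>F. escape_rate_defined \<mu> X (hole X F) \<and>
               \<bar>escape_rate \<mu> X (hole X F) - ereal (ln \<alpha>)\<bar> \<ge> ereal \<epsilon>) < exp (- \<rho> * real n)"
      by simp
  qed
qed

end

theorem theorem1p2:
  fixes X :: "(nat \<Rightarrow> 'a::finite) set"
    and f :: "(nat \<Rightarrow> 'a) \<Rightarrow> real"
    and \<mu> :: "(nat \<Rightarrow> 'a) measure"
    and \<alpha> \<epsilon> :: real
  assumes "SFT X" and "top_mixing X" and "nontrivial_shift X"
    and "holder_potential X f"
    and "gibbs_measure X f \<mu>"
    and "gamma0 X \<mu> < \<alpha>" and "\<alpha> \<le> 1"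
    and "\<epsilon> > 0"
  shows "\<exists>\<rho>>0. \<exists>N. \<forall>n\<ge>N.
           hole_prob X \<alpha> n (\<lambda>F. \<not> escape_rate_defined \<mu> X (hole X F)) = 0 \<and>
           hole_prob X \<alpha> n (\<lambda>F. escape_rate_defined \<mu> X (hole X F) \<and>
               \<bar>escape_rate \<mu> X (hole X F) - ereal (ln \<alpha>)\<bar> \<ge> ereal \<epsilon>)
             < exp (- \<rho> * real n)"
proof -
  have nonempty: "X \<noteq> {}" using assms(3) by (auto simp: nontrivial_shift_def)
  obtain c \<theta> where h: "0 < \<theta>" "\<theta> < 1"
    "\<And>x y k. x \<in> X \<Longrightarrow> y \<in> X \<Longrightarrow> (\<And>i. i < k \<Longrightarrow> x i = y i) \<Longrightarrow> \<bar>f x - f y\<bar> \<le> c * \<theta> ^ k"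
    using assms(4) unfolding holder_potential_def by metis
  interpret holder_sft X f c \<theta>
  proof unfold_locales
    fix x y k assume "x \<in> X" "y \<in> X" "win x 0 k = win y 0 k"
    then show "\<bar>f x - f y\<bar> \<le> c * \<theta> ^ k"
      by (intro h(3)) (auto simp: win_eq_iff)
  qed (use assms nonempty h in auto)
  obtain C where C: "C \<ge> 1"
    "\<And>u v. measure \<mu> (cyl X (u @ v)) \<le> C * (measure \<mu> (cyl X u) * measure \<mu> (cyl X v))"
    "\<And>u v. u @ v \<in> language X \<Longrightarrow>
      measure \<mu> (cyl X u) * measure \<mu> (cyl X v) \<le> C * measure \<mu> (cyl X (u @ v))"
    "\<And>u. u \<in> language X \<Longrightarrow> measure \<mu> (cyl X u) > 0"
    by (rule gibbs_measure_quasi_bernoulli[OF assms(5)]) blast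
  have inv: "inv_prob X \<mu>" using assms(5) by (simp add: gibbs_measure_def equilibrium_state_def)
  interpret invariant_measure X \<mu> by unfold_locales (rule inv)
  interpret quasi_bernoulli X \<mu> C by unfold_locales (use C in \<open>auto simp: p_def\<close>)
  define S where "S = {\<gamma>::real. \<gamma> > 0 \<and> (\<exists>n0. \<forall>m\<ge>n0. \<forall>u\<in>words m X. measure \<mu> (cyl X u) \<le> \<gamma> ^ m)}"
  \<comment> \<open>The set under the infimum is nonempty, so it contains an element below
    \<alpha>.\<close>
  have "1 \<in> S" by (simp add: S_def)
  moreover have "Inf S < \<alpha>" using assms(6) by (simp add: gamma0_def S_def)
  ultimately obtain \<gamma> where "\<gamma> \<in> S" "\<gamma> < \<alpha>" using cInf_lessD[of S \<alpha>] by blast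
  then obtain n0 where g: "\<gamma> > 0" "\<gamma> < \<alpha>" "\<And>m u. m \<ge> n0 \<Longrightarrow> u \<in> words m X \<Longrightarrow> p u \<le> \<gamma> ^ m"
    by (auto simp: S_def p_def)
  have g1: "\<gamma> \<le> 1" using g assms(7) by linarith
  \<comment> \<open>This extends the decay from lengths at least \<open>n0\<close> to all lengths:
    for shorter words the right-hand side is at least 1.\<close>
  define C1 where "C1 = 1 / \<gamma> ^ n0"
  have C1: "C1 \<ge> 1" using g g1 by (simp add: C1_def power_le_one)
  interpret quasi_bernoulli_decay X \<mu> C C1 \<gamma> \<alpha>
  proof unfold_locales
    fix u :: "'a list"
    have pos: "0 \<le> C1 * \<gamma> ^ length u" using C1 g by simp
    show "p u \<le> C1 * \<gamma> ^ length u"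
    proof (cases "u \<in> language X")
      case True
      show ?thesis
      proof (cases "length u \<ge> n0")
        case long: True
        have "p u \<le> 1 * \<gamma> ^ length u" using g(3)[OF long] True by simp
        also have "\<dots> \<le> C1 * \<gamma> ^ length u" using C1 g by (intro mult_right_mono) auto
        finally show ?thesis .
      next
        case False
        then have "\<gamma> ^ n0 \<le> \<gamma> ^ length u" using g g1 by (intro power_decreasing) auto
        then have "1 \<le> C1 * \<gamma> ^ length u" using g by (simp add: C1_def field_simps)
        then show ?thesis using p_le_1[of u] by linarith
      qed
    next
      case False
      then show ?thesis using pos p_zero by simp
    qed
  qed (use g C1 assms in auto)
  show ?thesis by (rule escape_rate_concentration[OF g(2) assms(8)])
qed

end
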